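(* Let $X(K,U)$ be any Oeljeklaus-Toma manifold. Then $X(K,U)$ admits no balanced metric.
   Context: **Oeljeklaus-Toma (OT) manifolds.** Let $K$ be an algebraic number field of degree $[K:\mathbb{Q}]=s+2t$ with $s\ge 1$ real embeddings $\sigma_1,\ldots,\sigma_s:K\hookrightarrow\mathbb{R}$ and $2t$ ($t\ge 1$) non-real complex embeddings $\sigma_{s+1},\ldots,\sigma_{s+2t}:K\hookrightarrow\mathbb{C}$, ordered so that $\sigma_{s+t+i}=\overline{\sigma_{s+i}}$ for $1\le i\le t$. Let $\mathcal{O}_K$ be the ring of integers of $K$ and $\mathcal{O}_K^{*,+}$ the group of totally positive units, i.e. units $u$ with $\sigma_i(u)>0$ for all $1\le i\le s$. Let $\mathbb{H}=\{z\in\mathbb{C}:\mathrm{Im}\,z>0\}$. The group $\mathcal{O}_K$ acts on $\mathbb{H}^s\times\mathbb{C}^t$ by translations $$T_a(w_1,\ldots,w_s,z_1,\ldots,z_t)=(w_1+\sigma_1(a),\ldots,w_s+\sigma_s(a),z_1+\sigma_{s+1}(a),\ldots,z_t+\sigma_{s+t}(a)),$$ and $\mathcal{O}_K^{*,+}$ acts by $$R_u(w_1,\ldots,w_s,z_1,\ldots,z_t)=(\sigma_1(u)w_1,\ldots,\sigma_s(u)w_s,\sigma_{s+1}(u)z_1,\ldots,\sigma_{s+t}(u)z_t).$$ Define $l:\mathcal{O}_K^{*,+}\to\mathbb{R}^{s+t}$ by $l(u)=(\log\sigma_1(u),\ldots,\log\sigma_s(u),2\log|\sigma_{s+1}(u)|,\ldots,2\log|\sigma_{s+t}(u)|)$.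 A subgroup $U\subseteq\mathcal{O}_K^{*,+}$ is called admissible if it is free of rank $s$ and the projection of $l(U)$ to the first $s$ coordinates is a lattice of rank $s$ in $\mathbb{R}^s$. For admissible $U$ the action of $U\ltimes\mathcal{O}_K$ on $\mathbb{H}^s\times\mathbb{C}^t$ is fixed-point-free, properly discontinuous and cocompact, and the OT manifold of type $(s,t)$ associated to $K$ and the admissible subgroup $U$ is the compact complex manifold $X(K,U)=(\mathbb{H}^s\times\mathbb{C}^t)/(U\ltimes\mathcal{O}_K)$, of complex dimension $n=s+t$. **Metrics.** A Hermitian metric on a complex manifold of complex dimension $n$ is identified with its (smooth, real, positive) fundamental $(1,1)$-form $\Omega$. It is called balanced if $d\Omega^{n-1}=0$. *)

theory Defs
  imports "HOL-Analysis.Analysis"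
begin

section \<open>Differential forms on open subsets of a Euclidean space\<close>

text \<open>
  \<open>S\<close> is meant to be open. The clause for \<open>Suc k\<close> asks for Frechet differentiability together
  with \<open>k\<close>-fold continuous differentiability of all directional derivatives.
\<close>

primrec times_differentiable_on ::
    "nat \<Rightarrow> 'v::euclidean_space set \<Rightarrow> ('v \<Rightarrow> real) \<Rightarrow> bool" where
  "times_differentiable_on 0 S f \<longleftrightarrow> continuous_on S f"
| "times_differentiable_on (Suc k) S f \<longleftrightarrow>
     (\<forall>x\<in>S. f differentiable (at x)) \<and>
     (\<forall>v. times_differentiable_on k S (\<lambda>x. frechet_derivative f (at x) v))"

definition smooth_on :: "'v::euclidean_space set \<Rightarrow> ('v \<Rightarrow> real) \<Rightarrow> bool" where
  "smooth_on S f \<longleftrightarrow> (\<forall>k. times_differentiable_on k S f)"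

text \<open>
  A \<open>k\<close>-tuple of vectors is a function \<open>nat \<Rightarrow> 'v\<close> of which only the values at \<open>0, \<dots>, k - 1\<close> matter.
  The degree of a form is not part of its type; it is passed explicitly where it is needed.
\<close>

definition alternating_form :: "nat \<Rightarrow> ((nat \<Rightarrow> 'v::euclidean_space) \<Rightarrow> real) \<Rightarrow> bool" where
  "alternating_form k f \<longleftrightarrow>
     (\<forall>v w. (\<forall>i<k. v i = w i) \<longrightarrow> f v = f w) \<and>
     (\<forall>v. \<forall>i<k. linear (\<lambda>x. f (v(i := x)))) \<and>
     (\<forall>v. \<forall>i<k. \<forall>j<k. i \<noteq> j \<and> v i = v j \<longrightarrow> f v = 0)"

type_synonym 'v form = "'v \<Rightarrow> (nat \<Rightarrow> 'v) \<Rightarrow> real"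

definition smooth_form_on :: "nat \<Rightarrow> 'v::euclidean_space set \<Rightarrow> 'v form \<Rightarrow> bool" where
  "smooth_form_on k S \<alpha> \<longleftrightarrow>
     (\<forall>x\<in>S. alternating_form k (\<alpha> x)) \<and> (\<forall>v. smooth_on S (\<lambda>x. \<alpha> x v))"

text \<open>The normalisation is the one for which \<open>(dx \<and> dy) (u, v) = dx u * dy v - dx v * dy u\<close>.\<close>

definition wedge :: "nat \<Rightarrow> nat \<Rightarrow> 'v form \<Rightarrow> 'v form \<Rightarrow> 'v::euclidean_space form" where
  "wedge k l \<alpha> \<beta> = (\<lambda>x v.
     (\<Sum>\<pi> | \<pi> permutes {..<k + l}.
        of_int (sign \<pi>) * \<alpha> x (\<lambda>i. v (\<pi> i)) * \<beta> x (\<lambda>i. v (\<pi> (k + i)))) / (fact k * fact l))"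

primrec wedge_power :: "nat \<Rightarrow> 'v form \<Rightarrow> nat \<Rightarrow> 'v::euclidean_space form" where
  "wedge_power k \<alpha> 0 = (\<lambda>x v. 1)"
| "wedge_power k \<alpha> (Suc m) = wedge k (k * m) \<alpha> (wedge_power k \<alpha> m)"

text \<open>
  The invariant formula for the exterior derivative, evaluated on constant vector fields, so that
  the terms containing Lie brackets vanish.
\<close>

definition ext_deriv :: "nat \<Rightarrow> 'v form \<Rightarrow> 'v::euclidean_space form" where
  "ext_deriv k \<alpha> = (\<lambda>x v.
     \<Sum>i\<le>k. (- 1) ^ i *
       frechet_derivative (\<lambda>y. \<alpha> y (\<lambda>j. if j < i then v j else v (Suc j))) (at x) (v i))"


section \<open>Forms and Hermitian metrics on a complex manifold given by an atlas\<close>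

text \<open>
  A chart is a pair of its domain and its coordinate map; the coordinate map is only relevant on
  the domain. A complex manifold of dimension \<open>CARD('n)\<close> is given by an atlas of charts with open
  images in \<open>\<complex>\<^sup>n\<close> and holomorphic coordinate changes, and a form on it by its coordinate
  expressions, one for each chart, which correspond to each other under the coordinate changes.
\<close>

type_synonym ('x, 'n) chart = "'x set \<times> ('x \<Rightarrow> complex ^ 'n)"

definition chart_image :: "('x, 'n) chart \<Rightarrow> (complex ^ 'n) set" where
  "chart_image c = snd c ` fst c"

definition transition ::
    "('x, 'n::finite) chart \<Rightarrow> ('x, 'n) chart \<Rightarrow> complex ^ 'n \<Rightarrow> complex ^ 'n" where
  "transition c c' = snd c' \<circ> inv_into (fst c) (snd c)"

type_synonym ('x, 'n) manifold_form = "('x, 'n) chart \<Rightarrow> (complex ^ 'n) form"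

definition manifold_form_on ::
    "nat \<Rightarrow> ('x, 'n::finite) chart set \<Rightarrow> ('x, 'n) manifold_form \<Rightarrow> bool" where
  "manifold_form_on k A \<alpha> \<longleftrightarrow>
     (\<forall>c\<in>A. smooth_form_on k (chart_image c) (\<alpha> c)) \<and>
     (\<forall>c\<in>A. \<forall>c'\<in>A. \<forall>p\<in>fst c \<inter> fst c'. \<forall>v.
        \<alpha> c (snd c p) v =
        \<alpha> c' (snd c' p) (\<lambda>i. frechet_derivative (transition c c') (at (snd c p)) (v i)))"

text \<open>
  A Hermitian metric is identified with its fundamental form: a real 2-form \<open>\<omega>\<close> which is of type
  \<open>(1,1)\<close>, i.e. \<open>\<omega> (J v, J w) = \<omega> (v, w)\<close> for the complex structure \<open>J v = \<i> v\<close>, and positive,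
  i.e. \<open>\<omega> (v, J v) > 0\<close> for \<open>v \<noteq> 0\<close>.
\<close>

definition hermitian_metric ::
    "('x, 'n::finite) chart set \<Rightarrow> ('x, 'n) manifold_form \<Rightarrow> bool" where
  "hermitian_metric A \<Omega> \<longleftrightarrow>
     manifold_form_on 2 A \<Omega> \<and>
     (\<forall>c\<in>A. \<forall>x\<in>chart_image c.
        (\<forall>v. \<Omega> c x (\<lambda>i. \<i> *s v i) = \<Omega> c x v) \<and>
        (\<forall>u. u \<noteq> 0 \<longrightarrow> \<Omega> c x (\<lambda>i. if i = 0 then u else \<i> *s u) > 0))"

definition balanced_metric ::
    "('x, 'n::finite) chart set \<Rightarrow> ('x, 'n) manifold_form \<Rightarrow> bool" where
  "balanced_metric A \<Omega> \<longleftrightarrow>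
     hermitian_metric A \<Omega> \<and>
     (\<forall>c\<in>A. \<forall>x\<in>chart_image c. \<forall>v.
        ext_deriv (2 * (CARD('n) - 1)) (wedge_power 2 (\<Omega> c) (CARD('n) - 1)) x v = 0)"


section \<open>Number fields and their embeddings\<close>

text \<open>
  A number field is a type \<open>'k\<close> of characteristic 0 whose dimension over the rationals is finite.
\<close>

lemma vector_space_of_rat: "vector_space (\<lambda>(q::rat) (x::'k::field_char_0). of_rat q * x)"
  by unfold_locales (simp_all add: algebra_simps of_rat_add of_rat_mult)

definition degree_over_rat :: "'k::field_char_0 itself \<Rightarrow> nat" where
  "degree_over_rat _ = vector_space.dim (\<lambda>(q::rat) (x::'k). of_rat q * x) UNIV"

definition field_embedding :: "('k::field \<Rightarrow> 'l::field) \<Rightarrow> bool" where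
  "field_embedding f \<longleftrightarrow>
     f 1 = 1 \<and> (\<forall>x y. f (x + y) = f x + f y) \<and> (\<forall>x y. f (x * y) = f x * f y)"

text \<open>
  \<open>\<sigma>\<close> enumerates the \<open>s = CARD('s)\<close> real embeddings and \<open>\<tau>\<close>, together with its complex conjugates,
  the \<open>2 t = 2 * CARD('t)\<close> non-real ones. Index types are nonempty, hence \<open>s \<ge> 1\<close> and \<open>t \<ge> 1\<close>.
  The dimension of an infinite-dimensional space is 0 by convention, so the condition on the
  degree includes that it is finite.
\<close>

definition number_field_embeddings ::
    "('s::finite \<Rightarrow> 'k::field_char_0 \<Rightarrow> real) \<Rightarrow> ('t::finite \<Rightarrow> 'k \<Rightarrow> complex) \<Rightarrow> bool" where
  "number_field_embeddings \<sigma> \<tau> \<longleftrightarrow>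
     degree_over_rat TYPE('k) = CARD('s) + 2 * CARD('t) \<and>
     bij_betw \<sigma> UNIV {f. field_embedding f} \<and>
     bij_betw (case_sum \<tau> (\<lambda>j x. cnj (\<tau> j x))) (UNIV :: ('t + 't) set)
       {f. field_embedding f \<and> \<not> range f \<subseteq> \<real>}"

definition ring_of_integers :: "'k::field_char_0 set" where
  "ring_of_integers = {a. algebraic_int a}"

definition totally_positive_units ::
    "('s \<Rightarrow> 'k::field_char_0 \<Rightarrow> real) \<Rightarrow> 'k set" where
  "totally_positive_units \<sigma> =
     {u. u \<noteq> 0 \<and> u \<in> ring_of_integers \<and> inverse u \<in> ring_of_integers \<and> (\<forall>i. \<sigma> i u > 0)}"


section \<open>Admissible subgroups\<close>

definition mult_subgroup :: "'k::field set \<Rightarrow> bool" where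
  "mult_subgroup U \<longleftrightarrow>
     1 \<in> U \<and> (\<forall>u\<in>U. \<forall>v\<in>U. u * v \<in> U) \<and> (\<forall>u\<in>U. u \<noteq> 0 \<and> inverse u \<in> U)"

definition free_of_rank :: "nat \<Rightarrow> 'k::field set \<Rightarrow> bool" where
  "free_of_rank r U \<longleftrightarrow>
     (\<exists>B\<subseteq>U. finite B \<and> card B = r \<and>
        bij_betw (\<lambda>m. \<Prod>b\<in>B. b powi (m b)) (B \<rightarrow>\<^sub>E (UNIV :: int set)) U)"

definition lattice_of_rank :: "nat \<Rightarrow> 'v::real_vector set \<Rightarrow> bool" where
  "lattice_of_rank r L \<longleftrightarrow>
     (\<exists>B. finite B \<and> independent B \<and> card B = r \<and>
        L = range (\<lambda>m :: 'v \<Rightarrow> int. \<Sum>b\<in>B. of_int (m b) *\<^sub>R b))"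

definition log_embedding ::
    "('s::finite \<Rightarrow> 'k \<Rightarrow> real) \<Rightarrow> ('t::finite \<Rightarrow> 'k \<Rightarrow> complex) \<Rightarrow> 'k \<Rightarrow> real ^ ('s + 't)" where
  "log_embedding \<sigma> \<tau> u =
     (\<chi> i. case i of Inl i \<Rightarrow> ln (\<sigma> i u) | Inr j \<Rightarrow> 2 * ln (cmod (\<tau> j u)))"

definition first_coords :: "real ^ ('s::finite + 't::finite) \<Rightarrow> real ^ 's" where
  "first_coords y = (\<chi> i. y $ Inl i)"

definition admissible ::
    "('s::finite \<Rightarrow> 'k::field_char_0 \<Rightarrow> real) \<Rightarrow> ('t::finite \<Rightarrow> 'k \<Rightarrow> complex) \<Rightarrow> 'k set \<Rightarrow> bool" where
  "admissible \<sigma> \<tau> U \<longleftrightarrow>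
     U \<subseteq> totally_positive_units \<sigma> \<and> mult_subgroup U \<and>
     free_of_rank (CARD('s)) U \<and>
     lattice_of_rank (CARD('s)) (first_coords ` log_embedding \<sigma> \<tau> ` U)"


section \<open>Oeljeklaus-Toma manifolds\<close>

text \<open>The space \<open>\<H>\<^sup>s \<times> \<complex>\<^sup>t\<close> is regarded as an open subset of \<open>\<complex>\<^sup>n\<close>, where \<open>n = s + t\<close>.\<close>

definition OT_cover :: "(complex ^ ('s::finite + 't::finite)) set" where
  "OT_cover = {z. \<forall>i. Im (z $ Inl i) > 0}"

definition OT_translation ::
    "('s::finite \<Rightarrow> 'k \<Rightarrow> real) \<Rightarrow> ('t::finite \<Rightarrow> 'k \<Rightarrow> complex) \<Rightarrow> 'k \<Rightarrow>
     complex ^ ('s + 't) \<Rightarrow> complex ^ ('s + 't)" where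
  "OT_translation \<sigma> \<tau> a z =
     (\<chi> i. z $ i + (case i of Inl i \<Rightarrow> of_real (\<sigma> i a) | Inr j \<Rightarrow> \<tau> j a))"

definition OT_rotation ::
    "('s::finite \<Rightarrow> 'k \<Rightarrow> real) \<Rightarrow> ('t::finite \<Rightarrow> 'k \<Rightarrow> complex) \<Rightarrow> 'k \<Rightarrow>
     complex ^ ('s + 't) \<Rightarrow> complex ^ ('s + 't)" where
  "OT_rotation \<sigma> \<tau> u z =
     (\<chi> i. (case i of Inl i \<Rightarrow> of_real (\<sigma> i u) | Inr j \<Rightarrow> \<tau> j u) * z $ i)"

definition OT_orbit ::
    "('s::finite \<Rightarrow> 'k::field_char_0 \<Rightarrow> real) \<Rightarrow> ('t::finite \<Rightarrow> 'k \<Rightarrow> complex) \<Rightarrow> 'k set \<Rightarrow>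
     complex ^ ('s + 't) \<Rightarrow> (complex ^ ('s + 't)) set" where
  "OT_orbit \<sigma> \<tau> U z =
     {OT_translation \<sigma> \<tau> a (OT_rotation \<sigma> \<tau> u z) | u a. u \<in> U \<and> a \<in> ring_of_integers}"

text \<open>
  The points of \<open>X(K,U)\<close> are the orbits of \<open>U \<ltimes> O\<^sub>K\<close> on \<open>\<H>\<^sup>s \<times> \<complex>\<^sup>t\<close>, and its complex structure
  is the one for which the projection \<open>\<pi>\<close>, which sends a point to its orbit, is locally
  biholomorphic: the charts are the inverses of \<open>\<pi>\<close> on the open sets on which \<open>\<pi>\<close> is injective.
\<close>

definition OT_atlas ::
    "('s::finite \<Rightarrow> 'k::field_char_0 \<Rightarrow> real) \<Rightarrow> ('t::finite \<Rightarrow> 'k \<Rightarrow> complex) \<Rightarrow> 'k set \<Rightarrow>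
     ((complex ^ ('s + 't)) set, 's + 't) chart set" where
  "OT_atlas \<sigma> \<tau> U =
     {(OT_orbit \<sigma> \<tau> U ` V, inv_into V (OT_orbit \<sigma> \<tau> U)) | V.
        open V \<and> V \<subseteq> OT_cover \<and> inj_on (OT_orbit \<sigma> \<tau> U) V}"

end

theory Submission
  imports Defs
begin

text \<open>
Let \<open>w\<^sub>k = x\<^sub>k + \<i> y\<^sub>k\<close> and \<open>z\<^sub>j\<close> be the coordinates of \<open>\<H>\<^sup>s \<times> \<complex>\<^sup>t\<close>. The 1-form \<open>dx\<^sub>0 / y\<^sub>0\<close>, for one of
the coordinates \<open>w\<^sub>0\<close>, is invariant under translations by real numbers and under scaling by positive
ones, hence it lives on \<open>X(K,U)\<close>, and its differential \<open>dx\<^sub>0 \<and> dy\<^sub>0 / y\<^sub>0\<^sup>2\<close> is a semipositive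
\<open>(1,1)\<close>-form that vanishes nowhere. If \<open>\<Omega>\<close> is balanced, then
\<open>d (dx\<^sub>0 / y\<^sub>0 \<and> \<Omega>\<^sup>n\<^sup>-\<^sup>1) = dx\<^sub>0 \<and> dy\<^sub>0 / y\<^sub>0\<^sup>2 \<and> \<Omega>\<^sup>n\<^sup>-\<^sup>1\<close> is a positive volume form on a compact manifold, and it
is exact. This contradicts Stokes' theorem.

Stokes' theorem on \<open>X(K,U)\<close> is replaced by the divergence theorem on large boxes in the cover. In
the coordinates \<open>x\<^sub>k, log y\<^sub>k, z\<^sub>j\<close> the components of the form \<open>dx\<^sub>0 / y\<^sub>0 \<and> \<Omega>\<^sup>n\<^sup>-\<^sup>1\<close> are functions \<open>flux i\<close>,
one for each real coordinate except \<open>x\<^sub>0\<close>, and closedness of \<open>\<Omega>\<^sup>n\<^sup>-\<^sup>1\<close> says that their divergence is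
\<open>- flux 0\<close> (\<open>sum_flux_deriv\<close>). The components in the directions \<open>log y\<^sub>k\<close> are invariant under
the whole group (\<open>flux_deck\<close>, where it matters that units have norm 1), hence bounded on
the cover, and \<open>flux 0\<close>, which is positive, is bounded below by a constant \<open>c > 0\<close>. The other
components are invariant under the translations only, so they are bounded where all \<open>log y\<^sub>k\<close> are
bounded. On a box of side length \<open>S\<close> in the directions \<open>log y\<^sub>k\<close> and \<open>R\<close> in the others, the mean of
the divergence is at most \<open>- c\<close>, but by \<open>flux_bound\<close> its absolute value is at most
\<open>const / S + const (S) / R\<close>. Choosing \<open>S\<close> and then \<open>R\<close> large gives the contradiction
(\<open>no_balanced_frame\<close>).

Boundedness of invariant functions needs compact sets that meet every orbit. For the units this
is the lattice condition on \<open>U\<close>. For the translations it is enough that the image of the ring of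
integers spans \<open>\<real>\<^sup>s \<times> \<complex>\<^sup>t\<close> (\<open>span_integers\<close>), which is Dedekind's independence of the
embeddings. That the metric can be pulled back to the cover at all requires charts around every
point (\<open>evenly_covered\<close>), that is, discreteness of the group: a nonzero algebraic integer has a norm
of absolute value at least 1, and \<open>U\<close> is discrete by the lattice condition. Positivity of \<open>flux 0\<close> is the
positivity of \<open>\<Omega>\<^sup>n\<^sup>-\<^sup>1\<close> on the complex hyperplane \<open>dw\<^sub>0 = 0\<close> (\<open>wedge_power_pos\<close>).
\<close>

section \<open>Algebraic integers and field embeddings\<close>

text \<open>Fraction-free Gaussian elimination. A system whose diagonal consists of monic polynomials of degree
\<open>d\<close> and whose other entries have smaller degree keeps this shape, with \<open>2 d\<close> in place of \<open>d\<close>, when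
the last unknown is eliminated. So a nonzero solution forces \<open>x\<close> to be a root of a monic
polynomial. This takes the place of the characteristic polynomial of an integer matrix of variable size.\<close>

lemma monic_root_of_dominant_system:
  fixes x :: "'k::field_char_0" and v :: "nat \<Rightarrow> 'k" and p :: "nat \<Rightarrow> nat \<Rightarrow> 'k poly"
  assumes "\<And>i. i < n \<Longrightarrow> lead_coeff (p i i) = 1 \<and> degree (p i i) = d"
    and "\<And>i j. i < n \<Longrightarrow> j < n \<Longrightarrow> i \<noteq> j \<Longrightarrow> degree (p i j) < d"
    and "\<And>i j k. i < n \<Longrightarrow> j < n \<Longrightarrow> coeff (p i j) k \<in> \<int>"
    and "\<And>i. i < n \<Longrightarrow> (\<Sum>j<n. poly (p i j) x * v j) = 0"
    and "j < n" and "v j \<noteq> 0"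
  shows "algebraic_int x"
  using assms
proof (induction n arbitrary: p d j)
  case 0
  then show ?case by simp
next
  case (Suc n)
  note mon = Suc.prems(1) and off = Suc.prems(2) and int = Suc.prems(3) and sys = Suc.prems(4)
  show ?case
  proof (cases "\<exists>j<n. v j \<noteq> 0")
    case False
    then have z: "v j = 0" if "j < n" for j using that by auto
    with Suc.prems have vn: "v n \<noteq> 0" by (metis less_Suc_eq)
    have "poly (p n n) x * v n = 0" using sys[of n] z by simp
    with vn have "poly (p n n) x = 0" by simp
    then show ?thesis using mon[of n] int by (intro algebraic_int.intros[of "p n n"]) auto
  next
    case True
    then obtain j' where j': "j' < n" "v j' \<noteq> 0" by auto
    have d: "0 < d" using off[of 0 n] j'(1) by (cases d) auto
    \<comment> \<open>the equation \<open>i\<close> times the pivot, minus the multiple of the last equation that removes \<open>v n\<close>\<close>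
    define q where "q i j = p n n * p i j - p i n * p n j" for i j
    show ?thesis
    proof (rule Suc.IH[of q "d + d" j'])
      fix i assume i: "i < n"
      have pn: "p n n \<noteq> 0" and pi: "p i i \<noteq> 0" using mon[of n] mon[of i] i by auto
      have 1: "degree (p n n * p i i) = d + d"
        using degree_mult_eq[OF pn pi] mon[of n] mon[of i] i by auto
      have 2: "lead_coeff (p n n * p i i) = 1"
        using mon[of n] mon[of i] i by (auto simp: lead_coeff_mult)
      have 3: "degree (p i n * p n i) < d + d"
        using degree_mult_le[of "p i n" "p n i"] off[of i n] off[of n i] i by auto
      have 4: "degree (q i i) = d + d" unfolding q_def diff_conv_add_uminus
        using 1 3 by (subst degree_add_eq_left) auto
      have "coeff (q i i) (d+d) = 1" unfolding q_def
        using 1 2 3 by (simp add: coeff_eq_0)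
      with 4 show "lead_coeff (q i i) = 1 \<and> degree (q i i) = d + d" by simp
    next
      fix i j assume i: "i < n" "j < n" "i \<noteq> j"
      have "degree (p n n * p i j) < d + d"
        using degree_mult_le[of "p n n" "p i j"] off[of i j] mon[of n] i by auto
      moreover have "degree (p i n * p n j) < d + d"
        using degree_mult_le[of "p i n" "p n j"] off[of i n] off[of n j] i by auto
      ultimately show "degree (q i j) < d + d" unfolding q_def
        by (meson degree_diff_less)
    next
      fix i j k assume "i < n" "j < n"
      then show "coeff (q i j) k \<in> \<int>" unfolding q_def
        by (auto simp: coeff_mult intro!: Ints_diff Ints_sum Ints_mult int)
    next
      fix i assume i: "i < n"
      have a: "(\<Sum>j<n. poly (p n j) x * v j) = - (poly (p n n) x * v n)"
        using sys[of n] by (simp add: eq_neg_iff_add_eq_0)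
      have b: "(\<Sum>j<n. poly (p i j) x * v j) = - (poly (p i n) x * v n)"
        using sys[of i] i by (simp add: eq_neg_iff_add_eq_0)
      have "(\<Sum>j<n. poly (q i j) x * v j) = poly (p n n) x * (\<Sum>j<n. poly (p i j) x * v j)
          - poly (p i n) x * (\<Sum>j<n. poly (p n j) x * v j)"
        unfolding q_def by (simp add: sum_distrib_left sum_subtractf algebra_simps)
      then show "(\<Sum>j<n. poly (q i j) x * v j) = 0" unfolding a b by simp
    qed (use j' in auto)
  qed
qed

text \<open>The relations say that \<open>v\<close> is in the kernel of \<open>x I - A\<close> for an integer matrix \<open>A\<close>, a system
of the above kind with \<open>d = 1\<close>.\<close>

lemma algebraic_int_if_stable_lattice:
  fixes x :: "'k::field_char_0" and v :: "'i \<Rightarrow> 'k"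
  assumes "finite I" and "\<And>i. i \<in> I \<Longrightarrow> \<exists>c :: 'i \<Rightarrow> int. x * v i = (\<Sum>j\<in>I. of_int (c j) * v j)"
    and "i0 \<in> I" "v i0 \<noteq> 0"
  shows "algebraic_int x"
proof -
  obtain f where f: "bij_betw f {..<card I} I"
    using \<open>finite I\<close> ex_bij_betw_nat_finite[of I] by (auto simp: atLeast0LessThan)
  from assms(2) obtain c :: "'i \<Rightarrow> 'i \<Rightarrow> int" where c: "\<And>i. i \<in> I \<Longrightarrow> x * v i = (\<Sum>j\<in>I. of_int (c i j) * v j)"
    by metis
  have fI: "f i \<in> I" if "i < card I" for i using f that by (auto simp: bij_betw_def)
  have "i0 \<in> f ` {..<card I}" using f assms(3) by (simp add: bij_betw_def)
  then obtain j0 where j0: "j0 < card I" "f j0 = i0" by auto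
  define p :: "nat \<Rightarrow> nat \<Rightarrow> 'k poly" where
    "p i j = (if i = j then [:- of_int (c (f i) (f i)), 1:] else [:- of_int (c (f i) (f j)):])" for i j
  have ev: "poly (p i j) x = (if i = j then x else 0) - of_int (c (f i) (f j))" for i j
    by (simp add: p_def)
  show ?thesis
  proof (rule monic_root_of_dominant_system[of "card I" p 1 x "\<lambda>j. v (f j)" j0])
    fix i assume i: "i < card I"
    have "(\<Sum>j<card I. poly (p i j) x * v (f j))
       = (\<Sum>j<card I. (if i = j then x * v (f j) else 0)) - (\<Sum>j<card I. of_int (c (f i) (f j)) * v (f j))"
      unfolding sum_subtractf[symmetric] ev by (intro sum.cong) (auto simp: algebra_simps)
    also have "(\<Sum>j<card I. of_int (c (f i) (f j)) * v (f j)) = x * v (f i)"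
      unfolding c[OF fI[OF i]] by (rule sum.reindex_bij_betw[OF f])
    finally show "(\<Sum>j<card I. poly (p i j) x * v (f j)) = 0" using i by simp
  qed (use j0 assms(4) in \<open>auto simp: p_def coeff_pCons split: nat.split\<close>)
qed

definition int_span :: "('i \<Rightarrow> 'k::field_char_0) \<Rightarrow> 'i set \<Rightarrow> 'k set" where
  "int_span v I = {\<Sum>j\<in>I. of_int (c j) * v j | c. True}"

lemma int_span_base: "finite I \<Longrightarrow> i \<in> I \<Longrightarrow> v i \<in> int_span v I"
  unfolding int_span_def
  by (auto intro!: exI[of _ "\<lambda>j. if j = i then 1 else 0"] simp: if_distrib[of of_int] if_distrib[of "\<lambda>z. z * _"] cong: if_cong)

lemma int_span_0: "0 \<in> int_span v I"
  unfolding int_span_def by (auto intro!: exI[of _ "\<lambda>_. 0"])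

lemma int_span_add: "a \<in> int_span v I \<Longrightarrow> b \<in> int_span v I \<Longrightarrow> a + b \<in> int_span v I"
proof -
  assume "a \<in> int_span v I" "b \<in> int_span v I"
  then obtain c c' where "a = (\<Sum>j\<in>I. of_int (c j) * v j)" "b = (\<Sum>j\<in>I. of_int (c' j) * v j)"
    unfolding int_span_def by auto
  then have "a + b = (\<Sum>j\<in>I. of_int (c j + c' j) * v j)"
    by (simp add: algebra_simps sum.distrib)
  then show ?thesis unfolding int_span_def by (intro CollectI exI[of _ "\<lambda>j. c j + c' j"] conjI TrueI)
qed

lemma int_span_scale: "a \<in> int_span v I \<Longrightarrow> of_int m * a \<in> int_span v I"
proof -
  assume "a \<in> int_span v I"
  then obtain c where "a = (\<Sum>j\<in>I. of_int (c j) * v j)"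
    unfolding int_span_def by auto
  then have "of_int m * a = (\<Sum>j\<in>I. of_int (m * c j) * v j)"
    by (simp add: sum_distrib_left mult.assoc)
  then show ?thesis unfolding int_span_def by (intro CollectI exI[of _ "\<lambda>j. m * c j"] conjI TrueI)
qed

lemma int_span_sum: "(\<And>k. k \<in> S \<Longrightarrow> f k \<in> int_span v I) \<Longrightarrow> (\<Sum>k\<in>S. f k) \<in> int_span v I"
  by (induction S rule: infinite_finite_induct) (auto intro: int_span_0 int_span_add)

lemma int_span_mult_stable:
  assumes "\<And>i. i \<in> I \<Longrightarrow> x * v i \<in> int_span v I" "y \<in> int_span v I"
  shows "x * y \<in> int_span v I"
proof -
  from assms(2) obtain c where "y = (\<Sum>j\<in>I. of_int (c j) * v j)"
    unfolding int_span_def by auto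
  then have "x * y = (\<Sum>j\<in>I. of_int (c j) * (x * v j))"
    by (simp add: sum_distrib_left algebra_simps)
  then show ?thesis using assms(1) by (auto intro!: int_span_sum int_span_scale)
qed

lemma algebraic_int_if_stable_int_span:
  assumes "finite I" "\<And>i. i \<in> I \<Longrightarrow> x * v i \<in> int_span v I" "i0 \<in> I" "v i0 \<noteq> 0"
  shows "algebraic_int x"
  using assms by (intro algebraic_int_if_stable_lattice[of I x v i0]) (auto simp: int_span_def)

lemma algebraic_int_power_reduction:
  fixes a :: "'k::field_char_0"
  assumes "algebraic_int a"
  obtains n and c :: "nat \<Rightarrow> int" where "n > 0" "a ^ n = (\<Sum>i<n. of_int (c i) * a ^ i)"
proof -
  obtain p :: "int poly" where p: "poly (map_poly of_int p) a = 0" "lead_coeff p = 1"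
    using assms by (auto simp: algebraic_int_altdef_ipoly)
  define n where "n = degree p"
  have "(\<Sum>i\<le>n. of_int (coeff p i) * a ^ i) = 0"
    using p by (simp add: poly_altdef degree_map_poly coeff_map_poly n_def)
  then have e: "(\<Sum>i<n. of_int (coeff p i) * a ^ i) + a ^ n = 0"
    using p by (simp add: lessThan_Suc_atMost[symmetric] n_def)
  then have "n > 0" by (cases n) auto
  moreover have "a ^ n = (\<Sum>i<n. of_int (- coeff p i) * a ^ i)"
    using e by (simp add: sum_negf eq_neg_iff_add_eq_0 add.commute)
  ultimately show ?thesis by (rule that)
qed

text \<open>The products \<open>a\<^sup>i b\<^sup>j\<close> below the degrees of monic equations for \<open>a\<close> and \<open>b\<close> span a
group that is stable under both, and hence under their sum and their product.\<close>

lemma algebraic_int_common_lattice: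
  fixes a b :: "'k::field_char_0"
  assumes "algebraic_int a" "algebraic_int b"
  obtains I :: "(nat \<times> nat) set" and v i0 where "finite I" "i0 \<in> I" "v i0 = (1::'k)"
    "\<And>i. i \<in> I \<Longrightarrow> a * v i \<in> int_span v I" "\<And>i. i \<in> I \<Longrightarrow> b * v i \<in> int_span v I"
proof -
  obtain n c where n: "n > 0" "a ^ n = (\<Sum>i<n. of_int (c i) * a ^ i)"
    using algebraic_int_power_reduction[OF assms(1)] by blast
  obtain m d where m: "m > 0" "b ^ m = (\<Sum>i<m. of_int (d i) * b ^ i)"
    using algebraic_int_power_reduction[OF assms(2)] by blast
  define I where "I = {..<n} \<times> {..<m}"
  define v where "v = (\<lambda>(i, j). a ^ i * b ^ j)"
  have fin: "finite I" by (simp add: I_def)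
  have base: "a ^ i * b ^ j \<in> int_span v I" if "i < n" "j < m" for i j
    using int_span_base[OF fin, of "(i, j)" v] that by (auto simp: I_def v_def)
  have "a * v ij \<in> int_span v I" if "ij \<in> I" for ij
  proof -
    obtain i j where ij: "ij = (i, j)" "i < n" "j < m" using \<open>ij \<in> I\<close> by (auto simp: I_def)
    show ?thesis
    proof (cases "Suc i < n")
      case True
      then show ?thesis using base[of "Suc i" j] ij by (simp add: v_def algebra_simps)
    next
      case False
      then have "Suc i = n" using ij by simp
      then have "a * v ij = a ^ n * b ^ j" using ij by (auto simp: v_def)
      also have "\<dots> = (\<Sum>i<n. of_int (c i) * (a ^ i * b ^ j))"
        unfolding n(2) by (simp only: sum_distrib_right mult.assoc)
      finally show ?thesis using ij base by (auto intro!: int_span_sum int_span_scale)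
    qed
  qed
  moreover have "b * v ij \<in> int_span v I" if "ij \<in> I" for ij
  proof -
    obtain i j where ij: "ij = (i, j)" "i < n" "j < m" using \<open>ij \<in> I\<close> by (auto simp: I_def)
    show ?thesis
    proof (cases "Suc j < m")
      case True
      then show ?thesis using base[of i "Suc j"] ij by (simp add: v_def algebra_simps)
    next
      case False
      then have "Suc j = m" using ij by simp
      then have "b * v ij = a ^ i * b ^ m" using ij by (auto simp: v_def)
      also have "\<dots> = (\<Sum>j<m. of_int (d j) * (a ^ i * b ^ j))"
        unfolding m(2) by (simp add: sum_distrib_left algebra_simps)
      finally show ?thesis using ij base by (auto intro!: int_span_sum int_span_scale)
    qed
  qed
  ultimately show ?thesis using fin n m that[of I "(0, 0)" v] by (auto simp: I_def v_def)
qed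

lemma algebraic_int_add:
  fixes a b :: "'k::field_char_0"
  assumes "algebraic_int a" "algebraic_int b"
  shows "algebraic_int (a + b)"
proof -
  obtain I :: "(nat \<times> nat) set" and v i0 where I: "finite I" "i0 \<in> I" "v i0 = (1::'k)"
    "\<And>i. i \<in> I \<Longrightarrow> a * v i \<in> int_span v I" "\<And>i. i \<in> I \<Longrightarrow> b * v i \<in> int_span v I"
    by (rule algebraic_int_common_lattice[OF assms], rule that)
  show ?thesis
    using I by (intro algebraic_int_if_stable_int_span[of I _ v i0]) (auto simp: distrib_right intro: int_span_add)
qed

lemma algebraic_int_mult:
  fixes a b :: "'k::field_char_0"
  assumes "algebraic_int a" "algebraic_int b"
  shows "algebraic_int (a * b)"
proof -
  obtain I :: "(nat \<times> nat) set" and v i0 where I: "finite I" "i0 \<in> I" "v i0 = (1::'k)"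
    "\<And>i. i \<in> I \<Longrightarrow> a * v i \<in> int_span v I" "\<And>i. i \<in> I \<Longrightarrow> b * v i \<in> int_span v I"
    by (rule algebraic_int_common_lattice[OF assms], rule that)
  show ?thesis
    using I int_span_mult_stable[OF I(4)]
    by (intro algebraic_int_if_stable_int_span[of I _ v i0]) (auto simp: mult.assoc)
qed

lemma algebraic_int_prod:
  fixes f :: "'i \<Rightarrow> 'k::field_char_0"
  shows "(\<And>i. i \<in> S \<Longrightarrow> algebraic_int (f i)) \<Longrightarrow> algebraic_int (prod f S)"
  by (induction S rule: infinite_finite_induct)
    (auto intro: algebraic_int_mult int_imp_algebraic_int)

lemma field_embedding_0: "field_embedding f \<Longrightarrow> f 0 = 0"
  unfolding field_embedding_def by (metis add_cancel_right_right)

lemma field_embedding_sum: "field_embedding f \<Longrightarrow> f (sum g S) = (\<Sum>i\<in>S. f (g i))"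
  by (induction S rule: infinite_finite_induct)
    (auto simp: field_embedding_0, auto simp: field_embedding_def)

lemma field_embedding_add: "field_embedding f \<Longrightarrow> f (x + y) = f x + f y"
  by (simp add: field_embedding_def)

lemma field_embedding_mult: "field_embedding f \<Longrightarrow> f (x * y) = f x * f y"
  by (simp add: field_embedding_def)

lemma field_embedding_1: "field_embedding f \<Longrightarrow> f 1 = 1"
  by (simp add: field_embedding_def)

lemma field_embedding_minus: "field_embedding f \<Longrightarrow> f (- x) = - f x"
  using field_embedding_add[of f x "- x"] by (simp add: field_embedding_0 eq_neg_iff_add_eq_0 add.commute)

lemma field_embedding_diff: "field_embedding f \<Longrightarrow> f (x - y) = f x - f y"
  using field_embedding_add[of f x "- y"] by (simp add: field_embedding_minus)

lemma field_embedding_eq_0_iff: 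
  assumes "field_embedding f" shows "f x = 0 \<longleftrightarrow> x = 0"
proof
  assume "f x = 0"
  then have "f (x * inverse x) = 0" by (simp add: field_embedding_mult[OF assms])
  then show "x = 0" using field_embedding_1[OF assms] by (cases "x = 0") auto
qed (simp add: field_embedding_0[OF assms])

lemma field_embedding_eq_iff: "field_embedding f \<Longrightarrow> f x = f y \<longleftrightarrow> x = y"
  using field_embedding_eq_0_iff[of f "x - y"] by (simp add: field_embedding_diff)

lemma field_embedding_inverse: 
  assumes "field_embedding f" shows "f (inverse x) = inverse (f x)"
proof (cases "x = 0")
  case False
  then have "f x * f (inverse x) = 1"
    using field_embedding_1[OF assms] by (simp flip: field_embedding_mult[OF assms])
  then show ?thesis by (simp add: inverse_unique)
qed (simp add: field_embedding_0[OF assms])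

lemma field_embedding_power: "field_embedding f \<Longrightarrow> f (x ^ n) = f x ^ n"
  by (induction n) (auto simp: field_embedding_def)

lemma field_embedding_of_nat: "field_embedding f \<Longrightarrow> f (of_nat n) = of_nat n"
  by (induction n) (auto simp: field_embedding_0 field_embedding_add field_embedding_1)

lemma field_embedding_of_int: "field_embedding f \<Longrightarrow> f (of_int n) = of_int n"
  by (cases n) (auto simp: field_embedding_of_nat field_embedding_minus field_embedding_add field_embedding_1 field_embedding_diff)

lemma field_embedding_of_rat:
  fixes f :: "'k::field_char_0 \<Rightarrow> 'l::field_char_0"
  shows "field_embedding f \<Longrightarrow> f (of_rat q) = of_rat q"
  by (cases q) (auto simp: of_rat_rat field_embedding_of_int field_embedding_mult field_embedding_inverse divide_inverse)

lemma algebraic_int_field_embedding: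
  fixes f :: "'k::field_char_0 \<Rightarrow> 'l::field_char_0"
  assumes "field_embedding f" "algebraic_int x"
  shows "algebraic_int (f x)"
proof -
  obtain p :: "int poly" where p: "poly (map_poly of_int p) x = 0" "lead_coeff p = 1"
    using assms by (auto simp: algebraic_int_altdef_ipoly)
  have "poly (map_poly of_int p) (f x) = f (poly (map_poly of_int p) x)"
    using assms(1) by (simp add: poly_altdef degree_map_poly coeff_map_poly field_embedding_sum
      field_embedding_mult field_embedding_power field_embedding_of_int)
  then show ?thesis using p field_embedding_0[OF assms(1)]
    by (auto simp: algebraic_int_altdef_ipoly)
qed

text \<open>Dedekind's independence of characters: comparing the relation at \<open>y x\<close> with \<open>e k y\<close> times the
relation at \<open>x\<close> removes the term of \<open>k\<close>, and it keeps the term of \<open>i\<close> if \<open>e i y \<noteq> e k y\<close>.\<close>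

lemma field_embeddings_independent:
  fixes e :: "'i \<Rightarrow> 'k::field \<Rightarrow> 'l::field"
  assumes "finite I" "\<And>i. i \<in> I \<Longrightarrow> field_embedding (e i)" "inj_on e I"
    and "\<And>x. (\<Sum>i\<in>I. c i * e i x) = 0" "i \<in> I"
  shows "c i = 0"
  using assms
proof (induction I arbitrary: c i rule: finite_induct)
  case empty
  then show ?case by simp
next
  case (insert k I)
  note emb = insert.prems(1) and inj = insert.prems(2) and rel = insert.prems(3)
  have small: "c i = 0" if i: "i \<in> I" for i
  proof -
    have "e i \<noteq> e k" using inj i insert.hyps by (auto simp: inj_on_def)
    then obtain y where y: "e i y \<noteq> e k y" by auto
    have "(\<Sum>i\<in>I. (c i * (e i y - e k y)) * e i x) = 0" for x
    proof -
      have "(\<Sum>i\<in>I. (c i * (e i y - e k y)) * e i x) = (\<Sum>i\<in>insert k I. c i * (e i y * e i x)) - e k y * (\<Sum>i\<in>insert k I. c i * e i x)"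
        using insert.hyps by (simp add: sum_distrib_left sum_subtractf algebra_simps)
      also have "(\<Sum>i\<in>insert k I. c i * (e i y * e i x)) = (\<Sum>i\<in>insert k I. c i * e i (y * x))"
        using emb by (intro sum.cong) (auto simp: field_embedding_mult)
      finally show ?thesis using rel by simp
    qed
    moreover have "inj_on e I" using inj by (rule inj_on_subset) auto
    ultimately have "c i * (e i y - e k y) = 0"
      using insert.IH[of "\<lambda>i. c i * (e i y - e k y)" i] emb i by simp
    then show ?thesis using y by simp
  qed
  have "c k * e k 1 = 0" using rel[of 1] small insert.hyps by simp
  then have "c k = 0" using emb[of k] by (simp add: field_embedding_1)
  with small show ?case using insert.prems(4) by auto
qed

section \<open>The embeddings of a number field\<close>

definition all_embeddings ::
    "('s \<Rightarrow> 'k \<Rightarrow> real) \<Rightarrow> ('t \<Rightarrow> 'k \<Rightarrow> complex) \<Rightarrow> ('s + 't) + 't \<Rightarrow> 'k \<Rightarrow> complex" where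
  "all_embeddings \<sigma> \<tau> e x =
     (case e of Inl i \<Rightarrow> (case i of Inl i \<Rightarrow> of_real (\<sigma> i x) | Inr j \<Rightarrow> \<tau> j x) | Inr j \<Rightarrow> cnj (\<tau> j x))"

lemma common_denominator:
  assumes "finite (S :: rat set)"
  obtains D :: int where "D \<noteq> 0" "\<And>q. q \<in> S \<Longrightarrow> of_int D * q \<in> \<int>"
  using assms
proof (induction S arbitrary: thesis rule: finite_induct)
  case empty
  show ?case by (rule empty(1)[of 1]) auto
next
  case (insert q S)
  obtain D where D: "D \<noteq> 0" "\<And>q. q \<in> S \<Longrightarrow> of_int D * q \<in> \<int>" using insert.IH by blast
  obtain a b where q: "q = of_int a / of_int b" "b \<noteq> 0"
    by (metis Rat_cases Fract_of_int_quotient less_irrefl)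
  show ?case
  proof (rule insert.prems(1)[of "b * D"])
    show "b * D \<noteq> 0" using q D by simp
    fix r assume "r \<in> insert q S"
    then show "of_int (b * D) * r \<in> \<int>"
    proof
      assume "r = q"
      then have "of_int (b * D) * r = of_int (D * a)" using q by (simp add: field_simps)
      then show ?thesis by (simp only: Ints_of_int)
    next
      assume "r \<in> S"
      then have "of_int b * (of_int D * r) \<in> \<int>" using D(2)[of r] Ints_mult[OF Ints_of_int] by blast
      then show ?thesis by (simp add: mult.assoc)
    qed
  qed
qed

lemma sum_UNIV_sum:
  "sum f (UNIV :: ('x::finite + 'y::finite) set) = (\<Sum>i\<in>UNIV. f (Inl i)) + (\<Sum>j\<in>UNIV. f (Inr j) :: 'a::comm_monoid_add)"
  unfolding UNIV_sum by (subst sum.union_disjoint) (auto simp: sum.reindex)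

lemma prod_UNIV_sum:
  "prod f (UNIV :: ('x::finite + 'y::finite) set) = (\<Prod>i\<in>UNIV. f (Inl i)) * (\<Prod>j\<in>UNIV. f (Inr j) :: 'a::comm_monoid_mult)"
  unfolding UNIV_sum by (subst prod.union_disjoint) (auto simp: prod.reindex)

locale embedded_number_field =
  fixes \<sigma> :: "'s::finite \<Rightarrow> 'k::field_char_0 \<Rightarrow> real" and \<tau> :: "'t::finite \<Rightarrow> 'k \<Rightarrow> complex"
  assumes nf: "number_field_embeddings \<sigma> \<tau>"
begin

lemma real_embedding: "field_embedding (\<sigma> i)"
  using nf unfolding number_field_embeddings_def bij_betw_def by auto

lemma complex_embedding: "field_embedding (\<tau> j)" "\<not> range (\<tau> j) \<subseteq> \<real>"
proof -
  have "case_sum \<tau> (\<lambda>j x. cnj (\<tau> j x)) (Inl j) \<in> {f. field_embedding f \<and> \<not> range f \<subseteq> \<real>}"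
    using nf unfolding number_field_embeddings_def bij_betw_def by blast
  then show "field_embedding (\<tau> j)" "\<not> range (\<tau> j) \<subseteq> \<real>" by auto
qed

lemma cnj_embedding: "field_embedding (\<lambda>x. cnj (\<tau> j x))"
  using complex_embedding(1)[of j] by (auto simp: field_embedding_def)

lemma embedding_all: "field_embedding (all_embeddings \<sigma> \<tau> e)"
  using real_embedding complex_embedding(1) cnj_embedding
  by (auto simp: all_embeddings_def field_embedding_def split: sum.splits)

lemma inj_all_embeddings: "inj (all_embeddings \<sigma> \<tau>)"
proof (rule injI)
  fix e e' assume eq: "all_embeddings \<sigma> \<tau> e = all_embeddings \<sigma> \<tau> e'"
  have s: "inj \<sigma>" and c: "inj (case_sum \<tau> (\<lambda>j x. cnj (\<tau> j x)))"
    using nf unfolding number_field_embeddings_def bij_betw_def by auto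
  have pt: "all_embeddings \<sigma> \<tau> e x = all_embeddings \<sigma> \<tau> e' x" for x using eq by simp
  have nonreal: "\<exists>x. \<tau> j x \<notin> \<real>" for j
    using complex_embedding(2)[of j] by auto
  have rt: "\<not> (\<forall>x. of_real (\<sigma> i x) = \<tau> j x)" for i j
    using nonreal[of j] by (metis Reals_of_real)
  have rc: "\<not> (\<forall>x. of_real (\<sigma> i x) = cnj (\<tau> j x))" for i j
    using nonreal[of j] by (metis Reals_of_real complex_cnj_cnj complex_cnj_complex_of_real)
  have rr: "i = i'" if "\<forall>x. \<sigma> i x = \<sigma> i' x" for i i'
    using that by (intro injD[OF s]) auto
  have tt: "j = j'" if "\<forall>x. \<tau> j x = \<tau> j' x" for j j'
  proof -
    have "Inl j = (Inl j' :: 't + 't)" using that by (intro injD[OF c]) auto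
    then show ?thesis by simp
  qed
  have tc: "\<not> (\<forall>x. \<tau> j x = cnj (\<tau> j' x))" for j j'
  proof
    assume "\<forall>x. \<tau> j x = cnj (\<tau> j' x)"
    then have "Inl j = (Inr j' :: 't + 't)" by (intro injD[OF c]) auto
    then show False by simp
  qed
  obtain i j k where e: "e = Inl (Inl i) \<or> e = Inl (Inr j) \<or> e = Inr k" by (metis sum.exhaust)
  obtain i' j' k' where e': "e' = Inl (Inl i') \<or> e' = Inl (Inr j') \<or> e' = Inr k'" by (metis sum.exhaust)
  have val: "all_embeddings \<sigma> \<tau> (Inl (Inl i)) x = of_real (\<sigma> i x)" "all_embeddings \<sigma> \<tau> (Inl (Inr j)) x = \<tau> j x"
    "all_embeddings \<sigma> \<tau> (Inr j) x = cnj (\<tau> j x)" for i j x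
    by (simp_all add: all_embeddings_def)
  show "e = e'"
    using e e'
  proof (elim disjE)
    assume a: "e = Inl (Inl i)" "e' = Inl (Inl i')"
    show ?thesis using pt rr[of i i'] unfolding a val by simp
  next
    assume a: "e = Inl (Inl i)" "e' = Inl (Inr j')"
    show ?thesis using pt rt[of i j'] unfolding a val by simp
  next
    assume a: "e = Inl (Inl i)" "e' = Inr k'"
    show ?thesis using pt rc[of i k'] unfolding a val by simp
  next
    assume a: "e = Inl (Inr j)" "e' = Inl (Inl i')"
    show ?thesis using pt[symmetric] rt[of i' j] unfolding a val by simp
  next
    assume a: "e = Inl (Inr j)" "e' = Inl (Inr j')"
    show ?thesis using pt tt[of j j'] unfolding a val by simp
  next
    assume a: "e = Inl (Inr j)" "e' = Inr k'"
    show ?thesis using pt tc[of j k'] unfolding a val by simp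
  next
    assume a: "e = Inr k" "e' = Inl (Inl i')"
    show ?thesis using pt[symmetric] rc[of i' k] unfolding a val by simp
  next
    assume a: "e = Inr k" "e' = Inl (Inr j')"
    show ?thesis using pt[symmetric] tc[of j' k] unfolding a val by simp
  next
    assume a: "e = Inr k" "e' = Inr k'"
    show ?thesis using pt tt[of k k'] unfolding a val by simp
  qed
qed

lemma all_embeddings_independent:
  assumes "\<And>x. (\<Sum>e\<in>UNIV. c e * all_embeddings \<sigma> \<tau> e x) = 0"
  shows "c e = 0"
  using field_embeddings_independent[of UNIV "all_embeddings \<sigma> \<tau>" c e]
    inj_all_embeddings embedding_all assms by auto

lemma rational_basis:
  obtains b :: "('s + 't) + 't \<Rightarrow> 'k"
  where "\<And>x. \<exists>q :: ('s + 't) + 't \<Rightarrow> rat. x = (\<Sum>i\<in>UNIV. of_rat (q i) * b i)" "\<And>i. b i \<noteq> 0"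
proof -
  interpret Q: vector_space "\<lambda>(q::rat) (x::'k). of_rat q * x" by (rule vector_space_of_rat)
  let ?N = "CARD(('s + 't) + 't)"
  have N: "?N = CARD('s) + 2 * CARD('t)" by simp
  have dim: "Q.dim UNIV = ?N"
    using nf unfolding number_field_embeddings_def degree_over_rat_def N by simp
  obtain B where B: "Q.independent B" "UNIV \<subseteq> Q.span B" "card B = Q.dim UNIV"
    by (rule Q.basis_exists[of UNIV], rule that)
  have cB: "card B = ?N" using B dim by simp
  then have fin: "finite B" by (auto intro: card_ge_0_finite)
  obtain b :: "('s + 't) + 't \<Rightarrow> 'k" where b: "bij_betw b UNIV B"
    using finite_same_card_bij[of "UNIV :: (('s + 't) + 't) set" B] fin cB by auto
  show ?thesis
  proof (rule that[of b])
    fix x :: 'k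
    have "x \<in> Q.span B" using B by auto
    then obtain u where "x = (\<Sum>v\<in>B. of_rat (u v) * v)"
      unfolding Q.span_finite[OF fin] by auto
    also have "\<dots> = (\<Sum>i\<in>UNIV. of_rat (u (b i)) * b i)"
      by (rule sum.reindex_bij_betw[OF b, symmetric])
    finally show "\<exists>q :: ('s + 't) + 't \<Rightarrow> rat. x = (\<Sum>i\<in>UNIV. of_rat (q i) * b i)" by (rule exI[of _ "\<lambda>i. u (b i)"])
  next
    fix i
    have "b i \<in> B" using b by (auto simp: bij_betw_def)
    show "b i \<noteq> 0"
    proof
      assume "b i = 0"
      with \<open>b i \<in> B\<close> have "Q.dependent B" by (intro Q.dependent_zero) simp
      with B(1) show False by contradiction
    qed
  qed
qed

text \<open>After multiplication with a common denominator of its matrix over a rational basis, \<open>x\<close>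
maps the group generated by the basis to itself.\<close>

lemma integral_multiple:
  obtains D :: int where "D \<noteq> 0" "of_int D * x \<in> (ring_of_integers :: 'k set)"
proof -
  obtain b :: "('s + 't) + 't \<Rightarrow> 'k" where b: "\<And>x. \<exists>q :: ('s + 't) + 't \<Rightarrow> rat. x = (\<Sum>i\<in>UNIV. of_rat (q i) * b i)" "\<And>i. b i \<noteq> 0"
    by (rule rational_basis, rule that)
  have "\<forall>i. \<exists>q :: ('s + 't) + 't \<Rightarrow> rat. x * b i = (\<Sum>j\<in>UNIV. of_rat (q j) * b j)" using b(1) by blast
  then obtain a :: "('s + 't) + 't \<Rightarrow> ('s + 't) + 't \<Rightarrow> rat" where a: "\<And>i. x * b i = (\<Sum>j\<in>UNIV. of_rat (a i j) * b j)" by metis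
  have "finite (range (\<lambda>(i, j). a i j))" by simp
  obtain D where D: "D \<noteq> 0" "\<And>q. q \<in> range (\<lambda>(i, j). a i j) \<Longrightarrow> of_int D * q \<in> \<int>"
    by (rule common_denominator[OF \<open>finite (range _)\<close>], rule that)
  have "\<exists>z. of_int D * a i j = of_int z" for i j
    using D(2)[of "a i j"] by (auto elim!: Ints_cases)
  then obtain z where z: "\<And>i j. of_int D * a i j = of_int (z i j)" by metis
  have "algebraic_int (of_int D * x)"
  proof (rule algebraic_int_if_stable_lattice[of UNIV _ b])
    fix i
    have "of_int D * x * b i = (\<Sum>j\<in>UNIV. of_rat (of_int D * a i j) * b j)"
      by (simp add: mult.assoc a sum_distrib_left of_rat_mult)
    then show "\<exists>c::('s + 't) + 't \<Rightarrow> int. of_int D * x * b i = (\<Sum>j\<in>UNIV. of_int (c j) * b j)"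
      unfolding z by auto
  qed (use b in auto)
  with D(1) show ?thesis using that by (auto simp: ring_of_integers_def)
qed

lemma independent_on_integers:
  assumes "\<And>a. a \<in> ring_of_integers \<Longrightarrow> (\<Sum>e\<in>UNIV. c e * all_embeddings \<sigma> \<tau> e a) = 0"
  shows "c e = 0"
proof (rule all_embeddings_independent)
  fix x :: 'k
  obtain D where D: "D \<noteq> 0" "of_int D * x \<in> ring_of_integers" by (rule integral_multiple[of x])
  have "(\<Sum>e\<in>UNIV. c e * all_embeddings \<sigma> \<tau> e (of_int D * x)) = of_int D * (\<Sum>e\<in>UNIV. c e * all_embeddings \<sigma> \<tau> e x)"
    by (simp add: sum_distrib_left field_embedding_mult[OF embedding_all] field_embedding_of_int[OF embedding_all] mult.left_commute)
  then show "(\<Sum>e\<in>UNIV. c e * all_embeddings \<sigma> \<tau> e x) = 0"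
    using assms[OF D(2)] D(1) by simp
qed

text \<open>Over a rational basis \<open>b\<close>, multiplication by \<open>x\<close> is a rational matrix \<open>A\<close>, and the matrix of
conjugates \<open>M\<close> diagonalises it: \<open>A M = M D\<close>. Dedekind's lemma makes \<open>M\<close> invertible, so the product
of the conjugates of \<open>x\<close> is \<open>det A\<close>.\<close>

lemma norm_rational: "(\<Prod>e\<in>UNIV. all_embeddings \<sigma> \<tau> e x) \<in> \<rat>"
proof -
  obtain b :: "('s + 't) + 't \<Rightarrow> 'k" where b: "\<And>x. \<exists>q :: ('s + 't) + 't \<Rightarrow> rat. x = (\<Sum>i\<in>UNIV. of_rat (q i) * b i)" "\<And>i. b i \<noteq> 0"
    by (rule rational_basis, rule that)
  let ?E = "all_embeddings \<sigma> \<tau>"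
  have expand: "?E e (\<Sum>i\<in>UNIV. of_rat (q i) * b i) = (\<Sum>i\<in>UNIV. of_rat (q i) * ?E e (b i))" for q e
    by (simp add: field_embedding_sum[OF embedding_all] field_embedding_mult[OF embedding_all] field_embedding_of_rat[OF embedding_all])
  have "\<forall>i. \<exists>q :: ('s + 't) + 't \<Rightarrow> rat. x * b i = (\<Sum>j\<in>UNIV. of_rat (q j) * b j)" using b(1) by blast
  then obtain a :: "('s + 't) + 't \<Rightarrow> ('s + 't) + 't \<Rightarrow> rat" where a: "\<And>i. x * b i = (\<Sum>j\<in>UNIV. of_rat (a i j) * b j)" by metis
  define M :: "complex ^ (('s + 't) + 't) ^ (('s + 't) + 't)" where "M = (\<chi> i e. ?E e (b i))"
  define A :: "complex ^ (('s + 't) + 't) ^ (('s + 't) + 't)" where "A = (\<chi> i j. of_rat (a i j))"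
  define D :: "complex ^ (('s + 't) + 't) ^ (('s + 't) + 't)" where "D = (\<chi> i j. if i = j then ?E i x else 0)"
  have "A ** M = M ** D"
  proof -
    have "(A ** M) $ i $ e = (M ** D) $ i $ e" for i e
    proof -
      have "(A ** M) $ i $ e = (\<Sum>j\<in>UNIV. of_rat (a i j) * ?E e (b j))"
        by (simp add: A_def M_def matrix_matrix_mult_def)
      also have "\<dots> = ?E e (x * b i)" by (simp add: a expand)
      also have "\<dots> = (M ** D) $ i $ e"
        by (simp add: M_def D_def matrix_matrix_mult_def field_embedding_mult[OF embedding_all] if_distrib cong: if_cong)
      finally show ?thesis .
    qed
    then show ?thesis by (simp add: vec_eq_iff)
  qed
  then have "det A * det M = det M * det D" by (metis det_mul)
  moreover have "det M \<noteq> 0"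
  proof -
    have "c = 0" if "M *v c = 0" for c
    proof -
      have "(\<Sum>e\<in>UNIV. ?E e (b i) * c $ e) = 0" for i
        using that by (simp add: vec_eq_iff matrix_vector_mult_def M_def)
      then have rel: "(\<Sum>e\<in>UNIV. c $ e * ?E e (b i)) = 0" for i by (simp add: mult.commute)
      have "(\<Sum>e\<in>UNIV. c $ e * ?E e y) = 0" for y
      proof -
        obtain q where y: "y = (\<Sum>i\<in>UNIV. of_rat (q i) * b i)" using b(1) by blast
        have "(\<Sum>e\<in>UNIV. c $ e * ?E e y) = (\<Sum>e\<in>UNIV. \<Sum>i\<in>UNIV. of_rat (q i) * (c $ e * ?E e (b i)))"
          unfolding y expand by (simp add: sum_distrib_left mult.left_commute)
        also have "\<dots> = (\<Sum>i\<in>UNIV. of_rat (q i) * (\<Sum>e\<in>UNIV. c $ e * ?E e (b i)))"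
          by (subst sum.swap) (simp add: sum_distrib_left)
        finally show ?thesis by (simp add: rel)
      qed
      then have "c $ e = 0" for e by (rule all_embeddings_independent)
      then show "c = 0" by (simp add: vec_eq_iff)
    qed
    then have "\<exists>B. B ** M = mat 1" by (simp add: matrix_left_invertible_ker)
    then show ?thesis by (metis det_I det_mul mult_zero_right zero_neq_one)
  qed
  ultimately have "det D = det A" by simp
  moreover have "det D = (\<Prod>e\<in>UNIV. ?E e x)"
    by (subst det_diagonal) (auto simp: D_def)
  moreover have "det A \<in> \<rat>"
    unfolding det_def A_def by (auto intro!: Rats_sum Rats_mult Rats_prod)
  ultimately show ?thesis by simp
qed

lemma norm_integer:
  assumes "a \<in> ring_of_integers"
  shows "(\<Prod>e\<in>UNIV. all_embeddings \<sigma> \<tau> e a) \<in> \<int>"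
proof (rule rational_algebraic_int_is_int[OF _ norm_rational], rule algebraic_int_prod)
  fix e
  show "algebraic_int (all_embeddings \<sigma> \<tau> e a)"
    using algebraic_int_field_embedding[OF embedding_all] assms by (auto simp: ring_of_integers_def)
qed

lemma norm_ge_1:
  assumes "a \<in> ring_of_integers" "a \<noteq> 0"
  shows "(\<Prod>e\<in>UNIV. cmod (all_embeddings \<sigma> \<tau> e a)) \<ge> 1"
proof -
  obtain z where z: "(\<Prod>e\<in>UNIV. all_embeddings \<sigma> \<tau> e a) = of_int z"
    using norm_integer[OF assms(1)] by (auto elim: Ints_cases)
  have "(\<Prod>e\<in>UNIV. all_embeddings \<sigma> \<tau> e a) \<noteq> 0"
    using assms(2) by (simp add: field_embedding_eq_0_iff[OF embedding_all])
  then have "z \<noteq> 0" using z by auto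
  moreover have "(\<Prod>e\<in>UNIV. cmod (all_embeddings \<sigma> \<tau> e a)) = \<bar>of_int z\<bar>"
    by (metis norm_of_int prod_norm z)
  ultimately show ?thesis by linarith
qed

lemma norm_cmod_split:
  "(\<Prod>e\<in>UNIV. cmod (all_embeddings \<sigma> \<tau> e a)) = (\<Prod>i\<in>UNIV. \<bar>\<sigma> i a\<bar>) * (\<Prod>j\<in>UNIV. (cmod (\<tau> j a))\<^sup>2)"
  by (simp add: prod_UNIV_sum all_embeddings_def power2_eq_square prod.distrib mult.assoc)

text \<open>The norms of \<open>u\<close> and of its inverse are both at least 1 in absolute value.\<close>

lemma unit_norm:
  assumes "u \<in> totally_positive_units \<sigma>"
  shows "(\<Prod>i\<in>UNIV. \<sigma> i u) * (\<Prod>j\<in>UNIV. (cmod (\<tau> j u))\<^sup>2) = 1"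
proof -
  let ?N = "\<lambda>a. \<Prod>e\<in>UNIV. cmod (all_embeddings \<sigma> \<tau> e a)"
  have u: "u \<in> ring_of_integers" "inverse u \<in> ring_of_integers" "u \<noteq> 0" "\<And>i. \<sigma> i u > 0"
    using assms by (auto simp: totally_positive_units_def)
  have inv: "?N (inverse u) = inverse (?N u)"
    by (simp add: field_embedding_inverse[OF embedding_all] norm_inverse prod_inversef[symmetric] comp_def)
  have "?N u \<ge> 1" "inverse (?N u) \<ge> 1"
    using norm_ge_1[of u] norm_ge_1[of "inverse u"] u inv by auto
  then have "?N u = 1" by (auto simp: one_le_inverse_iff)
  then show ?thesis using norm_cmod_split[of u] u(4) by (simp add: abs_of_pos)
qed

end

lemma ring_of_integers_add: "a \<in> ring_of_integers \<Longrightarrow> b \<in> ring_of_integers \<Longrightarrow> a + b \<in> ring_of_integers"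
  by (simp add: ring_of_integers_def algebraic_int_add)

lemma ring_of_integers_mult: "a \<in> ring_of_integers \<Longrightarrow> b \<in> ring_of_integers \<Longrightarrow> a * b \<in> ring_of_integers"
  by (simp add: ring_of_integers_def algebraic_int_mult)

lemma ring_of_integers_minus: "a \<in> ring_of_integers \<Longrightarrow> - a \<in> ring_of_integers"
  by (simp add: ring_of_integers_def)

lemma ring_of_integers_0: "0 \<in> ring_of_integers"
  by (simp add: ring_of_integers_def)


section \<open>Alternating forms, wedge powers and their regularity\<close>

lemma alternating_form_cong:
  "alternating_form k f \<Longrightarrow> (\<And>i. i < k \<Longrightarrow> v i = w i) \<Longrightarrow> f v = f w"
  by (auto simp: alternating_form_def)

lemma alternating_form_linear:
  "alternating_form k f \<Longrightarrow> i < k \<Longrightarrow> linear (\<lambda>x. f (v(i := x)))"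
  by (auto simp: alternating_form_def)

lemma alternating_form_eq_0:
  "alternating_form k f \<Longrightarrow> i < k \<Longrightarrow> j < k \<Longrightarrow> i \<noteq> j \<Longrightarrow> v i = v j \<Longrightarrow> f v = 0"
  unfolding alternating_form_def by blast

lemma alternating_form_add:
  "alternating_form k f \<Longrightarrow> i < k \<Longrightarrow> f (v(i := x + y)) = f (v(i := x)) + f (v(i := y))"
  using linear_add[OF alternating_form_linear] by blast

lemma alternating_form_scale:
  "alternating_form k f \<Longrightarrow> i < k \<Longrightarrow> f (v(i := c *\<^sub>R x)) = c * f (v(i := x))"
  using linear_scale[OF alternating_form_linear, of k f i v c x] by simp

lemma alternating_form_swap_upd:
  assumes f: "alternating_form k f" and ij: "i < k" "j < k" "i \<noteq> j"
  shows "f (v(i := y, j := x)) = - f (v(i := x, j := y))"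
proof -
  have z: "f (v(i := z, j := z)) = 0" for z
    using ij by (intro alternating_form_eq_0[OF f ij]) auto
  have "f (v(i := x + y, j := x + y)) = f (v(i := x, j := x + y)) + f (v(i := y, j := x + y))"
    using alternating_form_add[OF f ij(1), of "v(j := x + y)" x y] ij(3) by (simp add: fun_upd_twist)
  also have "\<dots> = f (v(i := x, j := x)) + f (v(i := x, j := y)) + (f (v(i := y, j := x)) + f (v(i := y, j := y)))"
    by (simp only: alternating_form_add[OF f ij(2)])
  finally show ?thesis by (simp add: z)
qed

lemma alternating_form_transpose:
  assumes f: "alternating_form k f" and ij: "i < k" "j < k" "i \<noteq> j"
  shows "f (\<lambda>l. v (Transposition.transpose i j l)) = - f v"
proof -
  have "(\<lambda>l. v (Transposition.transpose i j l)) = v(i := v j, j := v i)"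
    using ij by (auto simp: Transposition.transpose_def)
  moreover have "v = v(i := v i, j := v j)" by auto
  ultimately show ?thesis using alternating_form_swap_upd[OF f ij, of v "v j" "v i"] by simp
qed

text \<open>The offset \<open>d\<close> is needed for the last factor of a wedge product, which sees a tuple from its position
\<open>d\<close> on.\<close>

lemma alternating_form_permute:
  assumes f: "alternating_form l f" and "\<rho> permutes {d..<d + l}"
  shows "f (\<lambda>i. v (\<rho> (d + i))) = of_int (sign \<rho>) * f (\<lambda>i. v (d + i))"
  using finite_atLeastLessThan assms(2)
proof (induction rule: permutes_rev_induct)
  case id
  then show ?case by simp
next
  case (swap a b p)
  have ab: "a - d < l" "b - d < l" "a - d \<noteq> b - d" using swap by auto
  have "Transposition.transpose a b (d + i) = d + Transposition.transpose (a - d) (b - d) i" for i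
    using swap by (auto simp: Transposition.transpose_def)
  then have "f (\<lambda>i. v ((p \<circ> Transposition.transpose a b) (d + i))) = f (\<lambda>i. v (p (d + Transposition.transpose (a - d) (b - d) i)))"
    by simp
  also have "\<dots> = - f (\<lambda>i. v (p (d + i)))"
    by (rule alternating_form_transpose[OF f ab, of "\<lambda>i. v (p (d + i))"])
  also have "\<dots> = of_int (sign (p \<circ> Transposition.transpose a b)) * f (\<lambda>i. v (d + i))"
    using swap by (subst sign_compose) (auto simp: sign_swap_id permutation_swap_id intro: permutes_imp_permutation)
  finally show ?case .
qed

lemma alternating_form_add_span:
  assumes f: "alternating_form k f" and i: "i < k" and p: "p \<in> span (v ` ({..<k} - {i}))"
  shows "f (v(i := v i + p)) = f v"
proof -
  have "f (v(i := p)) = 0"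
    using p
  proof (rule span_induct)
    show "subspace {p. f (v(i := p)) = 0}"
      using linear_0[OF alternating_form_linear[OF f i, of v]]
      by (auto simp: subspace_def alternating_form_add[OF f i] alternating_form_scale[OF f i])
    fix x assume "x \<in> v ` ({..<k} - {i})"
    then obtain j where "j < k" "j \<noteq> i" "x = v j" by auto
    then show "f (v(i := x)) = 0" using i by (intro alternating_form_eq_0[OF f i, of j]) auto
  qed
  then show ?thesis by (simp add: alternating_form_add[OF f i])
qed

text \<open>For the alternation of wedge products: the terms of \<open>\<pi>\<close> and of \<open>(a b) \<circ> \<pi>\<close> cancel if the tuple has
equal entries at \<open>a\<close> and \<open>b\<close>.\<close>

lemma sum_permutations_cancel:
  fixes f :: "('a \<Rightarrow> 'a) \<Rightarrow> real"
  assumes "a \<in> S" "b \<in> S" "finite S" "\<And>\<pi>. \<pi> permutes S \<Longrightarrow> f (Transposition.transpose a b \<circ> \<pi>) = - f \<pi>"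
  shows "(\<Sum>\<pi> | \<pi> permutes S. f \<pi>) = 0"
proof -
  have "(\<Sum>\<pi> | \<pi> permutes S. f \<pi>) = (\<Sum>\<pi> | \<pi> permutes S. f (Transposition.transpose a b \<circ> \<pi>))"
    by (rule setum_permutations_compose_left) (rule permutes_swap_id[OF assms(1,2)])
  also have "\<dots> = - (\<Sum>\<pi> | \<pi> permutes S. f \<pi>)"
    unfolding sum_negf[symmetric] by (intro sum.cong) (use assms(4) in auto)
  finally show ?thesis by simp
qed

lemma alternating_form_wedge:
  assumes a: "alternating_form k (\<alpha> x)" and b: "alternating_form l (\<beta> x)"
  shows "alternating_form (k + l) (wedge k l \<alpha> \<beta> x)"
  unfolding alternating_form_def
proof (intro conjI allI impI)
  fix v w :: "nat \<Rightarrow> 'a" assume vw: "\<forall>i<k + l. v i = w i"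
  have "\<alpha> x (\<lambda>i. v (\<pi> i)) = \<alpha> x (\<lambda>i. w (\<pi> i)) \<and> \<beta> x (\<lambda>i. v (\<pi> (k + i))) = \<beta> x (\<lambda>i. w (\<pi> (k + i)))"
    if "\<pi> permutes {..<k + l}" for \<pi>
  proof -
    have "\<pi> i < k + l" if "i < k + l" for i
      using that permutes_in_image[OF \<open>\<pi> permutes _\<close>, of i] by simp
    then show ?thesis using vw by (intro conjI alternating_form_cong[OF a] alternating_form_cong[OF b]) auto
  qed
  then show "wedge k l \<alpha> \<beta> x v = wedge k l \<alpha> \<beta> x w"
    unfolding wedge_def by (intro arg_cong2[where f = "(/)"] sum.cong) auto
next
  fix v :: "nat \<Rightarrow> 'a" and i assume i: "i < k + l"
  have "linear (\<lambda>y. of_int (sign \<pi>) * \<alpha> x (\<lambda>j. (v(i := y)) (\<pi> j)) * \<beta> x (\<lambda>j. (v(i := y)) (\<pi> (k + j))))"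
    if \<pi>: "\<pi> permutes {..<k + l}" for \<pi>
  proof -
    define p where "p = inv \<pi> i"
    have p: "p < k + l" "\<pi> p = i"
      using i \<pi> permutes_in_image[OF permutes_inv[OF \<pi>], of i] by (auto simp: p_def permutes_inverses)
    have eq: "\<pi> j = i \<longleftrightarrow> j = p" for j using p(2) permutes_inj[OF \<pi>] by (auto dest: injD)
    show ?thesis
    proof (cases "p < k")
      case True
      have 1: "(\<lambda>j. (v(i := y)) (\<pi> j)) = (\<lambda>j. v (\<pi> j))(p := y)" for y by (auto simp: eq)
      have 2: "(\<lambda>j. (v(i := y)) (\<pi> (k + j))) = (\<lambda>j. v (\<pi> (k + j)))" for y using True by (auto simp: eq)
      show ?thesis unfolding 1 2
        using linear_compose_scale_right[OF alternating_form_linear[OF a True, of "\<lambda>j. v (\<pi> j)"], of "of_int (sign \<pi>) * \<beta> x (\<lambda>j. v (\<pi> (k + j)))"]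
        by (simp add: algebra_simps)
    next
      case False
      then have pk: "p - k < l" using p by auto
      have 1: "\<alpha> x (\<lambda>j. (v(i := y)) (\<pi> j)) = \<alpha> x (\<lambda>j. v (\<pi> j))" for y
        using False by (intro alternating_form_cong[OF a]) (auto simp: eq)
      have 2: "(\<lambda>j. (v(i := y)) (\<pi> (k + j))) = (\<lambda>j. v (\<pi> (k + j)))(p - k := y)" for y using False by (auto simp: eq fun_eq_iff)
      show ?thesis unfolding 1 2
        using linear_compose_scale_right[OF alternating_form_linear[OF b pk, of "\<lambda>j. v (\<pi> (k + j))"], of "of_int (sign \<pi>) * \<alpha> x (\<lambda>j. v (\<pi> j))"]
        by (simp add: algebra_simps)
    qed
  qed
  then have "linear (\<lambda>y. (\<Sum>\<pi> | \<pi> permutes {..<k + l}. of_int (sign \<pi>) * \<alpha> x (\<lambda>j. (v(i := y)) (\<pi> j)) * \<beta> x (\<lambda>j. (v(i := y)) (\<pi> (k + j)))))"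
    by (intro linear_compose_sum) auto
  from linear_compose_scale_right[OF this, of "1 / (fact k * fact l)"]
  show "linear (\<lambda>y. wedge k l \<alpha> \<beta> x (v(i := y)))"
    unfolding wedge_def by simp
next
  fix v :: "nat \<Rightarrow> 'a" and i j assume ij: "i < k + l" "j < k + l" "i \<noteq> j \<and> v i = v j"
  have vt: "v (Transposition.transpose i j m) = v m" for m using ij by (auto simp: Transposition.transpose_def)
  have "(\<Sum>\<pi> | \<pi> permutes {..<k + l}. of_int (sign \<pi>) * \<alpha> x (\<lambda>i. v (\<pi> i)) * \<beta> x (\<lambda>i. v (\<pi> (k + i)))) = 0"
    by (rule sum_permutations_cancel[of i _ j])
      (use ij in \<open>auto simp: vt sign_compose sign_swap_id permutation_swap_id permutes_imp_permutation[of "{..<k+l}"]\<close>)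
  then show "wedge k l \<alpha> \<beta> x v = 0" by (simp add: wedge_def)
qed

lemma alternating_form_wedge_power:
  assumes "alternating_form k (\<alpha> x)"
  shows "alternating_form (k * m) (wedge_power k \<alpha> m x)"
proof (induction m)
  case 0
  then show ?case by (simp add: alternating_form_def)
next
  case (Suc m)
  then show ?case
    using alternating_form_wedge[of k \<alpha> x "k * m" "wedge_power k \<alpha> m"] assms by simp
qed

lemma wedge_power_natural:
  assumes "\<And>v. \<alpha> x v = \<alpha>' x' (\<lambda>i. L (v i))"
  shows "wedge_power k \<alpha> m x v = wedge_power k \<alpha>' m x' (\<lambda>i. L (v i))"
  by (induction m arbitrary: v) (auto simp: wedge_def assms)

text \<open>Level 1 of the hierarchy is continuous differentiability, since level 0 asks the directional derivatives
to be continuous.\<close>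

abbreviation C1_on :: "'v::euclidean_space set \<Rightarrow> ('v \<Rightarrow> real) \<Rightarrow> bool" where
  "C1_on \<equiv> times_differentiable_on (Suc 0)"

lemma C1_onI:
  assumes "\<And>x. x \<in> S \<Longrightarrow> (f has_derivative f' x) (at x)" "\<And>v. continuous_on S (\<lambda>x. f' x v)"
  shows "C1_on S f"
proof -
  have fd: "frechet_derivative f (at x) = f' x" if "x \<in> S" for x
    using frechet_derivative_at[OF assms(1)[OF that]] by simp
  have "continuous_on S (\<lambda>x. frechet_derivative f (at x) v)" for v
    using assms(2)[of v] by (subst continuous_on_cong[OF refl, of S _ "\<lambda>x. f' x v"]) (auto simp: fd)
  then show ?thesis using assms(1) by (auto simp: differentiable_def)
qed

lemma C1_onD:
  assumes "C1_on S f"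
  shows "x \<in> S \<Longrightarrow> (f has_derivative frechet_derivative f (at x)) (at x)"
    and "continuous_on S (\<lambda>x. frechet_derivative f (at x) v)"
    and "continuous_on S f"
  using assms frechet_derivative_works
  by (auto intro!: continuous_at_imp_continuous_on differentiable_imp_continuous_within)

lemma C1_on_const: "C1_on S (\<lambda>x. c)"
  by (rule C1_onI[where f' = "\<lambda>_ _. 0"]) auto

lemma C1_on_mult:
  assumes f: "C1_on S f" and g: "C1_on S g"
  shows "C1_on S (\<lambda>x. f x * g x)"
proof (rule C1_onI)
  show "((\<lambda>x. f x * g x) has_derivative
     (\<lambda>h. f x * frechet_derivative g (at x) h + frechet_derivative f (at x) h * g x)) (at x)" if "x \<in> S" for x
    by (rule has_derivative_mult[OF C1_onD(1)[OF f that] C1_onD(1)[OF g that]])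
  show "continuous_on S (\<lambda>x. f x * frechet_derivative g (at x) v + frechet_derivative f (at x) v * g x)" for v
    by (intro continuous_intros C1_onD(2,3) f g)
qed

lemma C1_on_sum:
  assumes "\<And>i. i \<in> I \<Longrightarrow> C1_on S (f i)"
  shows "C1_on S (\<lambda>x. \<Sum>i\<in>I. f i x)"
proof (rule C1_onI)
  show "((\<lambda>x. \<Sum>i\<in>I. f i x) has_derivative (\<lambda>h. \<Sum>i\<in>I. frechet_derivative (f i) (at x) h)) (at x)" if "x \<in> S" for x
    by (intro has_derivative_sum C1_onD(1)[OF assms that])
  show "continuous_on S (\<lambda>x. \<Sum>i\<in>I. frechet_derivative (f i) (at x) v)" for v
    by (intro continuous_intros C1_onD(2) assms)
qed

lemma C1_on_wedge_power:
  assumes "\<And>v. C1_on S (\<lambda>x. \<alpha> x v)"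
  shows "C1_on S (\<lambda>x. wedge_power k \<alpha> m x v)"
proof (induction m arbitrary: v)
  case 0
  show ?case by (simp only: wedge_power.simps C1_on_const)
next
  case (Suc m)
  show ?case unfolding wedge_power.simps wedge_def divide_inverse
    by (intro C1_on_mult C1_on_sum C1_on_const assms Suc)
qed

section \<open>Positivity of powers of a Hermitian form\<close>

definition pair_tuple :: "'v \<Rightarrow> 'v \<Rightarrow> nat \<Rightarrow> 'v" where
  "pair_tuple a b = (\<lambda>i. if i = 0 then a else b)"

lemma alternating_form_2_pair:
  assumes "alternating_form 2 f"
  shows "f v = f (pair_tuple (v 0) (v 1))"
  using assms by (rule alternating_form_cong) (auto simp: pair_tuple_def less_2_cases_iff)

lemma alternating_form_2_bilinear:
  assumes f: "alternating_form 2 f"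
  shows "linear (\<lambda>a. f (pair_tuple a b))" "linear (\<lambda>b. f (pair_tuple a b))"
    "f (pair_tuple a b) = - f (pair_tuple b a)"
proof -
  have 1: "f (pair_tuple a b) = f ((pair_tuple c b)(0 := a))" for a b c
    using f by (rule alternating_form_cong) (auto simp: pair_tuple_def)
  have 2: "f (pair_tuple a b) = f ((pair_tuple a c)(1 := b))" for a b c
    using f by (rule alternating_form_cong) (auto simp: pair_tuple_def)
  show "linear (\<lambda>a. f (pair_tuple a b))"
    unfolding 1[of _ _ undefined] by (rule alternating_form_linear[OF f]) simp
  show "linear (\<lambda>b. f (pair_tuple a b))"
    unfolding 2[of _ _ undefined] by (rule alternating_form_linear[OF f]) simp
  have "f (pair_tuple b a) = f ((pair_tuple a b)(0 := b, 1 := a))" 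
    using f by (rule alternating_form_cong) (auto simp: pair_tuple_def)
  also have "\<dots> = - f ((pair_tuple a b)(0 := a, 1 := b))"
    by (rule alternating_form_swap_upd[OF f]) auto
  also have "f ((pair_tuple a b)(0 := a, 1 := b)) = f (pair_tuple a b)"
    using f by (rule alternating_form_cong) (auto simp: pair_tuple_def)
  finally show "f (pair_tuple a b) = - f (pair_tuple b a)" by simp
qed

lemma permutes_fix_first_two:
  assumes "\<rho> permutes {..<2 + n}" "\<rho> 0 = 0" "\<rho> 1 = (1::nat)"
  shows "\<rho> permutes {2..<2 + n}"
proof (rule permutes_superset[OF assms(1)])
  show "\<rho> x = x" if "x \<in> {..<2 + n} - {2..<2 + n}" for x
  proof -
    have "x = 0 \<or> x = 1" using that by auto
    then show ?thesis using assms by auto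
  qed
qed

text \<open>In the sum over permutations a term can be nonzero only if the first two entries form one of the
orthogonal pairs. Such a permutation becomes one that fixes 0 and 1 after an even permutation, which
moves that pair to the front, and possibly a transposition, whose sign is compensated by the
antisymmetry of \<open>\<alpha>\<close>. For these the sign cancels against the sign that the alternating form
\<open>\<alpha>\<^sup>m\<close> produces on the remaining entries, so that every term is nonnegative, and the one of the identity is positive.\<close>

lemma wedge_power_pos_orthogonal:
  fixes \<alpha> :: "'v::euclidean_space form"
  assumes alt: "alternating_form 2 (\<alpha> x)"
    and "\<And>i j. i < 2 * m \<Longrightarrow> j < 2 * m \<Longrightarrow> i div 2 \<noteq> j div 2 \<Longrightarrow> \<alpha> x (pair_tuple (f i) (f j)) = 0"
    and "\<And>k. k < m \<Longrightarrow> \<alpha> x (pair_tuple (f (2 * k)) (f (2 * k + 1))) > 0"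
  shows "wedge_power 2 \<alpha> m x f > 0"
  using assms(2,3)
proof (induction m arbitrary: f)
  case 0
  then show ?case by simp
next
  case (Suc m)
  note orth = Suc.prems(1) and pos = Suc.prems(2)
  let ?\<gamma> = "wedge_power 2 \<alpha> m x"
  let ?B = "\<lambda>a b. \<alpha> x (pair_tuple a b)"
  have \<gamma>: "alternating_form (2 * m) ?\<gamma>" using alt by (rule alternating_form_wedge_power)
  let ?S = "{..<2 + 2 * m}"
  define T where "T f \<pi> = of_int (sign \<pi>) * \<alpha> x (\<lambda>i. f (\<pi> i)) * ?\<gamma> (\<lambda>i. f (\<pi> (2 + i)))" for f and \<pi> :: "nat \<Rightarrow> nat"
  have T_fix: "T g \<rho> > 0" if \<rho>: "\<rho> permutes ?S" "\<rho> 0 = 0" "\<rho> 1 = 1"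
    and g: "\<And>i j. i < 2 * Suc m \<Longrightarrow> j < 2 * Suc m \<Longrightarrow> i div 2 \<noteq> j div 2 \<Longrightarrow> ?B (g i) (g j) = 0"
      "\<And>k. k < Suc m \<Longrightarrow> ?B (g (2 * k)) (g (2 * k + 1)) > 0" for g \<rho>
  proof -
    have "?\<gamma> (\<lambda>i. g (\<rho> (2 + i))) = of_int (sign \<rho>) * ?\<gamma> (\<lambda>i. g (2 + i))"
      by (rule alternating_form_permute[OF \<gamma> permutes_fix_first_two[OF \<rho>]])
    moreover have "\<alpha> x (\<lambda>i. g (\<rho> i)) = ?B (g 0) (g 1)"
      using alternating_form_2_pair[OF alt, of "\<lambda>i. g (\<rho> i)"] \<rho> by simp
    moreover have "of_int (sign \<rho>) * of_int (sign \<rho>) = (1::real)"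
      by (simp flip: of_int_mult)
    ultimately have "T g \<rho> = ?B (g 0) (g 1) * ?\<gamma> (\<lambda>i. g (2 + i))"
      unfolding T_def by (simp add: algebra_simps)
    moreover have "?B (g 0) (g 1) > 0" using g(2)[of 0] by simp
    moreover have "?\<gamma> (\<lambda>i. g (2 + i)) > 0"
    proof (rule Suc.IH)
      show "?B (g (2 + i)) (g (2 + j)) = 0" if "i < 2 * m" "j < 2 * m" "i div 2 \<noteq> j div 2" for i j
        using that by (intro g(1)) auto
      show "?B (g (2 + 2 * k)) (g (2 + (2 * k + 1))) > 0" if "k < m" for k
        using that g(2)[of "Suc k"] by simp
    qed
    ultimately show ?thesis by simp
  qed
  have T_first: "T g \<rho> > 0" if \<rho>: "\<rho> permutes ?S" "\<rho> 0 div 2 = 0" "\<rho> 1 div 2 = 0"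
    and g: "\<And>i j. i < 2 * Suc m \<Longrightarrow> j < 2 * Suc m \<Longrightarrow> i div 2 \<noteq> j div 2 \<Longrightarrow> ?B (g i) (g j) = 0"
      "\<And>k. k < Suc m \<Longrightarrow> ?B (g (2 * k)) (g (2 * k + 1)) > 0" for g \<rho>
  proof -
    have ne: "\<rho> 0 \<noteq> \<rho> 1" using permutes_inj[OF \<rho>(1)] by (auto dest: injD)
    have lt: "\<rho> 0 < 2" "\<rho> 1 < 2" using \<rho> by auto
    show ?thesis
    proof (cases "\<rho> 0 = 0")
      case True
      then have "\<rho> 1 = 1" using ne lt by auto
      then show ?thesis using T_fix[OF \<rho>(1) True _ g] by simp
    next
      case False
      then have e: "\<rho> 0 = 1" "\<rho> 1 = 0" using ne lt by auto
      define \<rho>' where "\<rho>' = \<rho> \<circ> Transposition.transpose 0 1"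
      have t: "Transposition.transpose 0 1 permutes ?S" by (rule permutes_swap_id) auto
      have p: "\<rho>' permutes ?S" unfolding \<rho>'_def by (rule permutes_compose[OF t \<rho>(1)])
      have s: "sign \<rho>' = - sign \<rho>" unfolding \<rho>'_def
        using \<rho>(1) by (subst sign_compose) (auto simp: sign_swap_id permutation_swap_id intro: permutes_imp_permutation)
      have e': "\<rho>' 0 = 0" "\<rho>' 1 = 1" "\<And>i. \<rho>' (2 + i) = \<rho> (2 + i)" using e by (auto simp: \<rho>'_def Transposition.transpose_def)
      have "T g \<rho> = T g \<rho>'"
        unfolding T_def s e'(3)
        using alternating_form_2_pair[OF alt, of "\<lambda>i. g (\<rho> i)"] alternating_form_2_pair[OF alt, of "\<lambda>i. g (\<rho>' i)"]
          alternating_form_2_bilinear(3)[OF alt, of "g 0" "g 1"] e e' by simp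
      then show ?thesis using T_fix[OF p e'(1,2) g] by simp
    qed
  qed
  have nonneg: "T f \<pi> \<ge> 0" if \<pi>: "\<pi> permutes ?S" for \<pi>
  proof (cases "\<pi> 0 div 2 = \<pi> 1 div 2")
    case False
    have "\<pi> 0 < 2 * Suc m" "\<pi> 1 < 2 * Suc m" using permutes_in_image[OF \<pi>, of 0] permutes_in_image[OF \<pi>, of 1] by auto
    then have "\<alpha> x (\<lambda>i. f (\<pi> i)) = 0"
      using alternating_form_2_pair[OF alt, of "\<lambda>i. f (\<pi> i)"] orth False by simp
    then show ?thesis by (simp add: T_def)
  next
    case True
    define k where "k = \<pi> 0 div 2"
    have k: "k < Suc m" using permutes_in_image[OF \<pi>, of 0] by (auto simp: k_def)
    \<comment> \<open>exchanges the pair number \<open>k\<close> with the first one; even, also in the degenerate case \<open>k = 0\<close>\<close>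
    define \<tau> where "\<tau> = Transposition.transpose 0 (2 * k) \<circ> Transposition.transpose 1 (2 * k + 1)"
    have \<tau>: "\<tau> permutes ?S" unfolding \<tau>_def
      using k by (intro permutes_compose permutes_swap_id) auto
    have sg: "sign \<tau> = 1" unfolding \<tau>_def
      by (subst sign_compose) (auto simp: sign_swap_id permutation_swap_id)
    have ev: "\<tau> (2 * j) = 2 * Transposition.transpose 0 k j" for j
      by (auto simp: \<tau>_def Transposition.transpose_def) presburger+
    have od: "\<tau> (2 * j + 1) = 2 * Transposition.transpose 0 k j + 1" for j
      by (auto simp: \<tau>_def Transposition.transpose_def)
    have dv: "\<tau> j div 2 = Transposition.transpose 0 k (j div 2)" for j
    proof (cases "even j")
      case True
      then obtain i where "j = 2 * i" by auto
      then show ?thesis using ev by simp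
    next
      case False
      then obtain i where "j = 2 * i + 1" by (auto elim: oddE)
      then show ?thesis unfolding \<open>j = _\<close> od by simp
    qed
    have inv: "\<tau> (\<tau> j) = j" for j
    proof (cases "even j")
      case True
      then obtain i where "j = 2 * i" by auto
      then show ?thesis using ev by simp
    next
      case False
      then obtain i where "j = 2 * i + 1" by (auto elim: oddE)
      then show ?thesis unfolding \<open>j = _\<close> od by simp
    qed
    have tk: "Transposition.transpose 0 k j < Suc m" if "j < Suc m" for j
      using that k by (auto simp: Transposition.transpose_def)
    have p: "(\<tau> \<circ> \<pi>) permutes ?S" by (rule permutes_compose[OF \<pi> \<tau>])
    have "T (\<lambda>i. f (\<tau> i)) (\<tau> \<circ> \<pi>) > 0"
    proof (rule T_first[OF p])
      show "(\<tau> \<circ> \<pi>) 0 div 2 = 0" "(\<tau> \<circ> \<pi>) 1 div 2 = 0"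
        using True by (simp_all add: dv k_def)
      show "?B (f (\<tau> i)) (f (\<tau> j)) = 0" if "i < 2 * Suc m" "j < 2 * Suc m" "i div 2 \<noteq> j div 2" for i j
      proof (rule orth)
        show "\<tau> i < 2 * Suc m" "\<tau> j < 2 * Suc m"
          using permutes_in_image[OF \<tau>, of i] permutes_in_image[OF \<tau>, of j] that by auto
        show "\<tau> i div 2 \<noteq> \<tau> j div 2" using that(3) unfolding dv by (metis transpose_involutory)
      qed
      show "?B (f (\<tau> (2 * j))) (f (\<tau> (2 * j + 1))) > 0" if "j < Suc m" for j
        unfolding ev od by (rule pos[OF tk[OF that]])
    qed
    moreover have "sign (\<tau> \<circ> \<pi>) = sign \<pi>"
      using \<tau> \<pi> by (subst sign_compose) (auto simp: sg intro: permutes_imp_permutation)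
    ultimately show ?thesis by (simp add: T_def inv)
  qed
  have "T f id > 0" by (rule T_fix) (use orth pos in \<open>auto simp: permutes_id\<close>)
  then have "(\<Sum>\<pi> | \<pi> permutes ?S. T f \<pi>) > 0"
    using nonneg by (intro sum_pos2[of _ id]) (auto simp: finite_permutations permutes_id)
  then show ?case by (simp add: wedge_def T_def)
qed

text \<open>The real basis \<open>w\<^sub>0, \<i> w\<^sub>0, w\<^sub>1, \<i> w\<^sub>1, \<dots>\<close> of the complex span of \<open>w\<close>, in the order that gives
the complex orientation.\<close>

definition complex_tuple :: "(nat \<Rightarrow> complex ^ 'n) \<Rightarrow> nat \<Rightarrow> complex ^ 'n" where
  "complex_tuple w j = (if even j then w (j div 2) else \<i> *s w (j div 2))"

lemma complex_scale_split: "c *s (x :: complex ^ 'n) = Re c *\<^sub>R x + Im c *\<^sub>R (\<i> *s x)"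
  by (auto simp: vec_eq_iff complex_eq_iff)

lemma alternating_form_complex_shear:
  assumes f: "alternating_form (2 * m) f" and K: "K < m"
  shows "f (complex_tuple (w(K := w K + (\<Sum>l<K. c l *s w l)))) = f (complex_tuple w)"
proof -
  let ?p = "\<Sum>l<K. c l *s w l" and ?v = "complex_tuple w"
  have mem: "c *s w l \<in> span (v ` (A - {i}))" if "l < K" "i \<in> {2 * K, 2 * K + 1}" "A = {..<2 * m}"
    "v (2 * l) = w l" "v (2 * l + 1) = \<i> *s w l" for c l v i A
  proof -
    have "2 * l \<in> A - {i}" "2 * l + 1 \<in> A - {i}" using that(1,2,3) K by (auto, presburger+)
    then have "v (2 * l) \<in> span (v ` (A - {i}))" "v (2 * l + 1) \<in> span (v ` (A - {i}))"
      by (blast intro: span_base)+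
    then have "w l \<in> span (v ` (A - {i}))" "\<i> *s w l \<in> span (v ` (A - {i}))"
      unfolding that(4,5) .
    then show ?thesis unfolding complex_scale_split[of c] by (intro span_add span_scale)
  qed
  have val: "?v (2 * l) = w l" "?v (2 * l + 1) = \<i> *s w l" for l by (auto simp: complex_tuple_def)
  have "f (?v(2 * K := ?v (2 * K) + ?p)) = f ?v"
    by (intro alternating_form_add_span[OF f] span_sum mem) (use K val in auto)
  moreover let ?v' = "?v(2 * K := ?v (2 * K) + ?p)"
  have "f (?v'(2 * K + 1 := ?v' (2 * K + 1) + \<i> *s ?p)) = f ?v'"
    unfolding vector_space_over_itself.scale_sum_right vec.scale_sum_right vec.scale_scale
    by (intro alternating_form_add_span[OF f] span_sum mem) (use K val in auto)
  moreover have "?v'(2 * K + 1 := ?v' (2 * K + 1) + \<i> *s ?p) = complex_tuple (w(K := w K + ?p))"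
    by (rule ext) (auto simp: complex_tuple_def vector_add_ldistrib elim: oddE)
  ultimately show ?thesis by simp
qed

text \<open>The Gram-Schmidt process for the Hermitian form that belongs to \<open>\<alpha>\<close> turns the coordinate vectors
into an orthogonal system by complex shears, which do not change the value of an alternating form
on the corresponding real basis.\<close>

lemma wedge_power_pos:
  fixes \<alpha> :: "(complex ^ 'n::finite) form"
  assumes alt: "alternating_form 2 (\<alpha> x)"
    and J: "\<And>v. \<alpha> x (\<lambda>i. \<i> *s v i) = \<alpha> x v"
    and pos: "\<And>u. u \<noteq> 0 \<Longrightarrow> \<alpha> x (\<lambda>i. if i = 0 then u else \<i> *s u) > 0"
    and b: "inj_on b {..<m}"
  shows "wedge_power 2 \<alpha> m x (complex_tuple (\<lambda>k. axis (b k) 1)) > 0"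
proof -
  let ?B = "\<lambda>a b. \<alpha> x (pair_tuple a b)"
  let ?\<gamma> = "wedge_power 2 \<alpha> m x"
  let ?e = "\<lambda>k. axis (b k) 1 :: complex ^ 'n"
  have \<gamma>: "alternating_form (2 * m) ?\<gamma>" using alt by (rule alternating_form_wedge_power)
  note lin = alternating_form_2_bilinear(1,2)[OF alt] and anti = alternating_form_2_bilinear(3)[OF alt]
  have JJ: "?B (\<i> *s a) (\<i> *s c) = ?B a c" for a c
    using J[of "pair_tuple a c"] by (simp add: pair_tuple_def if_distrib cong: if_cong)
  have ii: "\<i> *s (\<i> *s a) = - a" for a :: "complex ^ 'n" by (simp add: vec_eq_iff)
  have J1: "?B (\<i> *s a) c = - ?B a (\<i> *s c)" for a c
    using JJ[of "\<i> *s a" c] linear_neg[OF lin(1)] by (simp add: ii)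
  have Bpos: "?B u (\<i> *s u) > 0" if "u \<noteq> 0" for u
    using pos[OF that] by (simp add: pair_tuple_def)
  have self: "?B a a = 0" for a using anti[of a a] by simp
  have "\<exists>w. (\<forall>k\<ge>K. w k = ?e k) \<and> ?\<gamma> (complex_tuple w) = ?\<gamma> (complex_tuple ?e) \<and>
      (\<forall>l<K. \<forall>k<m. l \<le> k \<longrightarrow> w l $ b k = (if k = l then 1 else 0)) \<and>
      (\<forall>k<K. \<forall>l<K. k \<noteq> l \<longrightarrow> ?B (w k) (w l) = 0 \<and> ?B (w k) (\<i> *s w l) = 0)" if "K \<le> m" for K
    using that
  proof (induction K)
    case 0
    show ?case by (intro exI[of _ ?e]) auto
  next
    case (Suc K)
    from Suc.IH[OF Suc_leD[OF Suc.prems]]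
    obtain w where W: "\<forall>k\<ge>K. w k = ?e k" "?\<gamma> (complex_tuple w) = ?\<gamma> (complex_tuple ?e)"
      "\<forall>l<K. \<forall>k<m. l \<le> k \<longrightarrow> w l $ b k = (if k = l then 1 else 0)"
      "\<forall>k<K. \<forall>l<K. k \<noteq> l \<longrightarrow> ?B (w k) (w l) = 0 \<and> ?B (w k) (\<i> *s w l) = 0"
      by (elim exE conjE) (rule that)
    have w: "\<And>k. k \<ge> K \<Longrightarrow> w k = ?e k" "?\<gamma> (complex_tuple w) = ?\<gamma> (complex_tuple ?e)"
      "\<And>l k. l < K \<Longrightarrow> k < m \<Longrightarrow> l \<le> k \<Longrightarrow> w l $ b k = (if k = l then 1 else 0)"
      "\<And>k l. k < K \<Longrightarrow> l < K \<Longrightarrow> k \<noteq> l \<Longrightarrow> ?B (w k) (w l) = 0 \<and> ?B (w k) (\<i> *s w l) = 0"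
      using W by blast+
    have K: "K < m" using Suc by simp
    have w0: "w l \<noteq> 0" if "l < K" for l using w(3)[of l l] that K by auto
    define q where "q l = ?B (w l) (\<i> *s w l)" for l
    have q: "q l > 0" if "l < K" for l using Bpos[OF w0[OF that]] by (simp add: q_def)
    \<comment> \<open>the coefficients that make \<open>w' K\<close> orthogonal to \<open>w l\<close> and to \<open>\<i> *s w l\<close>\<close>
    define c where "c l = Complex (?B (\<i> *s w l) (?e K) / q l) (- ?B (w l) (?e K) / q l)" for l
    define p where "p = (\<Sum>l<K. c l *s w l)"
    define w' where "w' = w(K := w K + p)"
    have wK: "w K = ?e K" using w(1) by simp
    have o1: "?B (w l) (w' K) = 0" and o2: "?B (w l) (\<i> *s w' K) = 0" if l: "l < K" for l
    proof -
      have t: "?B (w l) (c k *s w k) = (if k = l then - ?B (w l) (?e K) else 0)"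
        "?B (\<i> *s w l) (c k *s w k) = (if k = l then - ?B (\<i> *s w l) (?e K) else 0)" if "k < K" for k
      proof -
        have 1: "?B z (c k *s w k) = Re (c k) * ?B z (w k) + Im (c k) * ?B z (\<i> *s w k)" for z
          unfolding complex_scale_split[of "c k"] linear_add[OF lin(2)] linear_scale[OF lin(2)] by simp
        show "?B (w l) (c k *s w k) = (if k = l then - ?B (w l) (?e K) else 0)"
          unfolding 1 using w(4)[of l k] l that q[OF l] by (auto simp: self c_def q_def)
        show "?B (\<i> *s w l) (c k *s w k) = (if k = l then - ?B (\<i> *s w l) (?e K) else 0)"
          unfolding 1 JJ using w(4)[of l k] l that q[OF l] J1[of "w l" "w k"] by (auto simp: self c_def q_def)
      qed
      have "?B z (w' K) = ?B z (?e K) + (\<Sum>k<K. ?B z (c k *s w k))" for z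
        unfolding w'_def p_def by (simp add: wK linear_add[OF lin(2)] linear_sum[OF lin(2)])
      then have "?B (w l) (w' K) = 0" "?B (\<i> *s w l) (w' K) = 0"
        using l by (simp_all add: t)
      then show "?B (w l) (w' K) = 0" "?B (w l) (\<i> *s w' K) = 0" using J1[of "w l" "w' K"] by auto
    qed
    have o3: "?B (w' K) (w l) = 0" "?B (w' K) (\<i> *s w l) = 0" if "l < K" for l
      using o1[OF that] o2[OF that] anti[of "w' K" "w l"] J1[of "w' K" "w l"] anti[of "\<i> *s w' K" "w l"] by auto
    have lt: "w' l = w l" if "l < K" for l using that by (simp add: w'_def)
    show ?case
    proof (intro exI[of _ w'] conjI allI impI)
      show "w' k = ?e k" if "Suc K \<le> k" for k using that w(1) by (simp add: w'_def)
      show "?\<gamma> (complex_tuple w') = ?\<gamma> (complex_tuple ?e)"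
        unfolding w'_def p_def using alternating_form_complex_shear[OF \<gamma> K] w(2) by simp
    next
      fix l k assume lk: "l < Suc K" "k < m" "l \<le> k"
      show "w' l $ b k = (if k = l then 1 else 0)"
      proof (cases "l = K")
        case True
        have "(?e K) $ b k = (if k = l then 1 else 0)"
          using b lk True by (auto simp: axis_def inj_on_def)
        moreover have "p $ b k = 0"
          unfolding p_def using w(3) lk True by (auto simp: sum_component intro!: sum.neutral)
        ultimately show ?thesis by (simp add: w'_def True wK)
      next
        case False
        then show ?thesis using lk w(3)[of l k] by (simp add: w'_def)
      qed
    next
      fix k l assume kl: "k < Suc K" "l < Suc K" "k \<noteq> l"
      show "?B (w' k) (w' l) = 0"
        using kl o1 o3 w(4) lt by (cases "k = K"; cases "l = K") auto
      show "?B (w' k) (\<i> *s w' l) = 0"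
        using kl o2 o3 w(4) lt by (cases "k = K"; cases "l = K") auto
    qed
  qed
  from this[OF order_refl]
  obtain w where W: "?\<gamma> (complex_tuple w) = ?\<gamma> (complex_tuple ?e)"
      "\<forall>l<m. \<forall>k<m. l \<le> k \<longrightarrow> w l $ b k = (if k = l then 1 else 0)"
      "\<forall>k<m. \<forall>l<m. k \<noteq> l \<longrightarrow> ?B (w k) (w l) = 0 \<and> ?B (w k) (\<i> *s w l) = 0"
    by (elim exE conjE) (rule that)
  have w: "?\<gamma> (complex_tuple w) = ?\<gamma> (complex_tuple ?e)"
      "\<And>l k. l < m \<Longrightarrow> k < m \<Longrightarrow> l \<le> k \<Longrightarrow> w l $ b k = (if k = l then 1 else 0)"
      "\<And>k l. k < m \<Longrightarrow> l < m \<Longrightarrow> k \<noteq> l \<Longrightarrow> ?B (w k) (w l) = 0 \<and> ?B (w k) (\<i> *s w l) = 0"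
    using W by blast+
  have "?\<gamma> (complex_tuple w) > 0"
  proof (rule wedge_power_pos_orthogonal[where \<alpha> = \<alpha>, OF alt])
    fix i j assume ij: "i < 2 * m" "j < 2 * m" "i div 2 \<noteq> j div 2"
    then show "?B (complex_tuple w i) (complex_tuple w j) = 0"
      using w(3)[of "i div 2" "j div 2"] J1 JJ by (auto simp: complex_tuple_def)
  next
    fix k assume "k < m"
    then have "w k \<noteq> 0" using w(2)[of k k] by auto
    then show "?B (complex_tuple w (2 * k)) (complex_tuple w (2 * k + 1)) > 0"
      using Bpos by (simp add: complex_tuple_def)
  qed
  then show ?thesis using w(1) by simp
qed

definition real_basis_vector :: "'n \<times> bool \<Rightarrow> complex ^ 'n" where
  "real_basis_vector p = (if snd p then \<i> *s axis (fst p) 1 else axis (fst p) 1)"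

text \<open>Multiplication by \<open>c\<close> on a complex line has real determinant \<open>|c|\<^sup>2\<close>.\<close>

lemma alternating_form_complex_scale:
  assumes f: "alternating_form d f" and ij: "i < d" "j < d" "i \<noteq> j" and v: "v j = \<i> *s v i"
  shows "f (v(i := c *s v i, j := c *s v j)) = (cmod c)\<^sup>2 * f (v :: nat \<Rightarrow> complex ^ 'n::finite)"
proof -
  define e g where "e = v i" and "g = v j"
  have ii: "\<i> *s (\<i> *s a) = - a" for a :: "complex ^ 'n" by (simp add: vec_eq_iff)
  have c1: "c *s v i = Re c *\<^sub>R e + Im c *\<^sub>R g" unfolding complex_scale_split[of c] e_def g_def v by simp
  have c2: "c *s v j = Re c *\<^sub>R g + (- Im c) *\<^sub>R e" unfolding complex_scale_split[of c] e_def g_def v ii by simp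
  have z: "f (v(i := z, j := z)) = 0" for z
    using ij by (intro alternating_form_eq_0[OF f ij]) auto
  have A: "f (v(i := x, j := r *\<^sub>R g + s *\<^sub>R e)) = r * f (v(i := x, j := g)) + s * f (v(i := x, j := e))" for x r s
    by (simp only: alternating_form_add[OF f ij(2)] alternating_form_scale[OF f ij(2)])
  have "v(i := x, j := y) = v(j := y, i := x)" for x y using ij(3) by (rule fun_upd_twist)
  then have Bm: "f (v(i := r *\<^sub>R e + s *\<^sub>R g, j := y)) = r * f (v(i := e, j := y)) + s * f (v(i := g, j := y))" for r s y
    by (simp only: alternating_form_add[OF f ij(1)] alternating_form_scale[OF f ij(1)])
  have sw: "f (v(i := g, j := e)) = - f (v(i := e, j := g))" by (rule alternating_form_swap_upd[OF f ij])
  have "v(i := e, j := g) = v" by (auto simp: e_def g_def)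
  then show ?thesis unfolding c1 c2 A Bm z sw unfolding cmod_power2 by (simp add: algebra_simps power2_eq_square)
qed

text \<open>A diagonal complex matrix acts on a tuple of distinct real basis vectors by the product of its
determinants on the coordinate lines. A line of which only one real basis vector
occurs has such a determinant only if the factor is real, whence the case distinction. The proof switches
the factors on one after the other.\<close>

lemma alternating_form_diagonal_scale:
  fixes lab :: "nat \<Rightarrow> 'n::finite \<times> bool" and \<mu> :: "'n \<Rightarrow> complex" and c :: "'n \<Rightarrow> real"
  assumes f: "alternating_form d f" and inj: "inj_on lab {..<d}"
    and c: "\<And>k. if (k, True) \<in> lab ` {..<d} then
                if (k, False) \<in> lab ` {..<d} then c k = (cmod (\<mu> k))\<^sup>2 else \<mu> k = of_real (c k)
              else if (k, False) \<in> lab ` {..<d} then \<mu> k = of_real (c k) else c k = 1"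
  shows "f (\<lambda>j. \<chi> k. \<mu> k * real_basis_vector (lab j) $ k) = (\<Prod>k\<in>UNIV. c k) * f (\<lambda>j. real_basis_vector (lab j))"
proof -
  define R where "R A z = (\<chi> k. (if k \<in> A then \<mu> k else 1) * z $ k)" for A and z :: "complex ^ 'n"
  have R_ins: "R (insert k A) (real_basis_vector p) = (if fst p = k then \<mu> k *s real_basis_vector p else R A (real_basis_vector p))"
    if "k \<notin> A" for k A p
    using that by (auto simp: R_def real_basis_vector_def vec_eq_iff axis_def)
  have R_same: "R A (real_basis_vector p) = real_basis_vector p" if "fst p \<notin> A" for A p
    using that by (auto simp: R_def real_basis_vector_def vec_eq_iff axis_def)
  have "f (\<lambda>j. R A (real_basis_vector (lab j))) = (\<Prod>k\<in>A. c k) * f (\<lambda>j. real_basis_vector (lab j))" for A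
    using finite[of A]
  proof (induction A rule: finite_induct)
    case empty
    then show ?case by (simp add: R_same)
  next
    case (insert k A)
    let ?u = "\<lambda>j. R A (real_basis_vector (lab j))" and ?u' = "\<lambda>j. R (insert k A) (real_basis_vector (lab j))"
    have step: "f ?u' = c k * f ?u"
    proof -
      have u: "?u j = real_basis_vector (k, h)" if "lab j = (k, h)" for j h
        using that insert.hyps by (simp add: R_same)
      have u': "?u' j = (if fst (lab j) = k then \<mu> k *s ?u j else ?u j)" for j
        using R_ins[OF insert.hyps(2), of "lab j"] R_same[of "lab j" A] insert.hyps(2) by auto
      have single: "f ?u' = c k * f ?u" if p: "p < d" "lab p = (k, h)" and n: "(k, \<not> h) \<notin> lab ` {..<d}" and r: "\<mu> k = of_real (c k)" for p h
      proof -
        have "f ?u' = f (?u(p := c k *\<^sub>R ?u p))"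
        proof (rule alternating_form_cong[OF f])
          fix j assume j: "j < d"
          show "?u' j = (?u(p := c k *\<^sub>R ?u p)) j"
          proof (cases "fst (lab j) = k")
            case True
            obtain h' where h': "lab j = (k, h')" using True by (cases "lab j") auto
            have "h' = h" using h' j n by (cases h; cases h') (auto intro: rev_image_eqI)
            then have "j = p" using h' p j inj by (auto simp: inj_on_def)
            moreover have "\<mu> k *s z = c k *\<^sub>R z" for z :: "complex ^ 'n" unfolding r by (simp add: vec_eq_iff) (simp add: scaleR_conv_of_real)
            ultimately show ?thesis using True u' by simp
          next
            case False
            then have "j \<noteq> p" using p by auto
            then show ?thesis using False u' by simp
          qed
        qed
        also have "\<dots> = c k * f (?u(p := ?u p))" by (rule alternating_form_scale[OF f p(1)])
        also have "?u(p := ?u p) = ?u" by auto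
        finally show ?thesis .
      qed
      consider p q where "p < d" "q < d" "lab p = (k, False)" "lab q = (k, True)" "c k = (cmod (\<mu> k))\<^sup>2"
        | p h where "p < d" "lab p = (k, h)" "(k, \<not> h) \<notin> lab ` {..<d}" "\<mu> k = of_real (c k)"
        | "(k, True) \<notin> lab ` {..<d}" "(k, False) \<notin> lab ` {..<d}" "c k = 1"
      proof -
        note ck = c[of k]
        show ?thesis
        proof (cases "(k, True) \<in> lab ` {..<d}")
          case T: True
          then obtain q where q: "q < d" "lab q = (k, True)" by auto
          show ?thesis
          proof (cases "(k, False) \<in> lab ` {..<d}")
            case True
            then obtain p where "p < d" "lab p = (k, False)" by auto
            then show ?thesis using q ck T True that(1) by simp
          next
            case False
            then show ?thesis using q ck T that(2)[of q True] by simp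
          qed
        next
          case F: False
          show ?thesis
          proof (cases "(k, False) \<in> lab ` {..<d}")
            case True
            then obtain p where "p < d" "lab p = (k, False)" by auto
            then show ?thesis using ck F True that(2)[of p False] by simp
          next
            case False
            then show ?thesis using ck F that(3) by simp
          qed
        qed
      qed
      then show ?thesis
      proof cases
        case (1 p q)
        have pq: "p \<noteq> q" using 1 by auto
        have "f ?u' = f (?u(p := \<mu> k *s ?u p, q := \<mu> k *s ?u q))"
        proof (rule alternating_form_cong[OF f])
          fix j assume j: "j < d"
          show "?u' j = (?u(p := \<mu> k *s ?u p, q := \<mu> k *s ?u q)) j"
          proof (cases "fst (lab j) = k")
            case True
            then obtain h where h: "lab j = (k, h)" by (cases "lab j") auto
            then have "j = (if h then q else p)" using 1 j inj by (auto simp: inj_on_def)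
            then show ?thesis using True u' pq by auto
          next
            case False
            then have "j \<noteq> p" "j \<noteq> q" using 1 by auto
            then show ?thesis using False u' by simp
          qed
        qed
        also have "\<dots> = (cmod (\<mu> k))\<^sup>2 * f ?u"
          using alternating_form_complex_scale[OF f 1(1,2) pq, of ?u "\<mu> k"] u[OF 1(3)] u[OF 1(4)]
          by (simp add: real_basis_vector_def)
        finally show ?thesis using 1 by simp
      next
        case (2 p h)
        then show ?thesis by (rule single)
      next
        case 3
        have "f ?u' = f ?u"
        proof (rule alternating_form_cong[OF f])
          fix j assume j: "j < d"
          have "fst (lab j) \<noteq> k"
          proof
            assume "fst (lab j) = k"
            then obtain h where "lab j = (k, h)" by (cases "lab j") auto
            then show False using 3 j by (cases h) (auto intro: rev_image_eqI)
          qed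
          then show "?u' j = ?u j" using u' by simp
        qed
        then show ?thesis using 3 by simp
      qed
    qed
    show ?case using insert step by simp
  qed
  from this[of UNIV] show ?thesis by (simp add: R_def)
qed

section \<open>A divergence estimate on boxes\<close>

text \<open>An \<open>L\<^sup>\<infinity>\<close> form of the divergence theorem on the box with corner \<open>x0\<close> and sides \<open>L i *\<^sub>R d i\<close>: a divergence
of at least \<open>c\<close> cannot exceed the flux through the boundary divided by the volume. The induction
averages all functions over one direction \<open>j\<close>; the component \<open>h j\<close> then contributes only its values at the two
ends, at most \<open>2 C j / L j\<close> in the mean. No integral over more than one variable is formed.\<close>

lemma flux_bound:
  fixes d :: "'i \<Rightarrow> 'v::euclidean_space" and h D :: "'i \<Rightarrow> 'v \<Rightarrow> real"
  assumes "finite I"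
    and "\<And>i. i \<in> I \<Longrightarrow> L i > 0"
    and "\<And>i. i \<in> I \<Longrightarrow> continuous_on UNIV (h i)"
    and "\<And>i. i \<in> I \<Longrightarrow> continuous_on UNIV (D i)"
    and "\<And>i x. i \<in> I \<Longrightarrow> ((\<lambda>t. h i (x + t *\<^sub>R d i)) has_real_derivative D i x) (at 0)"
    and "\<And>i t. i \<in> I \<Longrightarrow> (\<And>k. k \<in> I \<Longrightarrow> 0 \<le> t k \<and> t k \<le> L k) \<Longrightarrow> \<bar>h i (x0 + (\<Sum>k\<in>I. t k *\<^sub>R d k))\<bar> \<le> C i"
    and "\<And>t. (\<And>k. k \<in> I \<Longrightarrow> 0 \<le> t k \<and> t k \<le> L k) \<Longrightarrow> c \<le> (\<Sum>i\<in>I. D i (x0 + (\<Sum>k\<in>I. t k *\<^sub>R d k)))"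
  shows "c \<le> (\<Sum>i\<in>I. 2 * C i / L i)"
  using assms
proof (induction I arbitrary: h D c rule: finite_induct)
  case empty
  show ?case using empty(6)[of "\<lambda>_. 0"] by simp
next
  case (insert j I)
  note Lpos = insert.prems(1) and hc = insert.prems(2) and Dc = insert.prems(3)
    and der = insert.prems(4) and bd = insert.prems(5) and low = insert.prems(6)
  have jn: "j \<notin> I" by fact
  let ?A = "\<lambda>(f::'v\<Rightarrow>real) x. integral {0..L j} (\<lambda>t. f (x + t *\<^sub>R d j)) / L j"
  have Lj: "L j > 0" using Lpos by simp
  have cont_line: "continuous_on {0..L j} (\<lambda>t. f (x + t *\<^sub>R d j))" if "continuous_on UNIV f" for f :: "'v\<Rightarrow>real" and x
    by (rule continuous_on_compose2[OF that]) (auto intro!: continuous_intros)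
  have int_line: "(\<lambda>t. f (x + t *\<^sub>R d j)) integrable_on {0..L j}" if "continuous_on UNIV f" for f :: "'v\<Rightarrow>real" and x
    using cont_line[OF that] by (rule integrable_continuous_real)
  have Acont: "continuous_on UNIV (?A f)" if "continuous_on UNIV f" for f :: "'v\<Rightarrow>real"
  proof -
    have "continuous_on UNIV (\<lambda>x. integral (cbox 0 (L j)) (\<lambda>t. f (x + t *\<^sub>R d j)))"
      by (rule integral_continuous_on_param, simp add: split_def,
          rule continuous_on_compose2[OF that]) (auto intro!: continuous_intros)
    then show ?thesis using Lj by (auto intro!: continuous_intros)
  qed
  have ders: "((\<lambda>t. h i (x + t *\<^sub>R d i)) has_real_derivative D i (x + s *\<^sub>R d i)) (at s)" if "i \<in> insert j I" for i x s
    using der[OF that, of "x + s *\<^sub>R d i"]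
    by (subst DERIV_shift[of "\<lambda>t. h i (x + t *\<^sub>R d i)" _ 0 s, simplified]) (simp add: algebra_simps)
  have adm: "0 \<le> (t(j:=s)) k \<and> (t(j:=s)) k \<le> L k"
    if "\<And>k. k \<in> I \<Longrightarrow> 0 \<le> t k \<and> t k \<le> L k" "s \<in> {0..L j}" "k \<in> insert j I" for t s k
    using that by auto
  have key: "c - 2 * C j / L j \<le> (\<Sum>i\<in>I. 2 * C i / L i)"
  proof (rule insert.IH[where h = "\<lambda>i. ?A (h i)" and D = "\<lambda>i. ?A (D i)"])
    show "\<And>i. i \<in> I \<Longrightarrow> 0 < L i" using Lpos by simp
    show "\<And>i. i \<in> I \<Longrightarrow> continuous_on UNIV (?A (h i))" by (rule Acont) (use hc in simp)
    show "\<And>i. i \<in> I \<Longrightarrow> continuous_on UNIV (?A (D i))" by (rule Acont) (use Dc in simp)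
  next
    fix i x assume i: "i \<in> I"
    have ce: "x + y *\<^sub>R d i + t *\<^sub>R d j = (x + t *\<^sub>R d j) + y *\<^sub>R d i" for y t by simp
    have "((\<lambda>s. integral (cbox 0 (L j)) (\<lambda>t. h i (x + s *\<^sub>R d i + t *\<^sub>R d j))) has_field_derivative
        integral (cbox 0 (L j)) (\<lambda>t. D i (x + 0 *\<^sub>R d i + t *\<^sub>R d j))) (at 0 within UNIV)"
    proof (rule leibniz_rule_field_derivative)
      fix s t :: real
      show "((\<lambda>s. h i (x + s *\<^sub>R d i + t *\<^sub>R d j)) has_field_derivative D i (x + s *\<^sub>R d i + t *\<^sub>R d j)) (at s within UNIV)"
        unfolding ce using ders[of i "x + t *\<^sub>R d j" s] i by simp
    next
      fix s :: real
      show "(\<lambda>t. h i (x + s *\<^sub>R d i + t *\<^sub>R d j)) integrable_on cbox 0 (L j)"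
        using int_line[of "h i" "x + s *\<^sub>R d i"] hc i by simp
    next
      show "continuous_on (UNIV \<times> cbox 0 (L j)) (\<lambda>(s, t). D i (x + s *\<^sub>R d i + t *\<^sub>R d j))"
        unfolding split_def
        by (rule continuous_on_compose2[of UNIV "D i"]) (use Dc i in \<open>auto intro!: continuous_intros\<close>)
    qed auto
    then show "((\<lambda>s. ?A (h i) (x + s *\<^sub>R d i)) has_real_derivative ?A (D i) x) (at 0)"
      by (simp add: DERIV_cdivide)
  next
    fix i and t :: "'i \<Rightarrow> real"
    assume i: "i \<in> I" and t: "\<And>k. k \<in> I \<Longrightarrow> 0 \<le> t k \<and> t k \<le> L k"
    let ?x = "x0 + (\<Sum>k\<in>I. t k *\<^sub>R d k)"
    have "\<bar>h i (?x + s *\<^sub>R d j)\<bar> \<le> C i" if "s \<in> {0..L j}" for s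
    proof -
      have "(\<Sum>k\<in>insert j I. (t(j:=s)) k *\<^sub>R d k) = s *\<^sub>R d j + (\<Sum>k\<in>I. t k *\<^sub>R d k)"
        using insert.hyps by (simp add: sum.insert) (intro sum.cong, auto)
      then show ?thesis using bd[of i "t(j:=s)", OF _ adm[of t s]] i t that by (auto simp: algebra_simps)
    qed
    then have "norm (integral {0..L j} (\<lambda>s. h i (?x + s *\<^sub>R d j))) \<le> C i * (L j - 0)"
      by (intro integral_bound) (use Lj cont_line hc i in auto)
    then show "\<bar>?A (h i) ?x\<bar> \<le> C i" using Lj by (simp add: field_simps)
  next
    fix t :: "'i \<Rightarrow> real"
    assume t: "\<And>k. k \<in> I \<Longrightarrow> 0 \<le> t k \<and> t k \<le> L k"
    let ?x = "x0 + (\<Sum>k\<in>I. t k *\<^sub>R d k)"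
    have ext: "(\<Sum>k\<in>insert j I. (t(j:=s)) k *\<^sub>R d k) = s *\<^sub>R d j + (\<Sum>k\<in>I. t k *\<^sub>R d k)" for s
      using insert.hyps by (simp add: sum.insert) (intro sum.cong, auto)
    have lower: "c - D j (?x + s *\<^sub>R d j) \<le> (\<Sum>i\<in>I. D i (?x + s *\<^sub>R d j))" if "s \<in> {0..L j}" for s
      using low[of "t(j:=s)", OF adm[of t s]] t that insert.hyps unfolding ext by (auto simp: algebra_simps)
    have bdj: "\<bar>h j (?x + s *\<^sub>R d j)\<bar> \<le> C j" if "s \<in> {0..L j}" for s
      using bd[of j "t(j:=s)", OF _ adm[of t s]] t that unfolding ext by (auto simp: algebra_simps)
    have ftc: "((\<lambda>s. D j (?x + s *\<^sub>R d j)) has_integral (h j (?x + L j *\<^sub>R d j) - h j (?x + 0 *\<^sub>R d j))) {0..L j}"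
      by (rule fundamental_theorem_of_calculus)
        (use Lj ders[of j ?x] in \<open>auto simp flip: has_real_derivative_iff_has_vector_derivative intro: has_field_derivative_at_within\<close>)
    have "(\<Sum>i\<in>I. ?A (D i) ?x) = integral {0..L j} (\<lambda>s. \<Sum>i\<in>I. D i (?x + s *\<^sub>R d j)) / L j"
      using Dc int_line insert.hyps by (simp add: integral_sum sum_divide_distrib)
    also have "\<dots> \<ge> integral {0..L j} (\<lambda>s. c - D j (?x + s *\<^sub>R d j)) / L j"
      by (intro divide_right_mono integral_le integrable_sum integrable_diff int_line Dc lower)
         (use insert.hyps Lj in auto)
    also have "integral {0..L j} (\<lambda>s. c - D j (?x + s *\<^sub>R d j)) = c * L j - (h j (?x + L j *\<^sub>R d j) - h j (?x + 0 *\<^sub>R d j))"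
      using ftc Lj by (subst integral_diff) (auto simp: integral_unique has_integral_integrable)
    finally have 1: "(c * L j - (h j (?x + L j *\<^sub>R d j) - h j (?x + 0 *\<^sub>R d j))) / L j \<le> (\<Sum>i\<in>I. ?A (D i) ?x)" .
    have "c * L j - 2 * C j \<le> c * L j - (h j (?x + L j *\<^sub>R d j) - h j (?x + 0 *\<^sub>R d j))"
      using bdj[of 0] bdj[of "L j"] Lj by auto
    then have "(c * L j - 2 * C j) / L j \<le> (c * L j - (h j (?x + L j *\<^sub>R d j) - h j (?x + 0 *\<^sub>R d j))) / L j"
      using Lj by (intro divide_right_mono) auto
    moreover have "(c * L j - 2 * C j) / L j = c - 2 * C j / L j"
      using Lj by (simp add: field_simps)
    ultimately have "c - 2 * C j / L j \<le> (c * L j - (h j (?x + L j *\<^sub>R d j) - h j (?x + 0 *\<^sub>R d j))) / L j"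
      by simp
    then show "c - 2 * C j / L j \<le> (\<Sum>i\<in>I. ?A (D i) ?x)" using 1 by simp
  qed
  then show ?case using insert.hyps by simp
qed

section \<open>The action on the cover\<close>

lemma additive_subgroup_of_int_scale:
  fixes S :: "'v::real_vector set"
  assumes "0 \<in> S" "\<And>x y. x \<in> S \<Longrightarrow> y \<in> S \<Longrightarrow> x + y \<in> S" "\<And>x. x \<in> S \<Longrightarrow> - x \<in> S" "x \<in> S"
  shows "of_int n *\<^sub>R x \<in> S"
proof -
  have nat: "of_nat k *\<^sub>R x \<in> S" for k
    by (induction k) (auto simp: assms scaleR_add_left)
  show ?thesis
  proof (cases n)
    case (nonneg k)
    then show ?thesis using nat[of k] by simp
  next
    case (neg k)
    have "- (of_nat (Suc k) *\<^sub>R x) \<in> S" using nat[of "Suc k"] assms(3) by blast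
    then show ?thesis using neg by (simp add: scaleR_minus_left[symmetric] del: scaleR_minus_left)
  qed
qed

text \<open>Rounding the coefficients with respect to a basis that is contained in \<open>S\<close>.\<close>

lemma additive_subgroup_cobounded_in_span:
  fixes S :: "'v::euclidean_space set"
  assumes S: "0 \<in> S" "\<And>x y. x \<in> S \<Longrightarrow> y \<in> S \<Longrightarrow> x + y \<in> S" "\<And>x. x \<in> S \<Longrightarrow> - x \<in> S"
  obtains r where "\<And>x. x \<in> span S \<Longrightarrow> \<exists>s\<in>S. norm (x + s) \<le> r"
proof -
  obtain B where B: "B \<subseteq> S" "independent B" "S \<subseteq> span B"
    by (rule basis_exists[of S], rule that)
  have fin: "finite B" using B(2) by (rule independent_imp_finite)
  have sums: "(\<Sum>b\<in>C. f b) \<in> S" if "\<And>b. b \<in> C \<Longrightarrow> f b \<in> S" for f :: "'v \<Rightarrow> 'v" and C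
    using that by (induction C rule: infinite_finite_induct) (auto simp: S)
  show ?thesis
  proof (rule that[of "\<Sum>b\<in>B. norm b"])
    fix x assume "x \<in> span S"
    then have "x \<in> span B" using B(3) by (metis span_mono span_span subsetD)
    then obtain c where x: "x = (\<Sum>b\<in>B. c b *\<^sub>R b)" unfolding span_finite[OF fin] by auto
    define s where "s = (\<Sum>b\<in>B. of_int (- \<lfloor>c b\<rfloor>) *\<^sub>R b)"
    have "s \<in> S" unfolding s_def
      by (intro sums additive_subgroup_of_int_scale S) (use B in auto)
    moreover have "x + s = (\<Sum>b\<in>B. frac (c b) *\<^sub>R b)"
      unfolding x s_def sum.distrib[symmetric] by (simp add: frac_def scaleR_diff_left)
    then have "norm (x + s) \<le> (\<Sum>b\<in>B. norm b)"
      by (auto intro!: sum_norm_le mult_left_le_one_le simp: frac_lt_1 less_imp_le)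
    ultimately show "\<exists>s\<in>S. norm (x + s) \<le> (\<Sum>b\<in>B. norm b)" by blast
  qed
qed

lemma full_lattice_span:
  assumes "lattice_of_rank DIM('v) (L :: 'v::euclidean_space set)"
  shows "span L = UNIV" "0 \<in> L" "x \<in> L \<Longrightarrow> y \<in> L \<Longrightarrow> x + y \<in> L" "x \<in> L \<Longrightarrow> - x \<in> L"
proof -
  obtain B where B: "finite B" "independent B" "card B = DIM('v)"
    and L: "L = range (\<lambda>m :: 'v \<Rightarrow> int. \<Sum>b\<in>B. of_int (m b) *\<^sub>R b)"
    using assms unfolding lattice_of_rank_def by blast
  have "B \<subseteq> L"
  proof
    fix b assume "b \<in> B"
    then have "b = (\<Sum>x\<in>B. of_int ((\<lambda>x. if x = b then 1 else 0) x) *\<^sub>R x)"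
      using B(1) by (simp add: if_distrib[of of_int] if_distrib[of "\<lambda>z. z *\<^sub>R _"] cong: if_cong)
    then show "b \<in> L" unfolding L by (rule range_eqI[of _ _ "\<lambda>x. if x = b then 1 else 0"])
  qed
  moreover have "span B = UNIV" using dim_eq_card_independent[OF B(2)] B(3) by (simp add: dim_eq_full[symmetric])
  ultimately show "span L = UNIV" using span_mono[of B L] by auto
  show "0 \<in> L" unfolding L by (auto intro!: range_eqI[of _ _ "\<lambda>_. 0"])
  show "x + y \<in> L" if "x \<in> L" "y \<in> L"
  proof -
    obtain m m' where "x = (\<Sum>b\<in>B. of_int (m b) *\<^sub>R b)" "y = (\<Sum>b\<in>B. of_int (m' b) *\<^sub>R b)" using \<open>x \<in> L\<close> \<open>y \<in> L\<close> unfolding L by auto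
    then have "x + y = (\<Sum>b\<in>B. of_int ((\<lambda>b. m b + m' b) b) *\<^sub>R b)"
      by (simp add: scaleR_add_left sum.distrib)
    then show ?thesis unfolding L by (rule range_eqI[of _ _ "\<lambda>b. m b + m' b"])
  qed
  show "- x \<in> L" if "x \<in> L"
  proof -
    obtain m where "x = (\<Sum>b\<in>B. of_int (m b) *\<^sub>R b)" using \<open>x \<in> L\<close> unfolding L by auto
    then have "- x = (\<Sum>b\<in>B. of_int ((\<lambda>b. - m b) b) *\<^sub>R b)"
      by (simp add: sum_negf)
    then show ?thesis unfolding L by (rule range_eqI[of _ _ "\<lambda>b. - m b"])
  qed
qed

text \<open>A linear map that sends the lattice basis to an orthonormal basis sends a short lattice vector to an integer
vector that is shorter than 1.\<close>

lemma full_lattice_discrete: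
  assumes "lattice_of_rank DIM('v) (L :: 'v::euclidean_space set)"
  obtains \<epsilon> where "\<epsilon> > 0" "\<And>x. x \<in> L \<Longrightarrow> norm x < \<epsilon> \<Longrightarrow> x = 0"
proof -
  obtain B where B: "finite B" "independent B" "card B = DIM('v)"
    and L: "L = range (\<lambda>m :: 'v \<Rightarrow> int. \<Sum>b\<in>B. of_int (m b) *\<^sub>R b)"
    using assms unfolding lattice_of_rank_def by blast
  obtain g where g: "bij_betw g B (Basis :: 'v set)"
    using finite_same_card_bij[OF B(1) finite_Basis] B(3) by auto
  obtain f where f: "linear f" "\<And>b. b \<in> B \<Longrightarrow> f b = g b"
    using linear_independent_extend[OF B(2), of g] by auto
  obtain K where K: "K > 0" "\<And>x. norm (f x) \<le> K * norm x"
    using linear_bounded_pos[OF f(1)] by blast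
  show ?thesis
  proof (rule that[of "1 / K"])
    show "1 / K > 0" using K by simp
    fix x assume x: "x \<in> L" "norm x < 1 / K"
    obtain m :: "'v \<Rightarrow> int" where m: "x = (\<Sum>b\<in>B. of_int (m b) *\<^sub>R b)" using x unfolding L by auto
    have fx: "f x = (\<Sum>b\<in>B. of_int (m b) *\<^sub>R g b)"
      unfolding m by (simp add: linear_sum[OF f(1)] linear_scale[OF f(1)] f(2))
    have small: "norm (f x) < 1" using K(2)[of x] x(2) K(1) by (simp add: field_simps)
    have "m b = 0" if b: "b \<in> B" for b
    proof -
      have gB: "g b \<in> Basis" using g b by (auto simp: bij_betw_def)
      have "f x \<bullet> g b = (\<Sum>b'\<in>B. if b' = b then of_int (m b') else 0)"
        unfolding fx inner_sum_left
      proof (intro sum.cong refl)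
        fix b' assume b': "b' \<in> B"
        then have "g b' \<in> Basis" "g b' = g b \<longleftrightarrow> b' = b"
          using g b by (auto simp: bij_betw_def inj_on_def)
        then show "of_int (m b') *\<^sub>R g b' \<bullet> g b = (if b' = b then of_int (m b') else 0)"
          using gB by (simp add: inner_Basis)
      qed
      then have "f x \<bullet> g b = of_int (m b)" using b B(1) by simp
      moreover have "\<bar>f x \<bullet> g b\<bar> \<le> norm (f x)" by (rule Basis_le_norm[OF gB])
      ultimately have "\<bar>of_int (m b) :: real\<bar> < 1" using small by linarith
      then show "m b = 0" by linarith
    qed
    then show "x = 0" unfolding m by simp
  qed
qed

text \<open>The image of \<open>a\<close> under the Minkowski embedding. It is both the vector of the translation by \<open>a\<close> and
the diagonal of the action of a unit.\<close>

definition conjugate_vector ::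
    "('s::finite \<Rightarrow> 'k \<Rightarrow> real) \<Rightarrow> ('t::finite \<Rightarrow> 'k \<Rightarrow> complex) \<Rightarrow> 'k \<Rightarrow> complex ^ ('s + 't)" where
  "conjugate_vector \<sigma> \<tau> a = (\<chi> i. case i of Inl i \<Rightarrow> of_real (\<sigma> i a) | Inr j \<Rightarrow> \<tau> j a)"

lemma OT_translation_conv: "OT_translation \<sigma> \<tau> a z = z + conjugate_vector \<sigma> \<tau> a"
  by (simp add: OT_translation_def conjugate_vector_def vec_eq_iff)

lemma OT_rotation_conv: "OT_rotation \<sigma> \<tau> u z = (\<chi> k. conjugate_vector \<sigma> \<tau> u $ k * z $ k)"
  by (simp add: OT_rotation_def conjugate_vector_def vec_eq_iff)

definition log_height :: "complex ^ ('s::finite + 't::finite) \<Rightarrow> real ^ 's" where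
  "log_height z = (\<chi> i. ln (Im (z $ Inl i)))"

lemma open_OT_cover: "open (OT_cover :: (complex ^ ('s::finite + 't::finite)) set)"
proof -
  have eq: "OT_cover = (\<Inter>i. {z :: complex ^ ('s + 't). Im (z $ Inl i) > 0})"
    by (auto simp: OT_cover_def)
  show ?thesis unfolding eq
    by (intro open_INT ballI open_Collect_less continuous_intros) simp
qed

lemma continuous_on_log_height: "continuous_on OT_cover log_height"
  unfolding log_height_def
  by (intro continuous_intros) (simp add: OT_cover_def less_imp_neq[symmetric])

locale oeljeklaus_toma = embedded_number_field \<sigma> \<tau>
  for \<sigma> :: "'s::finite \<Rightarrow> 'k::field_char_0 \<Rightarrow> real" and \<tau> :: "'t::finite \<Rightarrow> 'k \<Rightarrow> complex" +
  fixes U :: "'k set"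
  assumes adm: "admissible \<sigma> \<tau> U"
begin

abbreviation (input) "cv \<equiv> conjugate_vector \<sigma> \<tau>"
abbreviation (input) "Tr \<equiv> OT_translation \<sigma> \<tau>"
abbreviation (input) "Ro \<equiv> OT_rotation \<sigma> \<tau>"
abbreviation (input) "OK \<equiv> ring_of_integers :: 'k set"

lemma conjugate_vector_add: "cv (a + b) = cv a + cv b"
  using real_embedding complex_embedding(1)
  by (auto simp: conjugate_vector_def vec_eq_iff field_embedding_add split: sum.split)

lemma conjugate_vector_mult: "cv (u * a) = Ro u (cv a)"
  using real_embedding complex_embedding(1)
  by (auto simp: OT_rotation_conv conjugate_vector_def vec_eq_iff field_embedding_mult split: sum.split)

lemma conjugate_vector_1: "cv 1 $ k = 1"
  using real_embedding complex_embedding(1)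
  by (auto simp: conjugate_vector_def field_embedding_1 split: sum.split)

lemma conjugate_vector_0: "cv 0 = 0"
  using conjugate_vector_add[of 0 0] by simp

lemma conjugate_vector_minus: "cv (- a) = - cv a"
  using conjugate_vector_add[of a "- a"] by (simp add: conjugate_vector_0 eq_neg_iff_add_eq_0 add.commute)

lemma rotation_1: "Ro 1 z = z"
  by (simp add: OT_rotation_conv conjugate_vector_1 vec_eq_iff)

lemma rotation_mult: "Ro (u * v) z = Ro u (Ro v z)"
  unfolding OT_rotation_conv[of _ _ "u * v"] conjugate_vector_mult by (simp add: OT_rotation_conv vec_eq_iff mult.assoc)

lemma rotation_add: "Ro u (z + z') = Ro u z + Ro u z'"
  by (simp add: OT_rotation_conv vec_eq_iff distrib_left)

lemma admissibleD:
  shows "u \<in> U \<Longrightarrow> u \<in> totally_positive_units \<sigma>" "1 \<in> U" "u \<in> U \<Longrightarrow> v \<in> U \<Longrightarrow> u * v \<in> U"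
    "u \<in> U \<Longrightarrow> inverse u \<in> U" "u \<in> U \<Longrightarrow> u \<noteq> 0" "u \<in> U \<Longrightarrow> \<sigma> i u > 0" "u \<in> U \<Longrightarrow> u \<in> OK"
  using adm by (auto simp: admissible_def mult_subgroup_def totally_positive_units_def)

lemma Im_deck: "Im (Tr a (Ro u z) $ Inl i) = \<sigma> i u * Im (z $ Inl i)"
  by (simp add: OT_translation_conv OT_rotation_conv conjugate_vector_def)

lemma deck_in_cover: "u \<in> U \<Longrightarrow> z \<in> OT_cover \<Longrightarrow> Tr a (Ro u z) \<in> OT_cover"
  using admissibleD(6) by (simp add: OT_cover_def Im_deck)

lemma orbit_subset:
  assumes "u \<in> U" "a \<in> OK"
  shows "OT_orbit \<sigma> \<tau> U (Tr a (Ro u z)) \<subseteq> OT_orbit \<sigma> \<tau> U z"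
proof
  fix y assume "y \<in> OT_orbit \<sigma> \<tau> U (Tr a (Ro u z))"
  then obtain u' a' where y: "y = Tr a' (Ro u' (Tr a (Ro u z)))" "u' \<in> U" "a' \<in> OK"
    by (auto simp: OT_orbit_def)
  have "y = Tr (a' + u' * a) (Ro (u' * u) z)"
    unfolding y(1) OT_translation_conv rotation_add rotation_mult conjugate_vector_add conjugate_vector_mult
    by (simp add: algebra_simps)
  moreover have "a' + u' * a \<in> OK" using y assms admissibleD(7)[OF y(2)] by (intro ring_of_integers_add ring_of_integers_mult)
  ultimately show "y \<in> OT_orbit \<sigma> \<tau> U z"
    using y assms admissibleD(3) unfolding OT_orbit_def by blast
qed

lemma orbit_deck:
  assumes "u \<in> U" "a \<in> OK"
  shows "OT_orbit \<sigma> \<tau> U (Tr a (Ro u z)) = OT_orbit \<sigma> \<tau> U z"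
proof
  show "OT_orbit \<sigma> \<tau> U (Tr a (Ro u z)) \<subseteq> OT_orbit \<sigma> \<tau> U z" by (rule orbit_subset[OF assms])
  let ?a = "- (inverse u * a)"
  have "Tr ?a (Ro (inverse u) (Tr a (Ro u z))) = z"
    unfolding OT_translation_conv rotation_add rotation_mult[symmetric] conjugate_vector_minus conjugate_vector_mult[symmetric]
    using admissibleD(5)[OF assms(1)] by (simp add: rotation_1)
  moreover have "?a \<in> OK" using assms(2) admissibleD(7)[OF admissibleD(4)[OF assms(1)]]
    by (intro ring_of_integers_minus ring_of_integers_mult)
  ultimately show "OT_orbit \<sigma> \<tau> U z \<subseteq> OT_orbit \<sigma> \<tau> U (Tr a (Ro u z))"
    using orbit_subset[OF admissibleD(4)[OF assms(1)], of ?a "Tr a (Ro u z)"] by simp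
qed

lemma orbit_eqD:
  assumes "OT_orbit \<sigma> \<tau> U z = OT_orbit \<sigma> \<tau> U z'"
  obtains u a where "u \<in> U" "a \<in> OK" "z' = Tr a (Ro u z)"
proof -
  have "z' = Tr 0 (Ro 1 z')" by (simp add: OT_translation_conv rotation_1 conjugate_vector_0)
  then have "z' \<in> OT_orbit \<sigma> \<tau> U z'"
    unfolding OT_orbit_def using admissibleD(2) ring_of_integers_0 by force
  then have "z' \<in> OT_orbit \<sigma> \<tau> U z" using assms by simp
  then show ?thesis using that by (auto simp: OT_orbit_def)
qed

text \<open>If all conjugates are smaller than 1, then so is the norm, which is an integer.\<close>

lemma integers_discrete:
  assumes "a \<in> OK" "norm (cv a) < 1"
  shows "a = 0"
proof (rule ccontr)
  assume "a \<noteq> 0"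
  have c: "cmod (cv a $ k) < 1" for k using Finite_Cartesian_Product.norm_nth_le[of "cv a" k] assms(2) by linarith
  have "cmod (all_embeddings \<sigma> \<tau> e a) < 1" for e
  proof (cases e)
    case (Inl k)
    then have "all_embeddings \<sigma> \<tau> e a = cv a $ k"
      by (auto simp: all_embeddings_def conjugate_vector_def split: sum.split)
    then show ?thesis using c by simp
  next
    case (Inr j)
    then show ?thesis using c[of "Inr j"] by (simp add: all_embeddings_def conjugate_vector_def)
  qed
  then have "(\<Prod>e\<in>UNIV. cmod (all_embeddings \<sigma> \<tau> e a)) < (\<Prod>e\<in>(UNIV :: (('s + 't) + 't) set). 1)"
    by (intro prod_mono_strict) (auto simp: less_imp_le)
  then show False using norm_ge_1[OF assms(1) \<open>a \<noteq> 0\<close>] by simp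
qed

definition unit_log :: "'k \<Rightarrow> real ^ 's" where
  "unit_log u = (\<chi> i. ln (\<sigma> i u))"

lemma unit_log_lattice: "lattice_of_rank DIM(real ^ 's) (unit_log ` U)"
proof -
  have "first_coords ` log_embedding \<sigma> \<tau> ` U = unit_log ` U"
    unfolding image_image by (intro image_cong) (auto simp: first_coords_def log_embedding_def unit_log_def)
  then show ?thesis using adm by (simp add: admissible_def)
qed

lemma log_height_deck:
  assumes "u \<in> U" "z \<in> OT_cover"
  shows "log_height (Tr a (Ro u z)) = unit_log u + log_height z"
proof -
  have "ln (\<sigma> i u * Im (z $ Inl i)) = ln (\<sigma> i u) + ln (Im (z $ Inl i))" for i
    using assms(2) admissibleD(6)[OF assms(1), of i] by (intro ln_mult_pos) (auto simp: OT_cover_def)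
  then show ?thesis by (simp add: log_height_def unit_log_def vec_eq_iff Im_deck)
qed

text \<open>A single real embedding suffices, because it is injective.\<close>

lemma unit_log_eq_0D:
  assumes "u \<in> U" "unit_log u = 0"
  shows "u = 1"
proof -
  have "ln (\<sigma> undefined u) = 0" using assms(2) by (simp add: unit_log_def vec_eq_iff)
  then have "\<sigma> undefined u = 1" using admissibleD(6)[OF assms(1)] by simp
  then show ?thesis
    using field_embedding_eq_iff[OF real_embedding, of undefined u 1] field_embedding_1[OF real_embedding] by simp
qed

text \<open>The group elements that map one point of a small \<open>V\<close> to another one barely move the
heights \<open>y\<^sub>k\<close>, so their unit is close to 1 and hence is 1; the remaining translation is short and hence
trivial.\<close>

lemma evenly_covered:
  assumes "z \<in> OT_cover"
  obtains V where "open V" "z \<in> V" "V \<subseteq> OT_cover" "inj_on (OT_orbit \<sigma> \<tau> U) V"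
proof -
  obtain \<epsilon> where \<epsilon>: "\<epsilon> > 0" "\<And>x. x \<in> unit_log ` U \<Longrightarrow> norm x < \<epsilon> \<Longrightarrow> x = 0"
    by (rule full_lattice_discrete[OF unit_log_lattice], rule that)
  define V where "V = (log_height -` ball (log_height z) (\<epsilon> / 2) \<inter> OT_cover) \<inter> ball z (1 / 2)"
  have "open (log_height -` ball (log_height z) (\<epsilon> / 2) \<inter> (OT_cover :: (complex ^ ('s + 't)) set))"
    by (rule continuous_on_open_vimage[OF open_OT_cover, THEN iffD1, rule_format, OF continuous_on_log_height]) simp
  then have "open V" unfolding V_def by (rule open_Int[OF _ open_ball])
  moreover have "z \<in> V" using assms \<epsilon> by (simp add: V_def)
  moreover have "V \<subseteq> OT_cover" by (auto simp: V_def)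
  moreover have "inj_on (OT_orbit \<sigma> \<tau> U) V"
  proof (rule inj_onI)
    fix x y assume xy: "x \<in> V" "y \<in> V" "OT_orbit \<sigma> \<tau> U x = OT_orbit \<sigma> \<tau> U y"
    obtain u a where ua: "u \<in> U" "a \<in> OK" "y = Tr a (Ro u x)" using orbit_eqD[OF xy(3)] .
    have "x \<in> OT_cover" using xy by (simp add: V_def)
    then have "unit_log u = log_height y - log_height x" using log_height_deck[OF ua(1)] ua(3) by simp
    then have "norm (unit_log u) = dist (log_height y) (log_height x)" by (simp add: dist_norm)
    also have "\<dots> < \<epsilon>"
      using xy dist_triangle_half_r[of "log_height z" "log_height y" \<epsilon> "log_height x"] by (auto simp: V_def)
    finally have "u = 1" using unit_log_eq_0D[OF ua(1)] \<epsilon>(2) ua(1) by blast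
    then have y: "y = x + cv a" using ua(3) by (simp add: rotation_1 OT_translation_conv)
    then have "norm (cv a) = dist y x" by (simp add: dist_norm)
    also have "\<dots> < 1" using xy dist_triangle_half_r[of z y 1 x] by (auto simp: V_def)
    finally have "a = 0" using integers_discrete ua(2) by blast
    then show "x = y" using y by (simp add: conjugate_vector_0)
  qed
  ultimately show ?thesis by (rule that)
qed

text \<open>A vector of \<open>\<real>\<^sup>s \<times> \<complex>\<^sup>t\<close> that is orthogonal to all integers is a linear relation between the embeddings, since
\<open>Re (z\<^sup>* y) = (z\<^sup>* y + z y\<^sup>*) / 2\<close>.\<close>

lemma span_integers:
  assumes "\<And>i. Im (w $ Inl i) = 0"
  shows "w \<in> span (cv ` OK)"
proof -
  define W where "W = {w :: complex ^ ('s + 't). \<forall>i. Im (w $ Inl i) = 0}"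
  have sub: "subspace W" by (auto simp: W_def subspace_def)
  have inc: "cv ` OK \<subseteq> W" by (auto simp: W_def conjugate_vector_def)
  have "span (cv ` OK) = W"
  proof (rule ccontr)
    assume "span (cv ` OK) \<noteq> W"
    then have "span (cv ` OK) \<subset> span W"
      using inc sub by (metis psubsetI span_eq_iff span_mono)
    from orthogonal_to_subspace_exists_gen[OF this]
    obtain x where x: "x \<noteq> 0" "x \<in> span W" "\<And>y. y \<in> span (cv ` OK) \<Longrightarrow> orthogonal x y"
      by metis
    \<comment> \<open>the real inner product with \<open>x\<close> as a complex combination of all embeddings\<close>
    define c :: "('s + 't) + 't \<Rightarrow> complex" where
      "c e = (case e of Inl k \<Rightarrow> (case k of Inl i \<Rightarrow> of_real (Re (x $ Inl i)) | Inr j \<Rightarrow> cnj (x $ Inr j) / 2) | Inr j \<Rightarrow> x $ Inr j / 2)" for e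
    have "(\<Sum>e\<in>UNIV. c e * all_embeddings \<sigma> \<tau> e a) = of_real (x \<bullet> cv a)" for a
    proof -
      have t: "of_real (x $ Inr j \<bullet> \<tau> j a) = cnj (x $ Inr j) / 2 * \<tau> j a + x $ Inr j / 2 * cnj (\<tau> j a)" for j
        by (simp add: complex_eq_iff inner_complex_def field_simps)
      have t2: "of_real (z \<bullet> of_real q) = of_real (Re z) * complex_of_real q" for z :: complex and q
        by (simp add: inner_complex_def)
      have "of_real (x \<bullet> cv a) = (\<Sum>i\<in>UNIV. of_real (Re (x $ Inl i)) * complex_of_real (\<sigma> i a))
          + ((\<Sum>j\<in>UNIV. cnj (x $ Inr j) / 2 * \<tau> j a) + (\<Sum>j\<in>UNIV. x $ Inr j / 2 * cnj (\<tau> j a)))"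
        unfolding inner_vec_def sum_UNIV_sum of_real_add of_real_sum sum.distrib[symmetric]
        by (simp add: conjugate_vector_def t t2)
      then show ?thesis
        unfolding sum_UNIV_sum by (simp add: c_def all_embeddings_def add.assoc)
    qed
    moreover have "x \<bullet> cv a = 0" if "a \<in> OK" for a
      using x(3)[of "cv a"] that by (auto simp: orthogonal_def intro: span_base)
    ultimately have c0: "c e = 0" for e
      using independent_on_integers[of c e] by simp
    have "x $ k = 0" for k
    proof (cases k)
      case (Inl i)
      have "Im (x $ Inl i) = 0" using x(2) sub by (simp add: span_eq_iff[THEN iffD2] W_def)
      then show ?thesis using c0[of "Inl (Inl i)"] Inl by (simp add: c_def complex_eq_iff)
    next
      case (Inr j)
      then show ?thesis using c0[of "Inr j"] by (simp add: c_def)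
    qed
    then show False using x(1) by (simp add: vec_eq_iff)
  qed
  then show ?thesis using assms by (simp add: W_def)
qed

lemma translations_cocompact:
  obtains K where "compact K" "K \<subseteq> OT_cover"
    "\<And>z. z \<in> OT_cover \<Longrightarrow> norm (log_height z) \<le> S \<Longrightarrow> \<exists>a\<in>OK. Tr a z \<in> K"
proof -
  have "\<exists>r. \<forall>x\<in>span (cv ` OK). \<exists>s\<in>cv ` OK. norm (x + s) \<le> r"
  proof (rule additive_subgroup_cobounded_in_span)
    show "0 \<in> cv ` OK" using conjugate_vector_0 ring_of_integers_0 by force
    show "x + y \<in> cv ` OK" if "x \<in> cv ` OK" "y \<in> cv ` OK" for x y
      using that by (auto simp flip: conjugate_vector_add intro: ring_of_integers_add)
    show "- x \<in> cv ` OK" if "x \<in> cv ` OK" for x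
      using that by (auto simp flip: conjugate_vector_minus intro: ring_of_integers_minus)
  qed blast
  then obtain r where r: "\<And>x. x \<in> span (cv ` OK) \<Longrightarrow> \<exists>s\<in>cv ` OK. norm (x + s) \<le> r" by blast
  define K where "K = {z :: complex ^ ('s + 't). (\<forall>k. \<bar>Re (z $ k)\<bar> \<le> r) \<and>
     (\<forall>i. exp (- S) \<le> Im (z $ Inl i) \<and> Im (z $ Inl i) \<le> exp S) \<and> (\<forall>j. \<bar>Im (z $ Inr j)\<bar> \<le> r)}"
  show ?thesis
  proof (rule that[of K])
    have "closed K"
      unfolding K_def
      by (intro closed_Collect_conj closed_Collect_all closed_Collect_le continuous_intros)
    moreover have "bounded K"
    proof (rule boundedI)
      fix z assume z: "z \<in> K"
      have "cmod (z $ k) \<le> \<bar>r\<bar> + (\<bar>r\<bar> + exp S)" for k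
      proof -
        have "\<bar>Re (z $ k)\<bar> \<le> r" using z by (simp add: K_def)
        moreover have "\<bar>Im (z $ k)\<bar> \<le> \<bar>r\<bar> + exp S"
        proof (cases k)
          case (Inl i)
          then have "exp (- S) \<le> Im (z $ k)" "Im (z $ k) \<le> exp S" using z by (simp_all add: K_def)
          moreover have "exp (- S) > 0" by simp
          ultimately show ?thesis by linarith
        next
          case (Inr j)
          then have "\<bar>Im (z $ k)\<bar> \<le> r" using z by (simp add: K_def)
          moreover have "exp S > 0" by simp
          ultimately show ?thesis by linarith
        qed
        ultimately show ?thesis using cmod_le[of "z $ k"] by linarith
      qed
      then show "norm z \<le> (\<Sum>k\<in>(UNIV :: ('s + 't) set). \<bar>r\<bar> + (\<bar>r\<bar> + exp S))"
        unfolding norm_vec_def by (intro order_trans[OF L2_set_le_sum] sum_mono) auto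
    qed
    ultimately show "compact K" by (simp add: compact_eq_bounded_closed)
    show "K \<subseteq> OT_cover"
    proof
      fix z assume z: "z \<in> K"
      have "Im (z $ Inl i) > 0" for i using z by (auto simp: K_def intro: less_le_trans[of 0 "exp (- S)"])
      then show "z \<in> OT_cover" unfolding OT_cover_def by simp
    qed
    fix z :: "complex ^ ('s + 't)" assume z: "z \<in> OT_cover" "norm (log_height z) \<le> S"
    define x where "x = (\<chi> k. case k of Inl i \<Rightarrow> of_real (Re (z $ k)) | Inr j \<Rightarrow> z $ k)"
    have "x \<in> span (cv ` OK)" by (rule span_integers) (simp add: x_def)
    then obtain a where a: "a \<in> OK" "norm (x + cv a) \<le> r" using r by blast
    have nk: "cmod ((x + cv a) $ k) \<le> r" for k
      using Finite_Cartesian_Product.norm_nth_le[of "x + cv a" k] a(2) by linarith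
    have "Tr a z \<in> K"
      unfolding K_def
    proof (intro CollectI conjI allI)
      show "\<bar>Re (Tr a z $ k)\<bar> \<le> r" for k
      proof -
        have "Re (Tr a z $ k) = Re ((x + cv a) $ k)" by (simp add: OT_translation_conv x_def split: sum.split)
        then show ?thesis using nk[of k] abs_Re_le_cmod[of "(x + cv a) $ k"] by linarith
      qed
      show "\<bar>Im (Tr a z $ Inr j)\<bar> \<le> r" for j
      proof -
        have "Im (Tr a z $ Inr j) = Im ((x + cv a) $ Inr j)" by (simp add: OT_translation_conv x_def)
        then show ?thesis using nk[of "Inr j"] abs_Im_le_cmod[of "(x + cv a) $ Inr j"] by linarith
      qed
      fix i
      have e: "Im (Tr a z $ Inl i) = Im (z $ Inl i)" by (simp add: OT_translation_conv conjugate_vector_def)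
      have p: "Im (z $ Inl i) > 0" using z by (simp add: OT_cover_def)
      have "\<bar>ln (Im (z $ Inl i))\<bar> \<le> S"
        using z(2) component_le_norm_cart[of "log_height z" i] by (simp add: log_height_def)
      then have "exp (- S) \<le> exp (ln (Im (z $ Inl i)))" "exp (ln (Im (z $ Inl i))) \<le> exp S"
        unfolding exp_le_cancel_iff by linarith+
      then show "exp (- S) \<le> Im (Tr a z $ Inl i)" "Im (Tr a z $ Inl i) \<le> exp S"
        using p by (simp_all add: e)
    qed
    then show "\<exists>a\<in>OK. Tr a z \<in> K" using a by blast
  qed
qed

lemma units_cocompact:
  obtains S where "\<And>z. z \<in> OT_cover \<Longrightarrow> \<exists>u\<in>U. norm (log_height (Ro u z)) \<le> S"
proof -
  note lat = full_lattice_span[OF unit_log_lattice]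
  obtain r where r: "\<And>x. x \<in> span (unit_log ` U) \<Longrightarrow> \<exists>s\<in>unit_log ` U. norm (x + s) \<le> r"
    by (rule additive_subgroup_cobounded_in_span[OF lat(2-4)], assumption+, rule that)
  show ?thesis
  proof (rule that[of r])
    fix z :: "complex ^ ('s + 't)" assume z: "z \<in> OT_cover"
    obtain u where u: "u \<in> U" "norm (log_height z + unit_log u) \<le> r" using r[of "log_height z"] lat(1) by auto
    have "log_height (Ro u z) = unit_log u + log_height z"
      using log_height_deck[OF u(1) z, of 0] by (simp add: OT_translation_conv conjugate_vector_0)
    then show "\<exists>u\<in>U. norm (log_height (Ro u z)) \<le> r" using u by (metis add.commute)
  qed
qed

text \<open>The translations do not change the heights, so they can only compactify the region between two heights.\<close>

lemma translation_invariant_bounded: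
  fixes F :: "complex ^ ('s + 't) \<Rightarrow> real"
  assumes "continuous_on OT_cover F" and inv: "\<And>a z. a \<in> OK \<Longrightarrow> z \<in> OT_cover \<Longrightarrow> F (Tr a z) = F z"
  obtains C where "\<And>z. z \<in> OT_cover \<Longrightarrow> norm (log_height z) \<le> S \<Longrightarrow> \<bar>F z\<bar> \<le> C"
proof -
  obtain K :: "(complex ^ ('s + 't)) set" where K: "compact K" "K \<subseteq> OT_cover"
    "\<And>z. z \<in> OT_cover \<Longrightarrow> norm (log_height z) \<le> S \<Longrightarrow> \<exists>a\<in>OK. Tr a z \<in> K"
    by (rule translations_cocompact, rule that)
  have "bounded (F ` K)"
    using K assms(1) by (intro compact_imp_bounded compact_continuous_image continuous_on_subset[OF assms(1)])
  then obtain C where C: "\<And>z. z \<in> K \<Longrightarrow> \<bar>F z\<bar> \<le> C" by (auto simp: bounded_iff)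
  show ?thesis
  proof (rule that[of C])
    fix z :: "complex ^ ('s + 't)" assume z: "z \<in> OT_cover" "norm (log_height z) \<le> S"
    then obtain a where "a \<in> OK" "Tr a z \<in> K" using K(3) by blast
    then show "\<bar>F z\<bar> \<le> C" using C[of "Tr a z"] inv z by simp
  qed
qed

lemma deck_invariant_bounded:
  fixes F :: "complex ^ ('s + 't) \<Rightarrow> real"
  assumes F: "continuous_on OT_cover F"
    and inv: "\<And>u a z. u \<in> U \<Longrightarrow> a \<in> OK \<Longrightarrow> z \<in> OT_cover \<Longrightarrow> F (Tr a (Ro u z)) = F z"
  obtains C where "\<And>z. z \<in> OT_cover \<Longrightarrow> \<bar>F z\<bar> \<le> C"
proof -
  obtain S where S: "\<And>z :: complex ^ ('s + 't). z \<in> OT_cover \<Longrightarrow> \<exists>u\<in>U. norm (log_height (Ro u z)) \<le> S"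
    by (rule units_cocompact, rule that)
  have "F (Tr a z) = F z" if "a \<in> OK" "z \<in> OT_cover" for a z
    using inv[OF admissibleD(2) that] by (simp add: rotation_1)
  then obtain C where C: "\<And>z. z \<in> OT_cover \<Longrightarrow> norm (log_height z) \<le> S \<Longrightarrow> \<bar>F z\<bar> \<le> C"
    using translation_invariant_bounded[OF F, of S] by blast
  show ?thesis
  proof (rule that[of C])
    fix z :: "complex ^ ('s + 't)" assume z: "z \<in> OT_cover"
    then obtain u where u: "u \<in> U" "norm (log_height (Ro u z)) \<le> S" using S by blast
    have R: "Tr 0 (Ro u z) = Ro u z" by (simp add: OT_translation_conv conjugate_vector_0)
    have "Ro u z \<in> OT_cover" using deck_in_cover[OF u(1) z, of 0] by (simp only: R)
    moreover have "F (Ro u z) = F z" using inv[OF u(1) _ z, of 0] ring_of_integers_0 by (simp add: R)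
    ultimately show "\<bar>F z\<bar> \<le> C" using C[OF _ u(2)] by simp
  qed
qed

text \<open>Applied to the reciprocal, boundedness gives a positive lower bound.\<close>

lemma deck_invariant_bounded_below:
  fixes F :: "complex ^ ('s + 't) \<Rightarrow> real"
  assumes F: "continuous_on OT_cover F"
    and inv: "\<And>u a z. u \<in> U \<Longrightarrow> a \<in> OK \<Longrightarrow> z \<in> OT_cover \<Longrightarrow> F (Tr a (Ro u z)) = F z"
    and pos: "\<And>z. z \<in> OT_cover \<Longrightarrow> F z > 0"
  obtains c where "c > 0" "\<And>z. z \<in> OT_cover \<Longrightarrow> F z \<ge> c"
proof -
  have "continuous_on OT_cover (\<lambda>z. inverse (F z))"
    using pos by (intro continuous_on_inverse F) (auto simp: less_le)
  then obtain C where C: "\<And>z. z \<in> OT_cover \<Longrightarrow> \<bar>inverse (F z)\<bar> \<le> C"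
    using deck_invariant_bounded[of "\<lambda>z. inverse (F z)"] inv by metis
  have ne: "vec \<i> \<in> (OT_cover :: (complex ^ ('s + 't)) set)" by (simp add: OT_cover_def)
  have C0: "C > 0" using C[OF ne] pos[OF ne] by (auto intro: less_le_trans[rotated])
  show ?thesis
  proof (rule that[of "inverse C"])
    show "inverse C > 0" using C0 by simp
    fix z :: "complex ^ ('s + 't)" assume z: "z \<in> OT_cover"
    have "inverse (F z) \<le> C" using C[OF z] pos[OF z] by simp
    then have "inverse C \<le> inverse (inverse (F z))" using pos[OF z] by (intro le_imp_inverse_le) auto
    then show "inverse C \<le> F z" by simp
  qed
qed

end

section \<open>The metric on the cover\<close>

lemma frechet_derivative_cong_open:
  assumes "open V" "x \<in> V" "\<And>y. y \<in> V \<Longrightarrow> f y = g y"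
  shows "frechet_derivative f (at x) = frechet_derivative g (at x)"
proof -
  have "(f has_derivative f') (at x) \<longleftrightarrow> (g has_derivative f') (at x)" for f'
    using has_derivative_transform_within_open[OF _ assms(1,2), of f f' UNIV g]
      has_derivative_transform_within_open[OF _ assms(1,2), of g f' UNIV f] assms(3) by auto
  then show ?thesis by (simp add: frechet_derivative_def)
qed

lemma C1_on_local:
  assumes "\<And>x. x \<in> S \<Longrightarrow> \<exists>V g. open V \<and> x \<in> V \<and> C1_on V g \<and> (\<forall>y\<in>V. f y = g y)"
  shows "C1_on S f"
proof -
  have "f differentiable (at x) \<and> (\<forall>v. continuous (at x) (\<lambda>x. frechet_derivative f (at x) v))" if "x \<in> S" for x
  proof -
    obtain V g where V: "open V" "x \<in> V" and g: "C1_on V g" "\<And>y. y \<in> V \<Longrightarrow> f y = g y"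
      using assms[OF \<open>x \<in> S\<close>] by blast
    have "(f has_derivative frechet_derivative g (at x)) (at x)"
      using has_derivative_transform_within_open[OF C1_onD(1)[OF g(1) V(2)] V] g(2) by simp
    moreover have "continuous (at x) (\<lambda>x. frechet_derivative f (at x) v)" for v
    proof -
      have "frechet_derivative f (at y) = frechet_derivative g (at y)" if "y \<in> V" for y
        using frechet_derivative_cong_open[OF V(1) that] g(2) by blast
      then have "continuous_on V (\<lambda>x. frechet_derivative f (at x) v)"
        using C1_onD(2)[OF g(1), of v] by (subst continuous_on_cong[OF refl]) auto
      then show ?thesis using V by (simp add: continuous_on_eq_continuous_at)
    qed
    ultimately show ?thesis by (auto simp: differentiable_def)
  qed
  then show ?thesis by (auto intro: continuous_at_imp_continuous_on)
qed

definition quotient_chart ::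
    "('s::finite \<Rightarrow> 'k::field_char_0 \<Rightarrow> real) \<Rightarrow> ('t::finite \<Rightarrow> 'k \<Rightarrow> complex) \<Rightarrow> 'k set \<Rightarrow>
     (complex ^ ('s + 't)) set \<Rightarrow> ((complex ^ ('s + 't)) set, 's + 't) chart" where
  "quotient_chart \<sigma> \<tau> U V = (OT_orbit \<sigma> \<tau> U ` V, inv_into V (OT_orbit \<sigma> \<tau> U))"

text \<open>The open sets on which the projection is injective are those that carry a chart of the atlas.\<close>

definition sheet ::
    "('s::finite \<Rightarrow> 'k::field_char_0 \<Rightarrow> real) \<Rightarrow> ('t::finite \<Rightarrow> 'k \<Rightarrow> complex) \<Rightarrow> 'k set \<Rightarrow>
     (complex ^ ('s + 't)) set \<Rightarrow> bool" where
  "sheet \<sigma> \<tau> U V \<longleftrightarrow> open V \<and> V \<subseteq> OT_cover \<and> inj_on (OT_orbit \<sigma> \<tau> U) V"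

text \<open>The chart that is chosen at \<open>z\<close> does not matter, by \<open>pullback_chart\<close> below.\<close>

definition pullback ::
    "('s::finite \<Rightarrow> 'k::field_char_0 \<Rightarrow> real) \<Rightarrow> ('t::finite \<Rightarrow> 'k \<Rightarrow> complex) \<Rightarrow> 'k set \<Rightarrow>
     ((complex ^ ('s + 't)) set, 's + 't) manifold_form \<Rightarrow> (complex ^ ('s + 't)) form" where
  "pullback \<sigma> \<tau> U \<Omega> z = \<Omega> (quotient_chart \<sigma> \<tau> U (SOME V. sheet \<sigma> \<tau> U V \<and> z \<in> V)) z"

lemma quotient_chart_image: "sheet \<sigma> \<tau> U V \<Longrightarrow> chart_image (quotient_chart \<sigma> \<tau> U V) = V"
  by (simp add: chart_image_def quotient_chart_def sheet_def image_image)

lemma quotient_chart_in_atlas: "sheet \<sigma> \<tau> U V \<Longrightarrow> quotient_chart \<sigma> \<tau> U V \<in> OT_atlas \<sigma> \<tau> U"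
  unfolding OT_atlas_def sheet_def quotient_chart_def by blast

lemma linear_rotation: "linear (OT_rotation \<sigma> \<tau> u)"
  by (rule linearI) (simp_all add: OT_rotation_conv vec_eq_iff distrib_left)

locale balanced_oeljeklaus_toma = oeljeklaus_toma \<sigma> \<tau> U
  for \<sigma> :: "'s::finite \<Rightarrow> 'k::field_char_0 \<Rightarrow> real" and \<tau> :: "'t::finite \<Rightarrow> 'k \<Rightarrow> complex"
    and U :: "'k set" +
  fixes \<Omega> :: "((complex ^ ('s + 't)) set, 's + 't) manifold_form"
  assumes bal: "balanced_metric (OT_atlas \<sigma> \<tau> U) \<Omega>"
begin

abbreviation (input) "proj \<equiv> OT_orbit \<sigma> \<tau> U"
abbreviation (input) "chart \<equiv> quotient_chart \<sigma> \<tau> U"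
abbreviation (input) "\<omega> \<equiv> pullback \<sigma> \<tau> U \<Omega>"

text \<open>The coordinate change between two charts is the group element that relates their sheets.\<close>

lemma transition_deck:
  assumes "sheet \<sigma> \<tau> U V" "sheet \<sigma> \<tau> U V'" "u \<in> U" "a \<in> OK" "z \<in> V" "Tr a (Ro u z) \<in> V'"
  shows "transition (chart V) (chart V') z = Tr a (Ro u z)"
proof -
  have inj: "inj_on proj V" "inj_on proj V'" using assms by (auto simp: sheet_def)
  have "inv_into (proj ` V) (inv_into V proj) z = proj z"
    by (rule inv_into_f_eq) (use assms inj in \<open>auto intro: inj_on_inv_into\<close>)
  also have "\<dots> = proj (Tr a (Ro u z))" using orbit_deck[OF assms(3,4)] by simp
  finally show ?thesis
    using inj assms by (simp add: transition_def quotient_chart_def)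
qed

lemma metric_deck_charts:
  assumes V: "sheet \<sigma> \<tau> U V" and V': "sheet \<sigma> \<tau> U V'" and ua: "u \<in> U" "a \<in> OK"
    and z: "z \<in> V" "Tr a (Ro u z) \<in> V'"
  shows "\<Omega> (chart V) z v = \<Omega> (chart V') (Tr a (Ro u z)) (\<lambda>i. Ro u (v i))"
proof -
  let ?g = "\<lambda>z. Tr a (Ro u z)"
  have inj: "inj_on proj V" "inj_on proj V'" and op: "open V" "open V'" using V V' by (auto simp: sheet_def)
  have der: "(?g has_derivative Ro u) (at w)" for w
    unfolding OT_translation_conv
    by (intro has_derivative_add_const linear_imp_has_derivative linear_rotation)
  then have cont: "continuous_on UNIV ?g"
    by (intro continuous_at_imp_continuous_on ballI has_derivative_continuous)
  define N where "N = V \<inter> ?g -` V'"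
  have N: "open N" "z \<in> N" using op z cont by (auto simp: N_def intro!: open_Int open_vimage)
  have "(transition (chart V) (chart V') has_derivative Ro u) (at z)"
    by (rule has_derivative_transform_within_open[OF der N])
      (simp add: N_def transition_deck[OF V V' ua])
  then have fd: "frechet_derivative (transition (chart V) (chart V')) (at z) = Ro u"
    by (rule frechet_derivative_at[symmetric])
  have p: "proj z \<in> fst (chart V) \<inter> fst (chart V')" "snd (chart V) (proj z) = z" "snd (chart V') (proj z) = ?g z"
    using z inj inv_into_f_f[OF inj(2) z(2)] imageI[OF z(2), of proj] orbit_deck[OF ua, of z]
    by (auto simp: quotient_chart_def)
  have "manifold_form_on 2 (OT_atlas \<sigma> \<tau> U) \<Omega>"
    using bal by (simp add: balanced_metric_def hermitian_metric_def)
  then have "\<Omega> (chart V) (snd (chart V) (proj z)) v =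
        \<Omega> (chart V') (snd (chart V') (proj z)) (\<lambda>i. frechet_derivative (transition (chart V) (chart V')) (at (snd (chart V) (proj z))) (v i))"
    using p(1) quotient_chart_in_atlas[OF V] quotient_chart_in_atlas[OF V'] unfolding manifold_form_on_def by blast
  then show ?thesis unfolding p(2,3) fd .
qed

lemma chosen_sheet:
  assumes "z \<in> OT_cover"
  shows "sheet \<sigma> \<tau> U (SOME V. sheet \<sigma> \<tau> U V \<and> z \<in> V) \<and> z \<in> (SOME V. sheet \<sigma> \<tau> U V \<and> z \<in> V)"
proof (rule someI_ex)
  obtain V where "open V" "z \<in> V" "V \<subseteq> OT_cover" "inj_on proj V"
    by (rule evenly_covered[OF assms])
  then show "\<exists>V. sheet \<sigma> \<tau> U V \<and> z \<in> V" by (auto simp: sheet_def)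
qed

text \<open>Both sides are expressions of the same form on the quotient at the same point.\<close>

lemma pullback_deck:
  assumes "u \<in> U" "a \<in> OK" "z \<in> OT_cover"
  shows "\<omega> z v = \<omega> (Tr a (Ro u z)) (\<lambda>i. Ro u (v i))"
  unfolding pullback_def
  using chosen_sheet[OF assms(3)] chosen_sheet[OF deck_in_cover[OF assms(1,3), of a]]
  by (intro metric_deck_charts assms) auto

lemma pullback_chart:
  assumes "sheet \<sigma> \<tau> U V" "z \<in> V"
  shows "\<omega> z = \<Omega> (chart V) z"
proof
  fix v
  have z: "z \<in> OT_cover" using assms by (auto simp: sheet_def)
  have id: "Tr 0 w = w" "Ro 1 w = w" for w
    by (simp_all add: OT_translation_conv rotation_1 conjugate_vector_0)
  have "0 \<in> OK" by (rule ring_of_integers_0)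
  then show "\<omega> z v = \<Omega> (chart V) z v"
    using metric_deck_charts[of "SOME V. sheet \<sigma> \<tau> U V \<and> z \<in> V" V 1 0 z v] chosen_sheet[OF z] assms
      admissibleD(2)
    by (simp add: id pullback_def)
qed

lemma sheet_at:
  assumes "z \<in> OT_cover"
  obtains V where "sheet \<sigma> \<tau> U V" "z \<in> V"
  using chosen_sheet[OF assms] by (auto intro: that)

lemma pullback_alternating: "z \<in> OT_cover \<Longrightarrow> alternating_form 2 (\<omega> z)"
proof (erule sheet_at)
  fix V assume V: "sheet \<sigma> \<tau> U V" "z \<in> V"
  then show ?thesis
    using bal quotient_chart_in_atlas[OF V(1)] quotient_chart_image[OF V(1)] pullback_chart[OF V]
    by (auto simp: balanced_metric_def hermitian_metric_def manifold_form_on_def smooth_form_on_def)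
qed

lemma pullback_hermitian:
  assumes "z \<in> OT_cover"
  shows "\<omega> z (\<lambda>i. \<i> *s v i) = \<omega> z v"
    and "x \<noteq> 0 \<Longrightarrow> \<omega> z (\<lambda>i. if i = 0 then x else \<i> *s x) > 0"
proof -
  obtain V where V: "sheet \<sigma> \<tau> U V" "z \<in> V" using sheet_at[OF assms] .
  show "\<omega> z (\<lambda>i. \<i> *s v i) = \<omega> z v" "x \<noteq> 0 \<Longrightarrow> \<omega> z (\<lambda>i. if i = 0 then x else \<i> *s x) > 0"
    using bal quotient_chart_in_atlas[OF V(1)] quotient_chart_image[OF V(1)] pullback_chart[OF V] V(2)
    unfolding balanced_metric_def hermitian_metric_def by auto
qed

lemma pullback_C1: "C1_on OT_cover (\<lambda>z. \<omega> z v)"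
proof (rule C1_on_local)
  fix z :: "complex ^ ('s + 't)" assume "z \<in> OT_cover"
  then obtain V where V: "sheet \<sigma> \<tau> U V" "z \<in> V" by (rule sheet_at)
  have "smooth_form_on 2 V (\<Omega> (chart V))"
    using bal quotient_chart_in_atlas[OF V(1)] quotient_chart_image[OF V(1)]
    unfolding balanced_metric_def hermitian_metric_def manifold_form_on_def by metis
  then have "C1_on V (\<lambda>z. \<Omega> (chart V) z v)"
    by (simp only: smooth_form_on_def smooth_on_def)
  then show "\<exists>V g. open V \<and> z \<in> V \<and> C1_on V g \<and> (\<forall>y\<in>V. \<omega> y v = g y)"
    using V pullback_chart[OF V(1)] by (intro exI[of _ V] exI[of _ "\<lambda>z. \<Omega> (chart V) z v"]) (auto simp: sheet_def)
qed

lemma pullback_closed: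
  assumes "z \<in> OT_cover"
  shows "ext_deriv (2 * (CARD('s + 't) - 1)) (wedge_power 2 \<omega> (CARD('s + 't) - 1)) z v = 0"
proof -
  let ?m = "CARD('s + 't) - 1"
  obtain V where V: "sheet \<sigma> \<tau> U V" "z \<in> V" using sheet_at[OF assms] .
  have op: "open V" using V by (simp add: sheet_def)
  have eq: "wedge_power 2 \<omega> ?m y w = wedge_power 2 (\<Omega> (chart V)) ?m y w" if "y \<in> V" for y w
    using wedge_power_natural[of \<omega> y "\<Omega> (chart V)" y "\<lambda>x. x"] pullback_chart[OF V(1) that] by simp
  have "ext_deriv (2 * ?m) (wedge_power 2 \<omega> ?m) z v = ext_deriv (2 * ?m) (wedge_power 2 (\<Omega> (chart V)) ?m) z v"
    unfolding ext_deriv_def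
    by (intro sum.cong arg_cong2[where f = "(*)"] fun_cong[OF frechet_derivative_cong_open[OF op V(2)]] eq refl)
  also have "\<dots> = 0"
    using bal quotient_chart_in_atlas[OF V(1)] quotient_chart_image[OF V(1)] V(2)
    unfolding balanced_metric_def by blast
  finally show ?thesis .
qed

end

section \<open>The flux of the balanced metric\<close>

definition heights_product :: "complex ^ ('s::finite + 't::finite) \<Rightarrow> real" where
  "heights_product z = (\<Prod>i\<in>UNIV. Im (z $ Inl i))"

text \<open>Replaces the height \<open>y\<^sub>k\<close> by \<open>log y\<^sub>k\<close> as the imaginary part of the coordinate, so that all of \<open>\<complex>\<^sup>n\<close> becomes
the domain and the units act by translations on the imaginary parts.\<close>

definition exp_chart :: "complex ^ ('s::finite + 't::finite) \<Rightarrow> complex ^ ('s + 't)" where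
  "exp_chart w = (\<chi> k. case k of Inl i \<Rightarrow> Complex (Re (w $ k)) (exp (Im (w $ k))) | Inr j \<Rightarrow> w $ k)"

text \<open>The factor \<open>y\<^sub>i\<close> by which \<open>exp_chart\<close> stretches the real coordinate direction \<open>p\<close>: it is 1 except for the
directions \<open>\<partial> / \<partial> log y\<^sub>i = y\<^sub>i \<partial> / \<partial> y\<^sub>i\<close>. Here \<open>(k, False)\<close> and \<open>(k, True)\<close> stand for the real and
the imaginary direction of coordinate \<open>k\<close>, as in \<open>real_basis_vector\<close>.\<close>

definition height_factor :: "('s + 't) \<times> bool \<Rightarrow> complex ^ ('s::finite + 't::finite) \<Rightarrow> real" where
  "height_factor p z = (case p of (Inl i, True) \<Rightarrow> Im (z $ Inl i) | _ \<Rightarrow> 1)"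

lemma exp_chart_in_cover: "exp_chart w \<in> OT_cover"
  by (simp add: exp_chart_def OT_cover_def)

lemma log_height_exp_chart: "log_height (exp_chart w) = (\<chi> i. Im (w $ Inl i))"
  by (simp add: log_height_def exp_chart_def)

lemma continuous_on_exp_chart: "continuous_on UNIV (exp_chart :: complex ^ ('s::finite + 't::finite) \<Rightarrow> _)"
proof -
  have "continuous_on UNIV (\<lambda>w :: complex ^ ('s + 't). case k of Inl i \<Rightarrow> Complex (Re (w $ k)) (exp (Im (w $ k))) | Inr j \<Rightarrow> w $ k)" for k
    by (cases k) (auto simp: Complex_eq intro!: continuous_intros)
  then show ?thesis unfolding exp_chart_def by (intro continuous_on_vec_lambda)
qed

lemma exp_chart_derivative:
  fixes w :: "complex ^ ('s::finite + 't::finite)"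
  shows "((\<lambda>t. exp_chart (w + t *\<^sub>R real_basis_vector p)) has_derivative
     (\<lambda>t. t *\<^sub>R (height_factor p (exp_chart w) *\<^sub>R real_basis_vector p))) (at 0)"
proof -
  have comp: "((\<lambda>t. exp_chart (w + t *\<^sub>R real_basis_vector p) $ k) has_derivative
     (\<lambda>t. (t *\<^sub>R (height_factor p (exp_chart w) *\<^sub>R real_basis_vector p)) $ k)) (at 0)" for k
  proof (cases k)
    case (Inl i)
    have "((\<lambda>t. Complex (Re (w $ k) + t * Re (real_basis_vector p $ k)) (exp (Im (w $ k) + t * Im (real_basis_vector p $ k))))
       has_derivative (\<lambda>t. Complex (t * Re (real_basis_vector p $ k)) (exp (Im (w $ k)) * (t * Im (real_basis_vector p $ k))))) (at 0)"
      unfolding Complex_eq by (auto intro!: derivative_eq_intros)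
    moreover have "Complex (t * Re (real_basis_vector p $ k)) (exp (Im (w $ k)) * (t * Im (real_basis_vector p $ k)))
       = (t *\<^sub>R (height_factor p (exp_chart w) *\<^sub>R real_basis_vector p)) $ k" for t
      using Inl by (cases p) (auto simp: complex_eq_iff real_basis_vector_def height_factor_def exp_chart_def axis_def split: sum.split bool.split)
    ultimately show ?thesis using Inl by (simp add: exp_chart_def)
  next
    case (Inr j)
    have "(t *\<^sub>R (height_factor p (exp_chart w) *\<^sub>R real_basis_vector p)) $ k = t *\<^sub>R (real_basis_vector p $ k)" for t
      using Inr by (cases p) (auto simp: real_basis_vector_def height_factor_def axis_def split: sum.split bool.split)
    then show ?thesis using Inr by (auto simp: exp_chart_def intro!: derivative_eq_intros)
  qed
  show ?thesis
  proof (subst has_derivative_componentwise_within, rule ballI)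
    fix e :: "complex ^ ('s + 't)" assume "e \<in> Basis"
    then obtain k b where e: "e = axis k b" by (auto simp: Basis_vec_def)
    show "((\<lambda>t. exp_chart (w + t *\<^sub>R real_basis_vector p) \<bullet> e) has_derivative
        (\<lambda>t. t *\<^sub>R (height_factor p (exp_chart w) *\<^sub>R real_basis_vector p) \<bullet> e)) (at 0)"
      unfolding e inner_axis by (rule has_derivative_inner_left[OF comp])
  qed
qed

lemma height_exp_chart:
  "Im (exp_chart (w + t *\<^sub>R real_basis_vector p) $ Inl i) = Im (exp_chart w $ Inl i) * (if p = (Inl i, True) then exp t else 1)"
  by (cases p) (auto simp: exp_chart_def real_basis_vector_def axis_def exp_add)

lemma heights_product_exp_chart:
  fixes w :: "complex ^ ('s::finite + 't::finite)"
  shows "heights_product (exp_chart (w + t *\<^sub>R real_basis_vector p)) =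
     heights_product (exp_chart w) * (if \<exists>i. p = (Inl i, True) then exp t else 1)"
proof (cases "\<exists>i. p = (Inl i, True)")
  case True
  then obtain i where "p = (Inl i, True)" by auto
  then show ?thesis by (simp add: heights_product_def height_exp_chart prod.distrib eq_commute[of i])
next
  case False
  then show ?thesis by (auto simp: heights_product_def height_exp_chart)
qed

lemma height_factor_exp_chart:
  "height_factor p (exp_chart (w + t *\<^sub>R real_basis_vector p)) =
     height_factor p (exp_chart w) * (if \<exists>i. p = (Inl i, True) then exp t else 1)"
  by (cases p) (auto simp: height_factor_def height_exp_chart split: sum.split bool.split)

text \<open>The order of the real directions: the imaginary direction of \<open>i0\<close> first, then the two directions
of each other coordinate. Only the real direction of \<open>i0\<close> is left out.\<close>

lemma real_basis_labels:
  fixes i0 :: 'n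
  assumes b: "bij_betw b {..<m} (UNIV - {i0})"
  defines "lab \<equiv> (\<lambda>i. case i of 0 \<Rightarrow> (i0, True) | Suc j \<Rightarrow> (b (j div 2), odd j))"
  shows "bij_betw lab {..2 * m} (UNIV - {(i0, False)})"
proof -
  have bne: "b l \<noteq> i0" if "l < m" for l using b that by (auto simp: bij_betw_def)
  have "inj_on lab {..2 * m}"
  proof (rule inj_onI)
    fix i i' assume ii: "i \<in> {..2 * m}" "i' \<in> {..2 * m}" "lab i = lab i'"
    show "i = i'"
    proof (cases i; cases i')
      fix j j' assume e: "i = Suc j" "i' = Suc j'"
      then have jm: "j div 2 < m" "j' div 2 < m" using ii by auto
      have "b (j div 2) = b (j' div 2)" "odd j = odd j'" using ii e by (auto simp: lab_def)
      then have "j div 2 = j' div 2" "odd j = odd j'" using jm b by (auto simp: bij_betw_def inj_on_def)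
      then have "j = j'" by presburger
      then show ?thesis using e by simp
    next
      fix j' assume "i = 0" "i' = Suc j'"
      then have "b (j' div 2) = i0" "j' div 2 < m" using ii by (auto simp: lab_def)
      then show ?thesis using bne by blast
    next
      fix j assume "i = Suc j" "i' = 0"
      then have "b (j div 2) = i0" "j div 2 < m" using ii by (auto simp: lab_def)
      then show ?thesis using bne by blast
    qed simp
  qed
  moreover have "lab ` {..2 * m} = UNIV - {(i0, False)}"
  proof (intro equalityI subsetI)
    fix p assume "p \<in> lab ` {..2 * m}"
    then obtain i where "i \<le> 2 * m" "p = lab i" by auto
    then show "p \<in> UNIV - {(i0, False)}" using bne[of "(i - 1) div 2"] by (cases i) (auto simp: lab_def)
  next
    fix p assume p: "p \<in> UNIV - {(i0, False)}"
    show "p \<in> lab ` {..2 * m}"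
    proof (cases "fst p = i0")
      case True
      then have "p = lab 0" using p by (cases p) (auto simp: lab_def)
      then show ?thesis by auto
    next
      case False
      then have "fst p \<in> b ` {..<m}" using b by (auto simp: bij_betw_def)
      then obtain l where l: "l < m" "fst p = b l" by auto
      have "p = lab (Suc (2 * l + (if snd p then 1 else 0)))" using l by (cases p) (auto simp: lab_def)
      then show ?thesis using l by (intro image_eqI[of _ _ "Suc (2 * l + (if snd p then 1 else 0))"]) auto
    qed
  qed
  ultimately show ?thesis by (simp add: bij_betw_def)
qed

lemma skip_image: "i \<le> n \<Longrightarrow> (\<lambda>j. if j < i then j else Suc j) ` {..<n} = {..n} - {i::nat}"
proof (intro equalityI subsetI)
  fix x assume i: "i \<le> n" and x: "x \<in> {..n} - {i}"
  show "x \<in> (\<lambda>j. if j < i then j else Suc j) ` {..<n}"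
  proof (cases "x < i")
    case True
    then show ?thesis using i x by (intro image_eqI[of _ _ x]) auto
  next
    case False
    then show ?thesis using i x by (intro image_eqI[of _ _ "x - 1"]) auto
  qed
qed auto

lemma cover_pos: 
  fixes z :: "complex ^ ('s::finite + 't::finite)"
  shows "z \<in> OT_cover \<Longrightarrow> Im (z $ Inl i) > 0"
  by (auto simp: OT_cover_def)

lemma heights_product_pos: "z \<in> OT_cover \<Longrightarrow> heights_product z > 0"
  unfolding heights_product_def by (intro prod_pos) (simp add: cover_pos)

lemma height_factor_cases:
  fixes p :: "('s::finite + 't::finite) \<times> bool"
  obtains i where "p = (Inl i, True)" "height_factor p = (\<lambda>z. Im (z $ Inl i))"
  | "\<And>i. p \<noteq> (Inl i, True)" "height_factor p = (\<lambda>z. 1)"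
proof (cases "\<exists>i. p = (Inl i, True)")
  case True
  then show ?thesis using that(1) by (auto simp: height_factor_def fun_eq_iff)
next
  case False
  then show ?thesis
    using that(2) by (cases p) (auto simp: height_factor_def fun_eq_iff split: sum.split bool.split)
qed

lemma height_factor_pos: "z \<in> OT_cover \<Longrightarrow> height_factor p z > 0"
  by (rule height_factor_cases[of p]) (auto simp: cover_pos)

lemma cover_nonzero: "z \<in> OT_cover \<Longrightarrow> Im (z $ Inl i) \<noteq> 0" "z \<in> OT_cover \<Longrightarrow> height_factor p z \<noteq> 0"
  using cover_pos[of z i] height_factor_pos[of z p] by auto

lemma continuous_on_heights:
  "continuous_on S heights_product" "continuous_on S (height_factor p)"
  unfolding heights_product_def
  by (intro continuous_intros) (rule height_factor_cases[of p]; simp; intro continuous_intros)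

text \<open>\<open>i0\<close> is the distinguished coordinate \<open>w\<^sub>0\<close>, and \<open>others\<close> lists the remaining ones. The dimension
\<open>m = n - 1\<close> is a parameter because locale constants cannot depend on the types alone.\<close>

locale balanced_frame = balanced_oeljeklaus_toma \<sigma> \<tau> U \<Omega>
  for \<sigma> :: "'s::finite \<Rightarrow> 'k::field_char_0 \<Rightarrow> real" and \<tau> :: "'t::finite \<Rightarrow> 'k \<Rightarrow> complex"
    and U :: "'k set" and \<Omega> :: "((complex ^ ('s + 't)) set, 's + 't) manifold_form" +
  fixes m :: nat and i0 :: 's and others :: "nat \<Rightarrow> 's + 't"
  assumes m: "m = CARD('s + 't) - 1" and others: "bij_betw others {..<m} (UNIV - {Inl i0})"
begin

abbreviation "\<beta> \<equiv> wedge_power 2 \<omega> m"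

lemma metric_power_alternating: "z \<in> OT_cover \<Longrightarrow> alternating_form (2 * m) (\<beta> z)"
  by (intro alternating_form_wedge_power pullback_alternating)

lemma metric_power_deck:
  assumes "u \<in> U" "a \<in> OK" "z \<in> OT_cover"
  shows "\<beta> z v = \<beta> (Tr a (Ro u z)) (\<lambda>i. Ro u (v i))"
  by (rule wedge_power_natural) (rule pullback_deck[OF assms])

lemma metric_power_C1: "C1_on OT_cover (\<lambda>z. \<beta> z v)"
  by (intro C1_on_wedge_power pullback_C1)

definition lab :: "nat \<Rightarrow> ('s + 't) \<times> bool" where
  "lab = (\<lambda>i. case i of 0 \<Rightarrow> (Inl i0, True) | Suc j \<Rightarrow> (others (j div 2), odd j))"

lemma lab: "bij_betw lab {..2 * m} (UNIV - {(Inl i0, False)})"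
  unfolding lab_def by (rule real_basis_labels[OF others])

definition "dir i = (real_basis_vector (lab i) :: complex ^ ('s + 't))"

definition "skip i j = (if j < i then j else Suc j :: nat)"

text \<open>The coefficient of \<open>\<Omega>\<^sup>n\<^sup>-\<^sup>1\<close> that belongs to all directions in the list except number \<open>i\<close>.\<close>

definition "minor i z = \<beta> z (\<lambda>j. dir (skip i j))"

text \<open>The component in direction \<open>i\<close> of the closed form \<open>\<Omega>\<^sup>n\<^sup>-\<^sup>1\<close>, multiplied by \<open>1 / y\<^sub>0\<close>, in the coordinates of
\<open>exp_chart\<close>: the volume is multiplied by the product of all heights, and the vector field is divided by
the stretching factor of the direction.\<close>

definition "flux i z = (- 1) ^ i * (heights_product z / (Im (z $ Inl i0) * height_factor (lab i) z)) * minor i z"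

lemma lab_0: "lab 0 = (Inl i0, True)" by (simp add: lab_def)

lemma minor_0_pos: assumes "z \<in> OT_cover" shows "minor 0 z > 0"
proof -
  have "minor 0 z = \<beta> z (complex_tuple (\<lambda>k. axis (others k) 1))"
    unfolding minor_def by (rule arg_cong[of _ _ "\<beta> z"])
      (auto simp: fun_eq_iff dir_def skip_def lab_def real_basis_vector_def complex_tuple_def)
  also have "\<dots> > 0"
    using others by (intro wedge_power_pos pullback_alternating pullback_hermitian assms) (auto simp: bij_betw_def)
  finally show ?thesis .
qed

lemma flux_0_pos: assumes "z \<in> OT_cover" shows "flux 0 z > 0"
  using minor_0_pos[OF assms] heights_product_pos[OF assms] height_factor_pos[OF assms, of "lab 0"] cover_pos[OF assms]
  by (simp add: flux_def)

lemma minor_C1: "C1_on OT_cover (minor i)"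
  unfolding minor_def by (rule metric_power_C1)

lemma continuous_on_flux: "continuous_on OT_cover (flux i)"
  unfolding flux_def
  by (intro continuous_intros continuous_on_heights C1_onD(3)[OF minor_C1])
    (simp add: cover_nonzero)

lemma flux_translation:
  assumes "a \<in> OK" "z \<in> OT_cover"
  shows "flux i (Tr a z) = flux i z"
proof -
  have "minor i (Tr a z) = minor i z"
    using metric_power_deck[OF admissibleD(2) assms] by (simp add: minor_def rotation_1)
  moreover have "Im (Tr a z $ Inl k) = Im (z $ Inl k)" for k
    by (simp add: OT_translation_conv conjugate_vector_def)
  ultimately show ?thesis
    by (simp add: flux_def heights_product_def height_factor_def split: prod.split sum.split bool.split)
qed

text \<open>The tuple of \<open>minor i\<close> misses one real direction of coordinate \<open>i0\<close> and one of coordinate \<open>q\<close>, or both directions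
of \<open>i0\<close> if \<open>q = i0\<close>. In both cases the determinant of the unit on the tuple is its full
real determinant, divided by \<open>\<sigma> i0 u\<close> and by \<open>\<sigma> q u\<close>. As the norm of \<open>u\<close> is 1, the full
determinant is the product of the real conjugates.\<close>

lemma minor_deck:
  assumes u: "u \<in> U" "a \<in> OK" "z \<in> OT_cover" and i: "i \<le> 2 * m" "lab i = (Inl q, True)"
  shows "minor i z = (\<Prod>k\<in>UNIV. \<sigma> k u) / (\<sigma> i0 u * \<sigma> q u) * minor i (Tr a (Ro u z))"
proof -
  let ?z = "Tr a (Ro u z)"
  have z: "?z \<in> OT_cover" by (rule deck_in_cover) (use u in auto)
  let ?lab = "\<lambda>j. lab (skip i j)"
  define \<mu> where "\<mu> k = conjugate_vector \<sigma> \<tau> u $ k" for k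
  \<comment> \<open>the determinant on line \<open>k\<close>, corrected for the missing directions; for \<open>q = i0\<close> the correction is squared\<close>
  define c where "c k = (cmod (\<mu> k))\<^sup>2 / ((if k = Inl i0 then \<sigma> i0 u else 1) * (if k = Inl q then \<sigma> q u else 1))" for k :: "'s + 't"
  have \<sigma>: "\<sigma> k u > 0" for k by (rule admissibleD(6)[OF u(1)])
  have \<mu>: "\<mu> (Inl k) = of_real (\<sigma> k u)" "\<mu> (Inr j) = \<tau> j u" for k j by (auto simp: \<mu>_def conjugate_vector_def)
  have lab': "inj_on lab {..2 * m}" "lab ` {..2 * m} = UNIV - {(Inl i0, False)}"
    using lab by (auto simp: bij_betw_def)
  have im: "?lab ` {..<2 * m} = UNIV - {(Inl i0, False), (Inl q, True)}"
  proof -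
    have "?lab ` {..<2 * m} = lab ` ({..2 * m} - {i})"
    proof -
      have "skip i ` {..<2 * m} = {..2 * m} - {i}"
        using skip_image[OF i(1)] unfolding skip_def .
      then show ?thesis by (metis image_image)
    qed
    also have "\<dots> = lab ` {..2 * m} - lab ` {i}"
      by (rule inj_on_image_set_diff[OF lab'(1)]) (use i in auto)
    also have "\<dots> = UNIV - {(Inl i0, False), (Inl q, True)}" unfolding lab'(2) using i by auto
    finally show ?thesis .
  qed
  have inj: "inj_on ?lab {..<2 * m}"
  proof -
    have "skip i j \<le> 2 * m" if "j < 2 * m" for j using that by (auto simp: skip_def)
    moreover have "inj (skip i)" by (auto simp: inj_def skip_def split: if_splits)
    ultimately show ?thesis using lab by (auto simp: bij_betw_def inj_on_def)
  qed
  have "minor i z = \<beta> ?z (\<lambda>j. Ro u (dir (skip i j)))"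
    unfolding minor_def by (rule metric_power_deck[OF u])
  also have "\<dots> = \<beta> ?z (\<lambda>j. \<chi> k. \<mu> k * real_basis_vector (?lab j) $ k)"
    by (simp add: OT_rotation_conv \<mu>_def dir_def)
  also have "\<dots> = (\<Prod>k\<in>UNIV. c k) * \<beta> ?z (\<lambda>j. real_basis_vector (?lab j))"
  proof (rule alternating_form_diagonal_scale[OF metric_power_alternating[OF z] inj], unfold im)
    fix k :: "'s + 't"
    have [simp]: "\<sigma> p u \<noteq> 0" for p using \<sigma>[of p] by simp
    show "if (k, True) \<in> UNIV - {(Inl i0, False), (Inl q, True)}
        then if (k, False) \<in> UNIV - {(Inl i0, False), (Inl q, True)} then c k = (cmod (\<mu> k))\<^sup>2
             else \<mu> k = complex_of_real (c k)
        else if (k, False) \<in> UNIV - {(Inl i0, False), (Inl q, True)} then \<mu> k = complex_of_real (c k)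
             else c k = 1"
      by (auto simp: c_def \<mu> power2_eq_square)
  qed
  also have "(\<Prod>k\<in>UNIV. c k) = (\<Prod>k\<in>UNIV. \<sigma> k u) / (\<sigma> i0 u * \<sigma> q u)"
  proof -
    have "(\<Prod>k\<in>UNIV. c k) = (\<Prod>k\<in>UNIV. (cmod (\<mu> k))\<^sup>2) / (\<sigma> i0 u * \<sigma> q u)"
      by (simp add: c_def prod_dividef prod.distrib)
    also have "(\<Prod>k\<in>UNIV. (cmod (\<mu> k))\<^sup>2) = (\<Prod>k\<in>UNIV. \<sigma> k u) * ((\<Prod>k\<in>UNIV. \<sigma> k u) * (\<Prod>j\<in>UNIV. (cmod (\<tau> j u))\<^sup>2))"
      by (simp add: prod_UNIV_sum \<mu> power2_eq_square[of "\<sigma> _ u"] prod.distrib)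
    also have "(\<Prod>k\<in>UNIV. \<sigma> k u) * (\<Prod>j\<in>UNIV. (cmod (\<tau> j u))\<^sup>2) = 1"
      by (rule unit_norm) (rule admissibleD(1)[OF u(1)])
    finally show ?thesis by simp
  qed
  finally show ?thesis by (simp add: minor_def dir_def)
qed

lemma flux_deck:
  assumes u: "u \<in> U" "a \<in> OK" "z \<in> OT_cover" and i: "i \<le> 2 * m" "lab i = (Inl q, True)"
  shows "flux i (Tr a (Ro u z)) = flux i z"
proof -
  let ?P = "\<Prod>k\<in>UNIV. \<sigma> k u"
  have \<sigma>: "\<sigma> k u > 0" for k by (rule admissibleD(6)[OF u(1)])
  have ne: "?P \<noteq> 0" "\<sigma> i0 u \<noteq> 0" "\<sigma> q u \<noteq> 0" using \<sigma> by (auto simp: less_imp_neq[symmetric])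
  have "heights_product (Tr a (Ro u z)) = ?P * heights_product z"
    by (simp add: heights_product_def Im_deck prod.distrib)
  moreover have "Im (Tr a (Ro u z) $ Inl i0) = \<sigma> i0 u * Im (z $ Inl i0)" by (simp add: Im_deck)
  moreover have "height_factor (lab i) (Tr a (Ro u z)) = \<sigma> q u * height_factor (lab i) z"
    by (simp add: i height_factor_def Im_deck)
  ultimately show ?thesis
    unfolding flux_def minor_deck[OF u i] using ne by (simp add: field_simps)
qed

definition "flux_deriv i w = (- 1) ^ i * (heights_product (exp_chart w) / Im (exp_chart w $ Inl i0)) *
    frechet_derivative (minor i) (at (exp_chart w)) (dir i) - (if i = 0 then flux 0 (exp_chart w) else 0)"

text \<open>The factor in front of \<open>minor i\<close> does not depend on the coordinate of direction \<open>i\<close>, because the stretching factor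
cancels the corresponding height in the product, except for \<open>i = 0\<close>, where the weight \<open>1 / y\<^sub>0\<close> remains
and contributes the term \<open>- flux 0\<close>.\<close>

lemma flux_has_derivative:
  assumes i: "i \<le> 2 * m"
  shows "((\<lambda>t. flux i (exp_chart (w + t *\<^sub>R dir i))) has_real_derivative flux_deriv i w) (at 0)"
proof -
  let ?s = "height_factor (lab i) (exp_chart w)"
  let ?W = "heights_product (exp_chart w) / (Im (exp_chart w $ Inl i0) * ?s)"
  let ?D = "frechet_derivative (minor i) (at (exp_chart w))"
  have s: "?s > 0" by (rule height_factor_pos[OF exp_chart_in_cover])
  have l0: "lab i = (Inl i0, True) \<longleftrightarrow> i = 0"
    using lab i lab_0 by (auto simp: bij_betw_def inj_on_def)
  have W: "heights_product (exp_chart (w + t *\<^sub>R dir i)) / (Im (exp_chart (w + t *\<^sub>R dir i) $ Inl i0) * height_factor (lab i) (exp_chart (w + t *\<^sub>R dir i)))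
     = ?W * (if i = 0 then exp (- t) else 1)" for t
    unfolding dir_def heights_product_exp_chart height_factor_exp_chart height_exp_chart l0
    by (auto simp: exp_minus field_simps)
  have "((\<lambda>t. minor i (exp_chart (w + t *\<^sub>R dir i))) has_derivative (\<lambda>t. ?D (t *\<^sub>R (?s *\<^sub>R dir i)))) (at 0)"
    using has_derivative_compose[OF exp_chart_derivative[of w "lab i"], of "minor i" ?D]
      C1_onD(1)[OF minor_C1 exp_chart_in_cover, of i w] unfolding dir_def by simp
  moreover have "?D (t *\<^sub>R (?s *\<^sub>R dir i)) = ?s * ?D (dir i) * t" for t
    using C1_onD(1)[OF minor_C1 exp_chart_in_cover, of i w]
    by (simp add: linear_scale[OF has_derivative_linear] mult.commute)
  ultimately have der: "((\<lambda>t. minor i (exp_chart (w + t *\<^sub>R dir i))) has_real_derivative ?s * ?D (dir i)) (at 0)"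
    by (simp add: has_field_derivative_def)
  have eq: "flux i (exp_chart (w + t *\<^sub>R dir i)) = (- 1) ^ i * ?W * (if i = 0 then exp (- t) else 1) * minor i (exp_chart (w + t *\<^sub>R dir i))" for t
    unfolding flux_def W by simp
  have e: "((\<lambda>t. (if i = 0 then exp (- t) else 1)) has_real_derivative (if i = 0 then - 1 else 0)) (at 0)"
    by (auto intro!: derivative_eq_intros)
  have "((\<lambda>t. (- 1) ^ i * ?W * ((if i = 0 then exp (- t) else 1) * minor i (exp_chart (w + t *\<^sub>R dir i)))) has_real_derivative
      (- 1) ^ i * ?W * ((if i = 0 then - 1 else 0) * minor i (exp_chart (w + 0 *\<^sub>R dir i)) + ?s * ?D (dir i) * (if i = 0 then exp (- 0) else 1))) (at 0)"
    by (intro DERIV_cmult DERIV_mult e der)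
  moreover have "(- 1) ^ i * ?W * ((if i = 0 then - 1 else 0) * minor i (exp_chart (w + 0 *\<^sub>R dir i)) + ?s * ?D (dir i) * (if i = 0 then exp (- 0) else 1))
     = flux_deriv i w"
    using s cover_nonzero(1)[OF exp_chart_in_cover, of w i0]
    by (auto simp: flux_deriv_def flux_def field_simps)
  ultimately show ?thesis unfolding eq by (simp add: mult.assoc)
qed

text \<open>This is \<open>d\<Omega>\<^sup>n\<^sup>-\<^sup>1 = 0\<close>, evaluated on all real directions except the real one of \<open>i0\<close>.\<close>

lemma sum_flux_deriv: "(\<Sum>i\<le>2 * m. flux_deriv i w) = - flux 0 (exp_chart w)"
proof -
  let ?z = "exp_chart w"
  have "ext_deriv (2 * m) \<beta> ?z dir = 0" unfolding m by (rule pullback_closed[OF exp_chart_in_cover])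
  then have 0: "(\<Sum>i\<le>2 * m. (- 1) ^ i * frechet_derivative (minor i) (at ?z) (dir i)) = 0"
    unfolding ext_deriv_def minor_def skip_def if_distrib[of dir] by simp
  have "(\<Sum>i\<le>2 * m. flux_deriv i w) = heights_product ?z / Im (?z $ Inl i0) * (\<Sum>i\<le>2 * m. (- 1) ^ i * frechet_derivative (minor i) (at ?z) (dir i))
     - flux 0 ?z"
    by (simp add: flux_deriv_def sum_subtractf sum_distrib_left mult.assoc mult.left_commute)
  then show ?thesis by (simp only: 0)
qed

lemma continuous_on_flux_deriv: "continuous_on UNIV (flux_deriv i)"
proof -
  have c: "continuous_on UNIV (\<lambda>w. F (exp_chart w))" if "continuous_on OT_cover F" for F :: "complex ^ ('s + 't) \<Rightarrow> real"
    by (rule continuous_on_compose2[OF that continuous_on_exp_chart]) (auto intro: exp_chart_in_cover)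
  have "continuous_on OT_cover (\<lambda>z. (- 1) ^ i * (heights_product z / Im (z $ Inl i0)) *
    frechet_derivative (minor i) (at z) (dir i) - (if i = 0 then flux 0 z else 0))"
    by (cases "i = 0"; simp only: if_True if_False; intro continuous_intros continuous_on_heights continuous_on_flux C1_onD(2)[OF minor_C1])
      (auto simp: cover_nonzero continuous_on_flux)
  from c[OF this] show ?thesis by (simp add: flux_deriv_def[abs_def])
qed

text \<open>The directions of the coordinates \<open>log y\<^sub>q\<close>.\<close>

definition "vertical i \<longleftrightarrow> (\<exists>q. lab i = (Inl q, True))"

text \<open>Only the vertical sides of a box change the heights, so the bound is independent of the
other side lengths.\<close>

lemma log_height_box:
  assumes t: "\<And>i. i \<le> 2 * m \<Longrightarrow> vertical i \<Longrightarrow> 0 \<le> t i \<and> t i \<le> S"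
  shows "norm (log_height (exp_chart (\<Sum>i\<le>2 * m. t i *\<^sub>R dir i))) \<le> real CARD('s) * (real (Suc (2 * m)) * S)"
proof -
  have S: "0 \<le> S" using t[of 0] lab_0 by (auto simp: vertical_def)
  have "\<bar>Im ((\<Sum>i\<le>2 * m. t i *\<^sub>R dir i) $ Inl k)\<bar> \<le> real (Suc (2 * m)) * S" for k
  proof -
    have "\<bar>t i * Im (dir i $ Inl k)\<bar> \<le> S" if "i \<le> 2 * m" for i
    proof (cases "vertical i")
      case True
      then show ?thesis using t[OF that] S
        by (cases "lab i") (auto simp: dir_def real_basis_vector_def axis_def)
    next
      case False
      then have "Im (dir i $ Inl k) = 0"
        by (cases "lab i") (auto simp: dir_def real_basis_vector_def axis_def vertical_def)
      then show ?thesis using S by simp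
    qed
    then have "(\<Sum>i\<le>2 * m. \<bar>t i * Im (dir i $ Inl k)\<bar>) \<le> of_nat (card {..2 * m}) * S"
      by (intro sum_bounded_above) auto
    then have "\<bar>\<Sum>i\<le>2 * m. t i * Im (dir i $ Inl k)\<bar> \<le> of_nat (card {..2 * m}) * S"
      by (rule order_trans[OF sum_abs])
    then show ?thesis by (simp add: sum_component)
  qed
  then have "(\<Sum>k\<in>UNIV. \<bar>log_height (exp_chart (\<Sum>i\<le>2 * m. t i *\<^sub>R dir i)) $ k\<bar>) \<le> of_nat (card (UNIV :: 's set)) * (real (Suc (2 * m)) * S)"
    unfolding log_height_exp_chart by (intro sum_bounded_above) auto
  then show ?thesis using norm_le_l1_cart order_trans by blast
qed

lemma no_balanced_frame: False
proof -
  let ?I = "{..2 * m}"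
  have v0: "vertical 0" using lab_0 by (auto simp: vertical_def)
  obtain c where c: "c > 0" "\<And>z. z \<in> OT_cover \<Longrightarrow> flux 0 z \<ge> c"
  proof (rule deck_invariant_bounded_below[OF continuous_on_flux[of 0]])
    show "flux 0 (Tr a (Ro u z)) = flux 0 z" if "u \<in> U" "a \<in> OK" "z \<in> OT_cover" for u a z
      using flux_deck[OF that] lab_0 by auto
  qed (auto intro: flux_0_pos)
  have "\<exists>C. \<forall>z\<in>OT_cover. \<bar>flux i z\<bar> \<le> C" if "i \<le> 2 * m" "vertical i" for i
  proof -
    obtain q where q: "lab i = (Inl q, True)" using \<open>vertical i\<close> by (auto simp: vertical_def)
    have "flux i (Tr a (Ro u z)) = flux i z" if "u \<in> U" "a \<in> OK" "z \<in> OT_cover" for u a z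
      by (rule flux_deck[OF that \<open>i \<le> 2 * m\<close> q])
    then show ?thesis by (rule deck_invariant_bounded[OF continuous_on_flux[of i]]) blast+
  qed
  then obtain A where A: "\<And>i z. i \<le> 2 * m \<Longrightarrow> vertical i \<Longrightarrow> z \<in> OT_cover \<Longrightarrow> \<bar>flux i z\<bar> \<le> A i" by metis
  define a where "a = (\<Sum>i\<in>?I. 2 * \<bar>A i\<bar>)"
  have a: "a \<ge> 0" by (auto simp: a_def intro: sum_nonneg)
  \<comment> \<open>large enough for the vertical faces to contribute less than \<open>c / 2\<close>\<close>
  define S where "S = 2 * (2 * a + 1) / c"
  have S: "S > 0" using a c by (simp add: S_def)
  have "\<exists>C. \<forall>z. z \<in> OT_cover \<longrightarrow> norm (log_height z) \<le> real CARD('s) * (real (Suc (2 * m)) * S) \<longrightarrow> \<bar>flux i z\<bar> \<le> C" for i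
    by (rule translation_invariant_bounded[OF continuous_on_flux[of i] flux_translation]) blast+
  then obtain B where B: "\<And>i z. z \<in> OT_cover \<Longrightarrow> norm (log_height z) \<le> real CARD('s) * (real (Suc (2 * m)) * S) \<Longrightarrow> \<bar>flux i z\<bar> \<le> B i"
    by metis
  define b where "b = (\<Sum>i\<in>?I. 2 * \<bar>B i\<bar>)"
  have b: "b \<ge> 0" by (auto simp: b_def intro: sum_nonneg)
  \<comment> \<open>the bounds \<open>B\<close> depend on \<open>S\<close>, so the other sides are chosen after it\<close>
  define R where "R = 2 * (2 * b + 1) / c"
  have R: "R > 0" using b c by (simp add: R_def)
  define L where "L i = (if vertical i then S else R)" for i
  define C where "C i = (if vertical i then \<bar>A i\<bar> else \<bar>B i\<bar>)" for i
  have "c \<le> (\<Sum>i\<in>?I. 2 * C i / L i)"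
  proof (rule flux_bound[where h = "\<lambda>i w. - flux i (exp_chart w)" and D = "\<lambda>i w. - flux_deriv i w" and d = dir and ?x0.0 = 0])
    fix i assume "i \<in> ?I"
    then have i: "i \<le> 2 * m" by simp
    show "L i > 0" using S R by (simp add: L_def)
    show "continuous_on UNIV (\<lambda>w. - flux i (exp_chart w))"
      by (intro continuous_on_minus continuous_on_compose2[OF continuous_on_flux continuous_on_exp_chart]) (auto intro: exp_chart_in_cover)
    show "continuous_on UNIV (\<lambda>w. - flux_deriv i w)" by (intro continuous_on_minus continuous_on_flux_deriv)
    show "((\<lambda>t. - flux i (exp_chart (x + t *\<^sub>R dir i))) has_real_derivative - flux_deriv i x) (at 0)" for x
      by (intro DERIV_minus flux_has_derivative[OF i])
    fix t :: "nat \<Rightarrow> real" assume t: "\<And>k. k \<in> ?I \<Longrightarrow> 0 \<le> t k \<and> t k \<le> L k"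
    let ?z = "exp_chart (0 + (\<Sum>k\<in>?I. t k *\<^sub>R dir k))"
    have "norm (log_height ?z) \<le> real CARD('s) * (real (Suc (2 * m)) * S)"
      unfolding add_0_left
    proof (rule log_height_box)
      show "0 \<le> t i \<and> t i \<le> S" if "i \<le> 2 * m" "vertical i" for i
        using t[of i] that by (simp add: L_def)
    qed
    then have "\<bar>flux i ?z\<bar> \<le> B i" by (rule B[OF exp_chart_in_cover])
    moreover have "vertical i \<Longrightarrow> \<bar>flux i ?z\<bar> \<le> A i" by (rule A[OF i _ exp_chart_in_cover])
    ultimately show "\<bar>- flux i ?z\<bar> \<le> C i" by (auto simp: C_def)
  next
    fix t :: "nat \<Rightarrow> real"
    show "c \<le> (\<Sum>i\<in>?I. - flux_deriv i (0 + (\<Sum>k\<in>?I. t k *\<^sub>R dir k)))"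
      unfolding sum_negf sum_flux_deriv using c(2)[OF exp_chart_in_cover] by simp
  qed simp
  also have "\<dots> \<le> (\<Sum>i\<in>?I. 2 * \<bar>A i\<bar> / S + 2 * \<bar>B i\<bar> / R)"
    using S R by (intro sum_mono) (auto simp: C_def L_def)
  also have "\<dots> = a / S + b / R" by (simp add: a_def b_def sum.distrib sum_divide_distrib)
  also have "a / S < c / 2"
  proof -
    have "c * S = 2 * (2 * a + 1)" using c by (simp add: S_def)
    then show ?thesis using S a by (simp add: pos_divide_less_eq)
  qed
  also have "b / R < c / 2"
  proof -
    have "c * R = 2 * (2 * b + 1)" using c by (simp add: R_def)
    then show ?thesis using R b by (simp add: pos_divide_less_eq)
  qed
  finally show False by simp
qed

end

theorem theorem1p2:
  fixes \<sigma> :: "'s::finite \<Rightarrow> 'k::field_char_0 \<Rightarrow> real"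
    and \<tau> :: "'t::finite \<Rightarrow> 'k \<Rightarrow> complex"
    and U :: "'k set"
  assumes "number_field_embeddings \<sigma> \<tau>"
    and "admissible \<sigma> \<tau> U"
  shows "\<not> (\<exists>\<Omega>. balanced_metric (OT_atlas \<sigma> \<tau> U) \<Omega>)"
proof
  assume "\<exists>\<Omega>. balanced_metric (OT_atlas \<sigma> \<tau> U) \<Omega>"
  then obtain \<Omega> where "balanced_metric (OT_atlas \<sigma> \<tau> U) \<Omega>" ..
  then interpret balanced_oeljeklaus_toma \<sigma> \<tau> U \<Omega>
    using assms by unfold_locales
  have "card (UNIV - {Inl undefined :: 's + 't}) = CARD('s + 't) - 1" by (simp add: card_Diff_singleton)
  then obtain b where "bij_betw b {..<CARD('s + 't) - 1} (UNIV - {Inl undefined :: 's + 't})"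
    using ex_bij_betw_nat_finite[of "UNIV - {Inl undefined :: 's + 't}"] by (auto simp: atLeast0LessThan)
  then interpret balanced_frame \<sigma> \<tau> U \<Omega> "CARD('s + 't) - 1" undefined b
    by unfold_locales simp
  show False by (rule no_balanced_frame)
qed

end
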